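(* Let $N\cong\mathbb{Z}^2$, $M=\operatorname{Hom}(N,\mathbb{Z})$, and let $P\subset N\otimes\mathbb{Q}$ be a Fano polygon, with dual polygon $P^*=\{u\in M\otimes\mathbb{Q}\mid u(v)\geq -1 \text{ for all } v\in P\}$. Let the cones over the edges of $P$ be $\sigma_1,\dots,\sigma_n$, let $(d,\mathcal{B})$ be the singularity content of $P$, let $\mathcal{IB}\subseteq\mathcal{B}$ be a choice of invisible basket with corresponding reduced basket $\mathcal{RB}=\mathcal{B}\setminus\mathcal{IB}$, and let $\mathcal{T}$ be the multiset of $T$-singularities of $P$ (as defined in the context). Then the quasi-period of $P^*$ is \[ \pi_{P^*}=\operatorname{lcm}\{\ell_\sigma\mid \sigma\in\mathcal{RB}\}, \] (with $\operatorname{lcm}\emptyset=1$). Furthermore, $P^*$ exhibits quasi-period collapse (i.e. $\pi_{P^*}\neq r_{P^*}$) if and only if there exists some $\tau\in\mathcal{IB}\cup\mathcal{T}$ whose local index does not divide $\operatorname{lcm}\{\ell_\sigma\mid\sigma\in\mathcal{RB}\}$. Moreover, \[ r_{P^*}=\operatorname{lcm}\big(\{\pi_{P^*}\}\cup\{\ell_\sigma\mid \sigma\in\mathcal{IB}\cup\mathcal{T}\}\big). \]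
   Context: A lattice polygon $P\subset N\otimes\mathbb{Q}$ is Fano if it is two-dimensional, contains the origin in its strict interior, and its vertices are primitive lattice points. For a rational polytope $Q$, $L_Q(k)=|kQ\cap\mathbb{Z}^2|$ is a quasi-polynomial in $k$ (Ehrhart quasi-polynomial); its minimal period is the quasi-period $\pi_Q$, and the denominator $r_Q$ is the smallest positive integer with $r_QQ$ a lattice polytope. "Quasi-period collapse" means $\pi_Q\neq r_Q$. Cones: a cone $\sigma$ over an edge $E$ of $P$ is spanned by the two primitive endpoints of $E$; it corresponds to a cyclic quotient singularity $\frac{1}{R}(1,a)$ (the cone $\operatorname{cone}(e_2,Re_1-ae_2)$ up to $\mathrm{GL}_2(\mathbb{Z})$). Its local index $\ell_\sigma$ is the lattice height of $E$ above the origin (equal to $R/\gcd(R,a+1)$), and its width $k$ is the number of unit lattice segments on $E$ (equal to $\gcd(R,a+1)$). Write $k=d_\sigma\ell_\sigma+r$ with $0\le r<\ell_\sigma$. If $r\neq0$ the residue $\operatorname{res}(\sigma)$ is the cyclic quotient singularity $\frac{1}{r\ell_\sigma}(1,rc/k-1)$, where $\sigma$ is $\frac{1}{R}(1,c-1)$; it has local index $\ell_\sigma$ and width $r<\ell_\sigma$ (an $R$-singularity, i.e. width less than local index). If $r=0$ the residue is empty. The singularity content of $P$ is $(d,\mathcal{B})$ with $d=\sum_i d_{\sigma_i}$ and $\mathcal{B}$ the multiset of nonempty residues $\operatorname{res}(\sigma_i)$ (the basket). The multiset $\mathcal{T}$ of $T$-singularities consists, for each cone $\sigma_i$, of $d_{\sigma_i}$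 copies of a $T$-singularity of local index $\ell_{\sigma_i}$ (so $|\mathcal{T}|=d$; $T$-singularities are cyclic quotient singularities $\frac{1}{dn^2}(1,dnc-1)$, $\gcd(n,c)=1$, equivalently width divisible by local index; smooth cones count as $T$-singularities of local index $1$). Orbifold correction terms: to each $R$-singularity $\sigma$ is attached a rational function $Q_\sigma(t)$ with denominator $1-t^{\ell_\sigma}$ (Akhtar–Kasprzyk) such that for an orbifold del Pezzo surface $X$ with basket $\mathcal{B}$ the anticanonical Hilbert series is $\frac{1+(K_X^2-2)t+t^2}{(1-t)^3}+\sum_{\sigma\in\mathcal{B}}Q_\sigma$; e.g. $Q_{\frac13(1,1)}=\frac{-t}{3(1-t^3)}$. For the toric surface $X_P$, this Hilbert series equals the Ehrhart series $\sum_{k\ge0}L_{P^*}(k)t^k$, and the Gorenstein index of $X_P$ equals $r_{P^*}$. A collection $\sigma_1,\dots,\sigma_m$ of $R$-singularities is a cancelling tuple if $Q_{\sigma_1}+\cdots+Q_{\sigma_m}=0$; a collection is invisible if it is a union of cancelling tuples. An invisible basket $\mathcal{IB}$ is a maximal invisible sub-multiset of $\mathcal{B}$, and $\mathcal{RB}=\mathcal{B}\setminus\mathcal{IB}$ is the corresponding reduced basket. *)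

theory Defs
  imports
    "HOL-Analysis.Analysis"
    "HOL-Library.Multiset"
    "HOL-Number_Theory.Cong"
    "HOL-Computational_Algebra.Polynomial"
    "HOL-Computational_Algebra.Fraction_Field"
begin

text \<open>
  Both lattices \<open>N\<close> and \<open>M = Hom(N, \<int>)\<close> are identified with the integer points of
  \<open>real ^ 2\<close>, the pairing of \<open>M\<close> and \<open>N\<close> being the inner product. Polygons live in
  \<open>N \<otimes> \<real>\<close>, so that the convex geometry of the library applies; a lattice polygon in
  \<open>N \<otimes> \<rat>\<close> and its real counterpart determine each other.
\<close>

definition int_lattice :: "(real ^ 2) set" where
  "int_lattice = {x. \<forall>i. x $ i \<in> \<int>}"

definition primitive :: "real ^ 2 \<Rightarrow> bool" where
  "primitive v \<longleftrightarrow> (\<exists>x y :: int. coprime x y \<and> v = vector [of_int x, of_int y])"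

definition lattice_polytope :: "(real ^ 2) set \<Rightarrow> bool" where
  "lattice_polytope S \<longleftrightarrow> (\<exists>V. finite V \<and> V \<subseteq> int_lattice \<and> S = convex hull V)"

definition fano_polygon :: "(real ^ 2) set \<Rightarrow> bool" where
  "fano_polygon P \<longleftrightarrow> lattice_polytope P \<and> aff_dim P = 2 \<and> 0 \<in> interior P \<and>
     (\<forall>v. v extreme_point_of P \<longrightarrow> primitive v)"

definition dual_polygon :: "(real ^ 2) set \<Rightarrow> (real ^ 2) set" where
  "dual_polygon P = {u. \<forall>v\<in>P. u \<bullet> v \<ge> -1}"


section \<open>Ehrhart quasi-polynomials\<close>

definition ehrhart :: "(real ^ 2) set \<Rightarrow> nat \<Rightarrow> nat" where
  "ehrhart S k = card ((\<lambda>x. real k *\<^sub>R x) ` S \<inter> int_lattice)"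

definition quasi_polynomial_of_period :: "(nat \<Rightarrow> nat) \<Rightarrow> nat \<Rightarrow> bool" where
  "quasi_polynomial_of_period f p \<longleftrightarrow>
     (\<exists>n (c :: nat \<Rightarrow> nat \<Rightarrow> real). (\<forall>i k. c i (k + p) = c i k) \<and>
        (\<forall>k. real (f k) = (\<Sum>i\<le>n. c i k * real k ^ i)))"

definition quasi_period :: "(real ^ 2) set \<Rightarrow> nat" where
  "quasi_period S = (LEAST p. p > 0 \<and> quasi_polynomial_of_period (ehrhart S) p)"

definition denominator :: "(real ^ 2) set \<Rightarrow> nat" where
  "denominator S = (LEAST r. r > 0 \<and> lattice_polytope ((\<lambda>x. real r *\<^sub>R x) ` S))"

definition quasi_period_collapse :: "(real ^ 2) set \<Rightarrow> bool" where
  "quasi_period_collapse S \<longleftrightarrow> quasi_period S \<noteq> denominator S"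


section \<open>Cyclic quotient singularities\<close>

text \<open>
  The singularity \<open>1/R(1,a)\<close>, with \<open>R\<close> and \<open>a\<close> coprime, depends only on \<open>a\<close> modulo \<open>R\<close>, and
  \<open>1/R(1,a)\<close> is isomorphic to \<open>1/R(1,b)\<close> if \<open>a * b\<close> is congruent to \<open>1\<close> modulo \<open>R\<close>.
  Singularities are recorded up to isomorphism, by the pair \<open>(R, a)\<close> with the least
  possible \<open>a\<close>; \<open>cqs R a\<close> is this representative. The smooth germ is \<open>(1, 0)\<close>.
\<close>

type_synonym singularity = "nat \<times> nat"

definition cqs :: "nat \<Rightarrow> nat \<Rightarrow> singularity" where
  "cqs R a = (R, LEAST b. [b = a] (mod R) \<or> [a * b = 1] (mod R))"

definition model_generators :: "nat \<Rightarrow> nat \<Rightarrow> (real ^ 2) set" where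
  "model_generators R a = {vector [0, 1], vector [real R, - real a]}"

definition unimodular :: "real ^ 2 ^ 2 \<Rightarrow> bool" where
  "unimodular A \<longleftrightarrow> (\<forall>i j. A $ i $ j \<in> \<int>) \<and> (det A = 1 \<or> det A = -1)"

definition cone_singularity :: "(real ^ 2) set \<Rightarrow> singularity" where
  "cone_singularity \<sigma> = (THE s. \<exists>R a. R > 0 \<and> coprime R a \<and> s = cqs R a \<and>
     (\<exists>A. unimodular A \<and> (*v) A ` \<sigma> = convex_cone hull (model_generators R a)))"

definition lattice_height :: "(real ^ 2) set \<Rightarrow> nat" where
  "lattice_height E = (THE h. h > 0 \<and> (\<exists>u. primitive u \<and> (\<forall>v\<in>E. u \<bullet> v = real h)))"

definition lattice_length :: "(real ^ 2) set \<Rightarrow> nat" where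
  "lattice_length E = card (E \<inter> int_lattice) - 1"

text \<open>
  Local index and width are invariant under \<open>GL(2, \<int>)\<close>, hence may be read off from the
  edge of the model cone. They equal \<open>R div gcd R (a + 1)\<close> and \<open>gcd R (a + 1)\<close>, see
  \<open>local_index_eq\<close> and \<open>width_eq\<close> below.
\<close>

fun local_index :: "singularity \<Rightarrow> nat" where
  "local_index (R, a) = lattice_height (convex hull (model_generators R a))"

fun width :: "singularity \<Rightarrow> nat" where
  "width (R, a) = lattice_length (convex hull (model_generators R a))"

definition R_singularity :: "singularity \<Rightarrow> bool" where
  "R_singularity s \<longleftrightarrow> width s < local_index s"

definition T_multiplicity :: "singularity \<Rightarrow> nat" where
  "T_multiplicity s = width s div local_index s"

text \<open>
  Below, \<open>1/R(1,a)\<close> is written \<open>1/R(1,c-1)\<close> with \<open>c = a + 1\<close>; the width \<open>gcd R c\<close> divides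
  \<open>c\<close>, so the divisions are exact. \<open>T_part s\<close> is the \<open>T\<close>-singularity
  \<open>1/\<ell>\<^sup>2(1, \<ell>c/k - 1)\<close> that can be split off from a singularity of local index \<open>\<ell>\<close>
  and width \<open>k\<close>, \<open>T_multiplicity s\<close> times.
\<close>

fun residue :: "singularity \<Rightarrow> singularity" where
  "residue (R, a) =
     (let l = local_index (R, a); k = width (R, a); r = k mod l
      in cqs (r * l) (r * (a + 1) div k - 1))"

fun T_part :: "singularity \<Rightarrow> singularity" where
  "T_part (R, a) =
     (let l = local_index (R, a); k = width (R, a)
      in cqs (l * l) (l * (a + 1) div k - 1))"


section \<open>Singularity content\<close>

definition cones :: "(real ^ 2) set \<Rightarrow> singularity multiset" where
  "cones P = image_mset (\<lambda>E. cone_singularity (conic hull E)) (mset_set {E. E edge_of P})"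

definition basket :: "(real ^ 2) set \<Rightarrow> singularity multiset" where
  "basket P = image_mset residue {#s \<in># cones P. width s mod local_index s \<noteq> 0#}"

definition singularity_content :: "(real ^ 2) set \<Rightarrow> nat \<times> singularity multiset" where
  "singularity_content P = ((\<Sum>s\<in>#cones P. T_multiplicity s), basket P)"

definition T_singularities :: "(real ^ 2) set \<Rightarrow> singularity multiset" where
  "T_singularities P = (\<Sum>s\<in>#cones P. replicate_mset (T_multiplicity s) (T_part s))"


section \<open>Orbifold correction terms\<close>

definition dedekind_sum :: "nat \<Rightarrow> nat \<Rightarrow> nat \<Rightarrow> complex" where
  "dedekind_sum R a j =
     (\<Sum>\<epsilon>\<in>{\<epsilon>. \<epsilon> ^ R = 1 \<and> \<epsilon> \<noteq> 1}. \<epsilon> ^ j / ((1 - \<epsilon>) * (1 - \<epsilon> ^ a))) / of_nat R"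

text \<open>
  This is the formula of Akhtar and Kasprzyk. They sum over \<open>1 \<le> i \<le> R\<close> and divide by
  \<open>1 - t ^ R\<close>, which gives the same rational function, as \<open>dedekind_sum R a (c * i)\<close> has period
  \<open>R div gcd R c\<close>, the local index, in \<open>i\<close>.
\<close>

fun orbifold_correction :: "singularity \<Rightarrow> complex poly fract" where
  "orbifold_correction (R, a) =
     (let l = local_index (R, a); c = a + 1
      in Fraction_Field.Fract
           (\<Sum>i = 1..l. monom (dedekind_sum R a (c * i) - dedekind_sum R a 0) (i - 1))
           (1 - monom 1 l))"

definition cancelling_tuple :: "singularity multiset \<Rightarrow> bool" where
  "cancelling_tuple A \<longleftrightarrow> A \<noteq> {#} \<and> (\<forall>s\<in>#A. R_singularity s) \<and>
     (\<Sum>s\<in>#A. orbifold_correction s) = 0"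

definition invisible :: "singularity multiset \<Rightarrow> bool" where
  "invisible A \<longleftrightarrow> (\<exists>\<C>. (\<forall>C\<in>#\<C>. cancelling_tuple C) \<and> A = sum_mset \<C>)"

definition invisible_basket :: "singularity multiset \<Rightarrow> singularity multiset \<Rightarrow> bool" where
  "invisible_basket IB B \<longleftrightarrow> IB \<subseteq># B \<and> invisible IB \<and>
     (\<forall>A. A \<subseteq># B \<and> invisible A \<and> IB \<subseteq># A \<longrightarrow> A = IB)"


section \<open>Closed formulas for local index and width\<close>

lemma local_index_eq:
  assumes "R > 0"
  shows "local_index (R, a) = R div gcd R (a + 1)"
proof -
  define g where "g = gcd R (a + 1)"
  have g0: "g > 0" using assms by (simp add: g_def)
  obtain p where p: "R = g * p" unfolding g_def by (metis gcd_dvd1 dvdE)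
  obtain q where q: "a + 1 = g * q" unfolding g_def by (metis gcd_dvd2 dvdE)
  have cop: "coprime p q"
    using g0 p q unfolding g_def by (metis gcd_mult_distrib_nat mult.right_neutral mult_left_cancel coprime_iff_gcd_eq_1 gr0_implies_Suc nat.distinct(1))
  have p0: "p > 0" using assms p by (cases p) auto
  have aR: "real a + 1 = real g * real q" by (metis of_nat_Suc of_nat_mult q Suc_eq_plus1 add.commute)
  have ip: "u \<bullet> vector [x, y] = u $ 1 * x + u $ 2 * y" for u :: "real ^ 2" and x y
    by (simp add: inner_vec_def sum_2)
  have edge: "(\<forall>v\<in>convex hull (model_generators R a). u \<bullet> v = c) \<longleftrightarrow>
      u $ 2 = c \<and> u $ 1 * real R - u $ 2 * real a = c" for u c
  proof -
    have "(\<forall>v\<in>convex hull S. u \<bullet> v = c) \<longleftrightarrow> (\<forall>v\<in>S. u \<bullet> v = c)" for S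
    proof
      assume "\<forall>v\<in>S. u \<bullet> v = c"
      then have "S \<subseteq> {v. u \<bullet> v = c}" by auto
      then have "convex hull S \<subseteq> {v. u \<bullet> v = c}"
        by (simp add: convex_hyperplane hull_minimal)
      then show "\<forall>v\<in>convex hull S. u \<bullet> v = c" by auto
    qed (auto intro: hull_inc)
    then show ?thesis by (simp add: model_generators_def ip)
  qed
  have "lattice_height (convex hull (model_generators R a)) = p"
    unfolding lattice_height_def edge
  proof (rule the_equality)
    have "primitive (vector [of_int (int q), of_int (int p)])"
      unfolding primitive_def using cop by (metis coprime_int_iff coprime_commute)
    moreover have "real q * real R - real p * real a = real p"
    proof -
      have "real p * (real a + 1) = real q * real R" unfolding aR p by simp
      then show ?thesis by (simp add: algebra_simps)
    qed
    ultimately show "0 < p \<and> (\<exists>u. primitive u \<and> u $ 2 = real p \<and> u $ 1 * real R - u $ 2 * real a = real p)"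
      using p0 by (intro conjI exI[of _ "vector [of_int (int q), of_int (int p)]"]) auto
  next
    fix h assume h: "0 < h \<and> (\<exists>u. primitive u \<and> u $ 2 = real h \<and> u $ 1 * real R - u $ 2 * real a = real h)"
    then obtain x y :: int where xy: "coprime x y" "of_int y = real h"
      "of_int x * real R - of_int y * real a = real h"
      unfolding primitive_def by auto
    have "real_of_int (x * int R) = of_int (int h * (int a + 1))"
      using xy(2,3) by (simp add: algebra_simps)
    then have "x * int R = int h * (int a + 1)" by linarith
    then have "x * (int g * int p) = int h * (int g * int q)"
      using p q by (metis of_nat_1 of_nat_add of_nat_mult)
    then have e: "x * int p = int h * int q" using g0 by simp
    have "y = int h" using xy(2) by linarith
    then have c: "coprime x (int h)" using xy(1) by simp
    have "int h dvd x * int p" "int p dvd int h * int q" unfolding e by (simp, simp add: e[symmetric])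
    then have "int h dvd int p" "int p dvd int h"
      using c cop by (metis coprime_commute coprime_dvd_mult_right_iff,
        metis coprime_dvd_mult_left_iff coprime_int_iff)
    then show "h = p" by (simp add: dvd_antisym)
  qed
  moreover have "R div gcd R (a + 1) = p" unfolding g_def[symmetric] using p g0 by simp
  ultimately show ?thesis by simp
qed

lemma width_eq:
  assumes "R > 0"
  shows "width (R, a) = gcd R (a + 1)"
proof -
  define g where "g = gcd R (a + 1)"
  have g0: "g > 0" using assms by (simp add: g_def)
  obtain p where p: "R = g * p" unfolding g_def by (metis gcd_dvd1 dvdE)
  obtain q where q: "a + 1 = g * q" unfolding g_def by (metis gcd_dvd2 dvdE)
  have cop: "coprime p q"
    using g0 p q unfolding g_def by (metis gcd_mult_distrib_nat mult.right_neutral mult_left_cancel coprime_iff_gcd_eq_1 gr0_implies_Suc nat.distinct(1))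
  have p0: "p > 0" using assms p by (cases p) auto
  have aR: "real a + 1 = real g * real q" by (metis of_nat_Suc of_nat_mult q Suc_eq_plus1 add.commute)
  define f :: "nat \<Rightarrow> real ^ 2" where "f i = vector [real i * real p, 1 - real i * real q]" for i
  have "convex hull (model_generators R a) \<inter> int_lattice = f ` {..g}"
  proof (intro equalityI subsetI)
    fix v assume v: "v \<in> convex hull (model_generators R a) \<inter> int_lattice"
    then have "v \<in> closed_segment (vector [0, 1]) (vector [real R, - real a])"
      by (simp add: model_generators_def segment_convex_hull)
    then obtain t where t: "0 \<le> t" "t \<le> 1"
      "v = (1 - t) *\<^sub>R vector [0, 1] + t *\<^sub>R vector [real R, - real a]"
      by (auto simp only: in_segment)
    have v12: "v $ 1 = t * real R" "v $ 2 = 1 - t * (real a + 1)"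
      unfolding t(3) by (simp_all, simp add: algebra_simps)
    obtain x y where xy: "v $ 1 = of_int x" "v $ 2 = of_int y"
    proof -
      have "v $ 1 \<in> \<int>" "v $ 2 \<in> \<int>" using v unfolding int_lattice_def by auto
      then show ?thesis using that by (elim Ints_cases) blast
    qed
    have "of_int x * (real a + 1) = (1 - of_int y) * real R"
    proof -
      have "of_int x = t * real R" "1 - of_int y = t * (real a + 1)" using v12 xy by simp_all
      then show ?thesis by (simp only: mult.commute mult.left_commute)
    qed
    then have "real g * (of_int x * real q) = real g * ((1 - of_int y) * real p)"
      unfolding aR p of_nat_mult by (simp only: mult.left_commute)
    then have "of_int x * real q = (1 - of_int y) * real p" using g0 by simp
    then have "real_of_int (x * int q) = of_int ((1 - y) * int p)" by simp
    then have e: "x * int q = (1 - y) * int p" by linarith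
    then have "int p dvd x * int q" by simp
    then have "int p dvd x" using cop by (metis coprime_dvd_mult_left_iff coprime_int_iff)
    then obtain j where j: "x = int p * j" by blast
    have "1 - y = j * int q" using e j p0 by simp
    have tg: "of_int j = t * real g" using v12(1) xy(1) j p p0 by simp
    have "0 \<le> real_of_int j" "real_of_int j \<le> real g"
      unfolding tg using t mult_left_le_one_le[of "real g" t] by simp_all
    then have jj: "0 \<le> j" "j \<le> int g" by linarith+
    then obtain i where i: "j = int i" "i \<le> g" by (cases j) auto
    have "x = int i * int p" using j i by simp
    moreover have "y = 1 - int i * int q" using \<open>1 - y = j * int q\<close> i by simp
    ultimately have "v = f i" unfolding vec_eq_iff forall_2 f_def using xy by simp
    then show "v \<in> f ` {..g}" using i by auto
  next
    fix v assume "v \<in> f ` {..g}"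
    then obtain i where i: "i \<le> g" "v = f i" by auto
    have "v \<in> int_lattice" unfolding i int_lattice_def f_def by (simp add: forall_2)
    moreover have "v \<in> closed_segment (vector [0, 1]) (vector [real R, - real a])"
      unfolding in_segment
    proof (intro exI conjI)
      show "0 \<le> real i / real g" "real i / real g \<le> 1" using i g0 by auto
      have "real i / real g * real R = real i * real p"
        "real i / real g * (real a + 1) = real i * real q"
        using g0 unfolding p aR by (simp_all)
      then show "v = (1 - real i / real g) *\<^sub>R vector [0, 1] +
          (real i / real g) *\<^sub>R vector [real R, - real a]"
        unfolding i f_def vec_eq_iff forall_2 by (simp, simp add: algebra_simps add_divide_distrib)
    qed
    ultimately show "v \<in> convex hull (model_generators R a) \<inter> int_lattice"
      by (simp add: model_generators_def segment_convex_hull)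
  qed
  moreover have "inj f" using p0 by (auto intro!: injI simp: f_def vec_eq_iff forall_2)
  ultimately show ?thesis
    unfolding g_def[symmetric] by (simp add: lattice_length_def card_image inj_on_subset)
qed

end

theory Submission
  imports Defs "HOL-Number_Theory.Number_Theory"
begin

text \<open>
  Lattice points of the dilated dual polygon are counted layer by layer: as the vertices of
  \<open>P\<close> are integral, the boundary of the \<open>k\<close>-th dilate contains exactly the lattice points that are
  new in it, and each vertex of \<open>P\<close> contributes a difference of two floor functions. Regrouped by
  edges, the increment of the Ehrhart function is linear in \<open>k\<close> minus the sum over the cones of a
  periodic odd \<open>wave\<close>, a sum of two sawtooth functions of denominator the local index. The
  difference recursion of Dedekind sums shows that the orbifold corrections of a multiset of
  singularities cancel iff their waves do, and a cone has the same wave as its residue. So the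
  periods of the Ehrhart function are those of the sum of the waves of the reduced basket.

  If a local index fails to divide such a period, take a maximal such \<open>l\<close>. The Fourier
  coefficients at primitive \<open>l\<close>-th roots of unity vanish and involve only the singularities of local
  index \<open>l\<close>; this is a relation between the numbers \<open>cot (\<pi> e / l)\<close> with \<open>e\<close> coprime to \<open>l\<close>. These
  have no linear relations except those given by oddness (Chowla, Okada): a relation stable under
  multiplication by units yields an odd Dirichlet character with \<open>L(1, \<psi>) = 0\<close>. Hence the
  singularities of local index \<open>l\<close> form a cancelling tuple, contrary to the maximality of the
  invisible basket.
\<close>

section \<open>Dirichlet characters\<close>

text \<open>Rational relations between cotangents are usually conjugated by Galois theory. Here the
  conjugates come for free: a period \<open>p\<close> not divisible by \<open>k\<close> kills the
  Fourier coefficients at all primitive \<open>k\<close>-th roots of unity at once. Relations may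
  then have complex coefficients, and the translations by units, commuting maps of finite order,
  have a common eigenvector. Maximality of the local index isolates it: the coefficient at a
  primitive \<open>k\<close>-th root of unity would also see every local index that is a proper
  multiple of \<open>k\<close>. Nonvanishing of \<open>L(1, \<psi>)\<close> takes two arguments,
  since the product with exponents 3, 4, 1 breaks down when the square of \<open>\<psi>\<close> is
  trivial and its L-function has a pole; real characters are handled by a Lambert series. Both
  arguments let a real parameter tend to 1. The waves determine the periods because they are odd:
  their sum over a period vanishes, so that their partial sums, which form the constant coefficient
  of the Ehrhart function, are periodic as well.\<close>

lemma abel_summation:
  fixes c a :: "nat \<Rightarrow> 'a::comm_ring_1"
  shows "(\<Sum>n<N. c n * a n) = (\<Sum>n<N. c n) * a N + (\<Sum>n<N. (\<Sum>k\<le>n. c k) * (a n - a (Suc n)))"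
  by (induction N) (simp_all add: algebra_simps lessThan_Suc_atMost[symmetric])

text \<open>Besides convergence, partial summation gives the explicit bound \<open>M * a 0\<close>.
  The weights will depend on a real parameter tending to 1, and the bound controls the series as the
  parameter varies.\<close>

lemma dirichlet_test:
  fixes c :: "nat \<Rightarrow> complex" and a :: "nat \<Rightarrow> real"
  assumes M: "\<And>N. norm (\<Sum>n<N. c n) \<le> M"
    and dec: "\<And>n. a (Suc n) \<le> a n" and lim: "a \<longlonglongrightarrow> 0"
  shows "summable (\<lambda>n. c n * a n)" "norm (\<Sum>n. c n * a n) \<le> M * a 0"
proof -
  have M0: "M \<ge> 0" using M[of 0] by simp
  define d where "d n = (\<Sum>k\<le>n. c k) * (complex_of_real (a n) - a (Suc n))" for n
  have nd: "norm (d n) \<le> M * (a n - a (Suc n))" for n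
  proof -
    have "norm (complex_of_real (a n) - a (Suc n)) = a n - a (Suc n)"
      using dec[of n] by (metis abs_of_nonneg diff_ge_0_iff_ge norm_of_real of_real_diff)
    then show ?thesis unfolding d_def norm_mult
      using M[of "Suc n"] dec[of n] M0 by (intro mult_mono) (auto simp: lessThan_Suc_atMost)
  qed
  have tel: "(\<lambda>n. M * (a n - a (Suc n))) sums (M * (a 0 - 0))"
    by (intro sums_mult telescope_sums' lim)
  have sd: "summable d" by (rule summable_comparison_test'[OF sums_summable[OF tel] nd])
  have bz: "(\<lambda>N. (\<Sum>n<N. c n) * complex_of_real (a N)) \<longlonglongrightarrow> 0"
  proof (rule Lim_null_comparison)
    show "\<forall>\<^sub>F N in sequentially. norm ((\<Sum>n<N. c n) * complex_of_real (a N)) \<le> M * \<bar>a N\<bar>"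
      using M by (intro always_eventually allI) (auto simp: norm_mult intro!: mult_right_mono)
    show "(\<lambda>N. M * \<bar>a N\<bar>) \<longlonglongrightarrow> 0"
      using tendsto_mult_right_zero[OF tendsto_rabs_zero[OF lim]] by simp
  qed
  have "(\<lambda>N. (\<Sum>n<N. c n * complex_of_real (a n))) \<longlonglongrightarrow> 0 + suminf d"
    unfolding abel_summation d_def[symmetric]
    by (intro tendsto_add bz summable_LIMSEQ sd)
  then have s: "(\<lambda>n. c n * a n) sums suminf d" by (simp add: sums_def)
  show "summable (\<lambda>n. c n * a n)" using s by (rule sums_summable)
  have "norm (suminf d) \<le> (\<Sum>n. M * (a n - a (Suc n)))"
    by (rule norm_suminf_le[OF nd sums_summable[OF tel]])
  then show "norm (\<Sum>n. c n * a n) \<le> M * a 0"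
    using sums_unique[OF s] sums_unique[OF tel] by simp
qed

section \<open>Characters and bounds for their partial sums\<close>

locale dirichlet_character =
  fixes l :: nat and \<psi> :: "nat \<Rightarrow> complex"
  assumes modulus_pos: "l > 0"
    and mult: "\<psi> (m * n) = \<psi> m * \<psi> n"
    and periodic: "\<psi> (n + l) = \<psi> n"
    and nonzero_iff: "\<psi> n \<noteq> 0 \<longleftrightarrow> coprime n l"
begin

lemma one [simp]: "\<psi> 1 = 1" "\<psi> (Suc 0) = 1"
  using mult[of 1 1] nonzero_iff[of 1] by auto

lemma power: "\<psi> (n ^ k) = \<psi> n ^ k"
  by (induction k) (auto simp: mult)

lemma periodic_mult: "\<psi> (n + l * k) = \<psi> n"
proof (induction k)
  case (Suc k)
  then show ?case using periodic[of "n + l * k"] by (simp add: algebra_simps)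
qed simp

lemma mod_eq: "\<psi> (n mod l) = \<psi> n"
  using periodic_mult[of "n mod l" "n div l"] by (simp add: add.commute)

lemma cong: "[m = n] (mod l) \<Longrightarrow> \<psi> m = \<psi> n"
  unfolding Cong.cong_def by (metis mod_eq)

lemma norm_1: "coprime n l \<Longrightarrow> norm (\<psi> n) = 1"
proof -
  assume "coprime n l"
  then have "[n ^ totient l = 1] (mod l)" by (rule euler_theorem)
  then have "\<psi> n ^ totient l = 1" using cong power by (metis one(1))
  then have "norm (\<psi> n) ^ totient l = 1" by (metis norm_one norm_power)
  moreover have "totient l > 0" using modulus_pos by simp
  ultimately show ?thesis using power_eq_1_iff
    by (metis gr_implies_not0 norm_ge_zero power_eq_imp_eq_base power_one)
qed

lemma norm_le_1: "norm (\<psi> n) \<le> 1"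
  using norm_1[of n] nonzero_iff[of n] by (cases "coprime n l") auto

text \<open>Multiplication by the unit \<open>u\<close> permutes the residues, so the sum equals
  \<open>\<psi> u\<close> times itself.\<close>

lemma sum_period:
  assumes "coprime u l" "\<psi> u \<noteq> 1"
  shows "(\<Sum>n<l. \<psi> n) = 0"
proof -
  have inj: "inj_on (\<lambda>n. u * n mod l) {..<l}"
  proof (rule inj_onI)
    fix x y assume xy: "x \<in> {..<l}" "y \<in> {..<l}" "u * x mod l = u * y mod l"
    then have "[x = y] (mod l)" using assms(1) by (metis cong_mult_lcancel_nat Cong.cong_def)
    then show "x = y" using xy by (simp add: Cong.cong_def)
  qed
  have "(\<lambda>n. u * n mod l) ` {..<l} = {..<l}"
    by (rule endo_inj_surj[OF _ _ inj]) (auto simp: modulus_pos)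
  then have "(\<Sum>n<l. \<psi> n) = (\<Sum>n<l. \<psi> (u * n mod l))"
    using sum.reindex[OF inj, of \<psi>] by (simp add: o_def)
  also have "\<dots> = \<psi> u * (\<Sum>n<l. \<psi> n)" by (simp add: mod_eq mult sum_distrib_left)
  finally show ?thesis using assms(2) by (metis mult_cancel_right1)
qed

text \<open>Whole periods sum to zero and can be stripped off; fewer than \<open>l\<close> terms of
  norm at most 1 remain.\<close>

lemma partial_sums_bounded:
  assumes "coprime u l" "\<psi> u \<noteq> 1"
  shows "norm (\<Sum>n<N. \<psi> n) \<le> l"
proof (induction N rule: less_induct)
  case (less N)
  show ?case
  proof (cases "N < l")
    case True
    have "norm (\<Sum>n<N. \<psi> n) \<le> (\<Sum>n<N. 1)" by (rule sum_norm_le) (rule norm_le_1)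
    then show ?thesis using True by simp
  next
    case False
    have "(\<Sum>n<N. \<psi> n) = (\<Sum>n<l. \<psi> n) + (\<Sum>n\<in>{l..<N}. \<psi> n)"
      using False by (subst sum.union_disjoint[symmetric]) (auto intro!: sum.cong)
    also have "(\<Sum>n\<in>{l..<N}. \<psi> n) = (\<Sum>n<N - l. \<psi> (n + l))"
      using sum.shift_bounds_nat_ivl[of \<psi> 0 l "N - l"] False by (simp add: lessThan_atLeast0)
    also have "\<dots> = (\<Sum>n<N - l. \<psi> n)" by (simp add: periodic)
    finally show ?thesis using less.IH[of "N - l"] modulus_pos False sum_period[OF assms] by simp
  qed
qed

text \<open>The sum is a difference of two initial sums, hence the factor 2. The offset is 1 for
  series starting at \<open>n = 1\<close> and 3 where the weights decrease only from there.\<close>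

lemma partial_sums_bounded_from:
  assumes "coprime u l" "\<psi> u \<noteq> 1"
  shows "norm (\<Sum>n<N. \<psi> (n + k)) \<le> 2 * l"
proof -
  have "(\<Sum>n<N + k. \<psi> n) = (\<Sum>n<k. \<psi> n) + (\<Sum>n\<in>{k..<N + k}. \<psi> n)"
    by (subst sum.union_disjoint[symmetric]) (auto intro!: sum.cong)
  also have "(\<Sum>n\<in>{k..<N + k}. \<psi> n) = (\<Sum>n<N. \<psi> (n + k))"
    using sum.shift_bounds_nat_ivl[of \<psi> 0 k N] by (simp add: lessThan_atLeast0)
  finally have "(\<Sum>n<N. \<psi> (n + k)) = (\<Sum>n<N + k. \<psi> n) - (\<Sum>n<k. \<psi> n)" by simp
  then have "norm (\<Sum>n<N. \<psi> (n + k)) \<le> norm (\<Sum>n<N + k. \<psi> n) + norm (\<Sum>n<k. \<psi> n)"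
    by (metis norm_triangle_ineq4)
  then show ?thesis using partial_sums_bounded[OF assms, of "N + k"] partial_sums_bounded[OF assms, of k] by simp
qed

end

text \<open>The arithmetic-geometric mean inequality for the even powers of \<open>q\<close> up to
  \<open>2 * n\<close>. The induction removes the two outer terms, whose sum is at least
  \<open>2 * q ^ n\<close>, and therefore goes in steps of two.\<close>

lemma geometric_sum_ge:
  fixes q :: real
  assumes "0 \<le> q"
  shows "(\<Sum>j<Suc n. (q\<^sup>2) ^ j) \<ge> real (Suc n) * q ^ n"
proof (induction n rule: nat_less_induct)
  case (1 n)
  consider "n = 0" | "n = 1" | m where "n = Suc (Suc m)" by (metis One_nat_def not0_implies_Suc)
  then show ?case
  proof cases
    case 2
    have "0 \<le> (1 - q)\<^sup>2" by simp
    then show ?thesis using 2 by (simp add: power2_eq_square algebra_simps)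
  next
    case 3
    have "0 \<le> (1 - q ^ n)\<^sup>2" by simp
    then have a: "2 * q ^ n \<le> 1 + (q\<^sup>2) ^ n"
      by (simp add: power2_eq_square algebra_simps power_mult_distrib)
    have "real (Suc m) * q ^ m \<le> (\<Sum>j<Suc m. (q\<^sup>2) ^ j)" by (rule 1[rule_format]) (simp add: 3)
    then have "q\<^sup>2 * (real (Suc m) * q ^ m) \<le> q\<^sup>2 * (\<Sum>j<Suc m. (q\<^sup>2) ^ j)"
      by (rule mult_left_mono) simp
    also have "\<dots> = (\<Sum>j<Suc m. (q\<^sup>2) ^ Suc j)" by (simp add: sum_distrib_left del: sum.lessThan_Suc)
    finally have b: "real (Suc m) * q ^ n \<le> (\<Sum>j<Suc m. (q\<^sup>2) ^ Suc j)"
      using 3 by (simp add: power2_eq_square algebra_simps)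
    have "(\<Sum>j<Suc n. (q\<^sup>2) ^ j) = 1 + (\<Sum>j<Suc m. (q\<^sup>2) ^ Suc j) + (q\<^sup>2) ^ n"
      unfolding 3 by (subst sum.lessThan_Suc, subst sum.lessThan_Suc_shift) simp
    moreover have "real (Suc n) * q ^ n = real (Suc m) * q ^ n + 2 * q ^ n"
      using 3 by (simp add: algebra_simps)
    ultimately show ?thesis using a b by linarith
  qed auto
qed

text \<open>The coefficient of the L-series at 1, scaled by \<open>1 / (1 - t)\<close>, minus the
  coefficient of the Lambert series. The scaling is chosen so that the poles of both at
  \<open>t = 1\<close> cancel.\<close>

definition lambert_weight :: "real \<Rightarrow> nat \<Rightarrow> real" where
  "lambert_weight t n = 1 / (real n * (1 - t)) - t ^ n / (1 - t ^ n)"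

text \<open>After clearing denominators the claim is
  \<open>n * (n + 1) * t ^ n \<le> G n * G (n + 1)\<close> for the geometric sums \<open>G\<close>.
  With \<open>q\<close> the square root of \<open>t\<close>, the mean inequality bounds the right
  side below by \<open>n * (n + 1) * q ^ (2 * n - 1)\<close>, and \<open>t ^ n = q ^ (2 * n)\<close>
  is smaller still.\<close>

lemma lambert_weight_dec:
  assumes "0 < t" "t < 1" "n \<ge> 1"
  shows "lambert_weight t (Suc n) \<le> lambert_weight t n"
proof -
  define q where "q = sqrt t"
  have q: "q > 0" "q\<^sup>2 = t" "q < 1" using assms by (auto simp: q_def)
  define G where "G n = (\<Sum>j<n. t ^ j)" for n
  obtain m where m: "n = Suc m" using assms(3) by (cases n) auto
  have g1: "G n \<ge> real n * q ^ m" "G (Suc n) \<ge> real (Suc n) * q ^ n"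
    unfolding G_def m q(2)[symmetric] by (rule geometric_sum_ge, use q in simp)+
  have pos: "real n * q ^ m > 0" "real (Suc n) * q ^ n > 0" using q assms by auto
  have "G n * G (Suc n) \<ge> (real n * q ^ m) * (real (Suc n) * q ^ n)"
    using g1 pos by (intro mult_mono) auto
  also have "(real n * q ^ m) * (real (Suc n) * q ^ n) = real n * real (Suc n) * q ^ (m + n)"
    by (simp add: power_add)
  finally have g2: "real n * real (Suc n) * q ^ (m + n) \<le> G n * G (Suc n)" .
  have "t ^ n \<le> q ^ (m + n)"
  proof -
    have "t ^ n = q ^ (2 * n)" by (simp add: q(2)[symmetric] power_mult)
    also have "\<dots> \<le> q ^ (m + n)" using q m by (intro power_decreasing) auto
    finally show ?thesis .
  qed
  then have "real n * real (Suc n) * t ^ n \<le> real n * real (Suc n) * q ^ (m + n)"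
    by (intro mult_left_mono) auto
  with g2 have g3: "real n * real (Suc n) * t ^ n \<le> G n * G (Suc n)" by linarith
  have G: "1 - t ^ k = (1 - t) * G k" for k unfolding G_def by (rule one_diff_power_eq)
  have Gp: "G n > 0" "G (Suc n) > 0" using g1 pos by linarith+
  have t1: "1 - t > 0" using assms by simp
  have "t ^ n / (1 - t ^ n) - t ^ Suc n / (1 - t ^ Suc n) = t ^ n * (1 - t) / ((1 - t ^ n) * (1 - t ^ Suc n))"
  proof -
    have "1 - t ^ n \<noteq> 0" "1 - t ^ Suc n \<noteq> 0" unfolding G using t1 Gp by auto
    then show ?thesis by (subst diff_frac_eq) (auto simp: algebra_simps)
  qed
  also have "\<dots> = t ^ n / (G n * G (Suc n)) / (1 - t)"
    unfolding G using t1 by simp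
  also have "\<dots> \<le> (1 / (real n * real (Suc n))) / (1 - t)"
  proof (rule divide_right_mono)
    show "t ^ n / (G n * G (Suc n)) \<le> 1 / (real n * real (Suc n))"
      using g3 Gp assms(3) by (simp add: divide_simps mult_ac)
  qed (use t1 in simp)
  also have "1 / (real n * real (Suc n)) = 1 / real n - 1 / real (Suc n)"
    using assms(3) by (simp add: field_simps)
  also have "\<dots> / (1 - t) = 1 / (real n * (1 - t)) - 1 / (real (Suc n) * (1 - t))"
    by (simp add: diff_divide_distrib)
  finally show ?thesis unfolding lambert_weight_def by linarith
qed

lemma lambert_weight_lim:
  assumes "0 < t" "t < 1"
  shows "(\<lambda>n. lambert_weight t (Suc n)) \<longlonglongrightarrow> 0"
proof -
  have a: "(\<lambda>n. t ^ Suc n) \<longlonglongrightarrow> 0" using assms by (intro LIMSEQ_Suc LIMSEQ_power_zero) auto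
  have "(\<lambda>n. t ^ Suc n / (1 - t ^ Suc n)) \<longlonglongrightarrow> 0 / (1 - 0)"
    by (intro tendsto_divide tendsto_diff tendsto_const a) simp
  moreover have "(\<lambda>n. (1 / (1 - t)) * inverse (real (Suc n))) \<longlonglongrightarrow> (1 / (1 - t)) * 0"
    by (intro tendsto_mult tendsto_const LIMSEQ_inverse_real_of_nat)
  ultimately have "(\<lambda>n. (1 / (1 - t)) * inverse (real (Suc n)) - t ^ Suc n / (1 - t ^ Suc n)) \<longlonglongrightarrow> (1 / (1 - t)) * 0 - 0 / (1 - 0)"
    by (intro tendsto_diff)
  then show ?thesis unfolding lambert_weight_def by (simp add: divide_inverse mult_ac)
qed

section \<open>Nonvanishing of \<open>L(1, \<psi>)\<close> for real characters\<close>

text \<open>These sums are the factors of \<open>divisor_sum\<close> at prime powers. For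
  \<open>x = -1\<close> the terms cancel in pairs, and an even \<open>k\<close> leaves one of them
  over.\<close>

lemma geometric_sum_sign:
  fixes x :: real
  assumes "x \<in> {-1, 0, 1}"
  shows "(\<Sum>i\<le>k. x ^ i) \<ge> 0" "even k \<Longrightarrow> (\<Sum>i\<le>k. x ^ i) \<ge> 1"
proof -
  have m: "(\<Sum>i\<le>k. (-1 :: real) ^ i) = (if even k then 1 else 0)" for k by (induction k) auto
  have z: "(\<Sum>i\<le>k. (0 :: real) ^ i) = 1" for k by (induction k) auto
  show "(\<Sum>i\<le>k. x ^ i) \<ge> 0" using assms by (auto simp: m z)
  show "even k \<Longrightarrow> (\<Sum>i\<le>k. x ^ i) \<ge> 1" using assms by (auto simp: m z)
qed

lemma divisors_prime_power_mult:
  fixes p m :: nat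
  assumes "prime p" "\<not> p dvd m" "m > 0"
  shows "bij_betw (\<lambda>(i, d). p ^ i * d) ({..k} \<times> {d. d dvd m}) {d. d dvd p ^ k * m}"
proof (rule bij_betwI')
  fix x y assume x: "x \<in> {..k} \<times> {d. d dvd m}" and y: "y \<in> {..k} \<times> {d. d dvd m}"
  obtain i d where x': "x = (i, d)" by fastforce
  obtain j e where y': "y = (j, e)" by fastforce
  have nd: "\<not> p dvd d" "\<not> p dvd e" using x y x' y' assms(2) by (auto dest: dvd_trans)
  have mult: "multiplicity p (p ^ n * d') = n" if "\<not> p dvd d'" for n d'
    using that assms(1) by (intro multiplicity_eqI) auto
  show "((case x of (i, d) \<Rightarrow> p ^ i * d) = (case y of (i, d) \<Rightarrow> p ^ i * d)) = (x = y)"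
  proof
    assume "(case x of (i, d) \<Rightarrow> p ^ i * d) = (case y of (i, d) \<Rightarrow> p ^ i * d)"
    then have eq: "p ^ i * d = p ^ j * e" by (simp add: x' y')
    then have "i = j" using mult[OF nd(1), of i] mult[OF nd(2), of j] by simp
    then show "x = y" using eq assms(1) by (simp add: x' y' prime_gt_0_nat)
  qed simp
next
  fix x assume "x \<in> {..k} \<times> {d. d dvd m}"
  then show "(case x of (i, d) \<Rightarrow> p ^ i * d) \<in> {d. d dvd p ^ k * m}"
    by (auto intro!: mult_dvd_mono le_imp_power_dvd)
next
  fix y assume "y \<in> {d. d dvd p ^ k * m}"
  then obtain a b where ab: "y = a * b" "a dvd p ^ k" "b dvd m"
    using division_decomp[of y "p ^ k" m] by auto
  obtain i where "i \<le> k" "a = p ^ i" using ab(2) assms(1) divides_primepow_nat by blast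
  then show "\<exists>x\<in>{..k} \<times> {d. d dvd m}. y = (case x of (i, d) \<Rightarrow> p ^ i * d)"
    using ab by (intro bexI[of _ "(i, b)"]) auto
qed

section \<open>Divisor sums and the Lambert series of a real character\<close>

context dirichlet_character
begin

text \<open>For real \<open>\<psi>\<close>, the convolution of \<open>\<psi>\<close> with 1:
  expanding each \<open>t ^ n / (1 - t ^ n)\<close> geometrically makes it the coefficient of
  \<open>t ^ m\<close> in the Lambert series.\<close>

definition divisor_sum :: "nat \<Rightarrow> real" where
  "divisor_sum m = (\<Sum>d | d dvd m. Re (\<psi> d))"

context
  assumes real_valued: "\<And>n. \<psi> n \<in> {-1, 0, 1}"
begin


lemma Re_mult: "Re (\<psi> (m * n)) = Re (\<psi> m) * Re (\<psi> n)"
  using real_valued[of n] real_valued[of m] by (auto simp: mult)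

lemma Re_power: "Re (\<psi> (m ^ n)) = Re (\<psi> m) ^ n"
  by (induction n) (auto simp: Re_mult)

lemma divisor_sum_split:
  assumes "prime p" "\<not> p dvd m" "m > 0"
  shows "divisor_sum (p ^ k * m) = (\<Sum>i\<le>k. Re (\<psi> p) ^ i) * divisor_sum m"
proof -
  have "divisor_sum (p ^ k * m) = (\<Sum>x\<in>{..k} \<times> {d. d dvd m}. Re (\<psi> (case x of (i, d) \<Rightarrow> p ^ i * d)))"
    unfolding divisor_sum_def
    by (rule sum.reindex_bij_betw[OF divisors_prime_power_mult[OF assms], symmetric])
  also have "\<dots> = (\<Sum>(i, d)\<in>{..k} \<times> {d. d dvd m}. Re (\<psi> p) ^ i * Re (\<psi> d))"
    by (rule sum.cong) (auto simp: Re_mult Re_power)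
  also have "\<dots> = (\<Sum>i\<le>k. Re (\<psi> p) ^ i) * divisor_sum m"
    by (simp add: divisor_sum_def sum_product sum.cartesian_product)
  finally show ?thesis .
qed

text \<open>Splitting off the full power of a prime leaves a smaller cofactor and a factor governed
  by \<open>geometric_sum_sign\<close>. In a square the exponent is even and the cofactor is again a
  square, so both bounds go through one induction.\<close>

lemma divisor_sum_bounds:
  assumes "m > 0"
  shows "divisor_sum m \<ge> 0 \<and> (\<forall>n. m = n\<^sup>2 \<longrightarrow> divisor_sum m \<ge> 1)"
  using assms
proof (induction m rule: less_induct)
  case (less m)
  show ?case
  proof (cases "m = 1")
    case True
    have "divisor_sum 1 = 1" by (simp add: divisor_sum_def)
    then show ?thesis using True by (auto simp del: One_nat_def)
  next
    case False
    then obtain p where p: "prime p" "p dvd m" using prime_factor_nat by blast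
    define k where "k = multiplicity p m"
    define m' where "m' = m div p ^ k"
    have m: "m = p ^ k * m'" unfolding m'_def k_def by (simp add: multiplicity_dvd)
    have nd: "\<not> p dvd m'" unfolding m'_def k_def
      using less.prems p(1) by (intro multiplicity_decompose) (auto simp: prime_gt_1_nat)
    have m'0: "m' > 0" using m less.prems by (cases m') auto
    have k0: "k > 0" unfolding k_def using p less.prems
      by (metis bot_nat_0.not_eq_extremum multiplicity_eq_zero_iff not_prime_unit)
    have "1 < p ^ k" using p(1) k0 by (metis one_less_power prime_gt_1_nat)
    then have lt: "m' < m" using m m'0 by simp
    have x: "Re (\<psi> p) \<in> {-1, 0, 1}" using real_valued[of p] by auto
    have IH: "divisor_sum m' \<ge> 0" "\<And>n. m' = n\<^sup>2 \<Longrightarrow> divisor_sum m' \<ge> 1"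
      using less.IH[OF lt m'0] by auto
    have split: "divisor_sum m = (\<Sum>i\<le>k. Re (\<psi> p) ^ i) * divisor_sum m'"
      unfolding m by (rule divisor_sum_split[OF p(1) nd m'0])
    show ?thesis
    proof (intro conjI allI impI)
      show "divisor_sum m \<ge> 0" unfolding split using geometric_sum_sign(1)[OF x, of k] IH(1) by simp
      fix n assume n: "m = n\<^sup>2"
      have n0: "n \<noteq> 0" using n less.prems by auto
      have ek: "k = 2 * multiplicity p n" unfolding k_def n
        using p(1) n0 by (simp add: prime_elem_multiplicity_power_distrib)
      define n' where "n' = n div p ^ multiplicity p n"
      have "n = p ^ multiplicity p n * n'" unfolding n'_def by (simp add: multiplicity_dvd)
      then have "p ^ k * n'\<^sup>2 = p ^ k * m'" using m n ek
        by (metis power_mult_distrib power_mult mult.commute)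
      then have "m' = n'\<^sup>2" using p(1) by (simp add: prime_gt_0_nat)
      then have "divisor_sum m' \<ge> 1" using IH(2) by blast
      moreover have "(\<Sum>i\<le>k. Re (\<psi> p) ^ i) \<ge> 1" using geometric_sum_sign(2)[OF x, of k] ek by simp
      ultimately show "divisor_sum m \<ge> 1" unfolding split
        using mult_mono[of 1 "\<Sum>i\<le>k. Re (\<psi> p) ^ i" 1 "divisor_sum m'"] by simp
    qed
  qed
qed

text \<open>Both sides run over the pairs \<open>(n, j)\<close> with \<open>n * j \<le> N\<close>,
  grouped by \<open>n\<close> on the left and by the product on the right.\<close>

lemma sum_divisor_sum:
  fixes t :: real
  shows "(\<Sum>n\<in>{1..N}. Re (\<psi> n) * (\<Sum>j\<in>{1..N div n}. t ^ (n * j))) = (\<Sum>m\<in>{1..N}. divisor_sum m * t ^ m)"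
proof -
  have "(\<Sum>n\<in>{1..N}. Re (\<psi> n) * (\<Sum>j\<in>{1..N div n}. t ^ (n * j))) =
      (\<Sum>(n, j)\<in>(SIGMA n:{1..N}. {1..N div n}). Re (\<psi> n) * t ^ (n * j))"
    by (simp add: sum_distrib_left sum.Sigma)
  also have "\<dots> = (\<Sum>(m, d)\<in>(SIGMA m:{1..N}. {d. d dvd m}). Re (\<psi> d) * t ^ m)"
  proof (rule sum.reindex_bij_witness[of _ "\<lambda>(m, d). (d, m div d)" "\<lambda>(n, j). (n * j, n)"])
    fix a assume "a \<in> (SIGMA n:{1..N}. {1..N div n})"
    then obtain n j where a: "a = (n, j)" "1 \<le> n" "n \<le> N" "1 \<le> j" "j \<le> N div n" by auto
    have "n * j \<le> N" using a by (metis div_times_less_eq_dividend le_trans mult.commute mult_le_mono1)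
    then show "(case a of (n, j) \<Rightarrow> (n * j, n)) \<in> (SIGMA m:{1..N}. {d. d dvd m})" using a by auto
    show "(case case a of (n, j) \<Rightarrow> (n * j, n) of (m, d) \<Rightarrow> (d, m div d)) = a" using a by simp
    show "(case case a of (n, j) \<Rightarrow> (n * j, n) of (m, d) \<Rightarrow> Re (\<psi> d) * t ^ m) =
         (case a of (n, j) \<Rightarrow> Re (\<psi> n) * t ^ (n * j))" using a by simp
  next
    fix b assume "b \<in> (SIGMA m:{1..N}. {d. d dvd m})"
    then obtain m d where b: "b = (m, d)" "1 \<le> m" "m \<le> N" "d dvd m" by auto
    have d: "1 \<le> d" "d \<le> m" using b by (auto intro: dvd_imp_le simp: Suc_le_eq dvd_pos_nat)
    have "1 \<le> m div d" using d by (simp add: Suc_le_eq div_greater_zero_iff)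
    moreover have "m div d \<le> N div d" using b by (simp add: div_le_mono)
    ultimately show "(case b of (m, d) \<Rightarrow> (d, m div d)) \<in> (SIGMA n:{1..N}. {1..N div n})"
      using b d by auto
    show "(case case b of (m, d) \<Rightarrow> (d, m div d) of (n, j) \<Rightarrow> (n * j, n)) = b" using b by simp
  qed
  also have "\<dots> = (\<Sum>m\<in>{1..N}. \<Sum>d | d dvd m. Re (\<psi> d) * t ^ m)"
    by (subst sum.Sigma) (auto intro: finite_divisors_nat)
  also have "\<dots> = (\<Sum>m\<in>{1..N}. divisor_sum m * t ^ m)"
    by (simp add: divisor_sum_def sum_distrib_right)
  finally show ?thesis .
qed

lemma sum_squares_le:
  fixes t :: real
  assumes "0 < t" "K\<^sup>2 \<le> N"
  shows "(\<Sum>k\<in>{1..K}. t ^ (k\<^sup>2)) \<le> (\<Sum>m\<in>{1..N}. divisor_sum m * t ^ m)"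
proof -
  have inj: "inj_on (\<lambda>k::nat. k\<^sup>2) {1..K}" by (auto intro!: inj_onI simp: power2_eq_iff_nonneg)
  have sub: "(\<lambda>k. k\<^sup>2) ` {1..K} \<subseteq> {1..N}"
  proof (rule image_subsetI)
    fix k assume "k \<in> {1..K}"
    then have "k\<^sup>2 \<le> K\<^sup>2" "1 \<le> k" by (auto intro: power_mono)
    with assms(2) show "k\<^sup>2 \<in> {1..N}" unfolding atLeastAtMost_iff by (meson le_trans one_le_power)
  qed
  have "(\<Sum>k\<in>{1..K}. t ^ (k\<^sup>2)) = (\<Sum>m\<in>(\<lambda>k. k\<^sup>2) ` {1..K}. t ^ m)"
    using sum.reindex[OF inj, of "\<lambda>m. t ^ m"] by (simp add: o_def)
  also have "\<dots> \<le> (\<Sum>m\<in>(\<lambda>k. k\<^sup>2) ` {1..K}. divisor_sum m * t ^ m)"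
  proof (rule sum_mono)
    fix m assume "m \<in> (\<lambda>k. k\<^sup>2) ` {1..K}"
    then have "divisor_sum m \<ge> 1" using divisor_sum_bounds[of m] by auto
    then have "1 * t ^ m \<le> divisor_sum m * t ^ m" using assms(1) by (intro mult_right_mono) auto
    then show "t ^ m \<le> divisor_sum m * t ^ m" by simp
  qed
  also have "\<dots> \<le> (\<Sum>m\<in>{1..N}. divisor_sum m * t ^ m)"
    using divisor_sum_bounds assms(1) by (intro sum_mono2 sub) auto
  finally show ?thesis .
qed

text \<open>Truncation avoids rearranging a double series: cutting the geometric series at
  \<open>n\<close> after \<open>N div n\<close> terms costs at most
  \<open>t ^ Suc N / (1 - t)\<close>, and \<open>N\<close> such errors still tend to zero.\<close>

lemma lambert_series_ge:
  fixes t :: real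
  assumes t: "0 < t" "t < 1" and s: "(\<lambda>n. \<psi> (Suc n) * of_real (t ^ Suc n / (1 - t ^ Suc n))) sums f"
  shows "(\<Sum>k\<in>{1..K}. t ^ (k\<^sup>2)) \<le> Re f"
proof -
  define g where "g n = Re (\<psi> n) * (t ^ n / (1 - t ^ n))" for n
  have "(\<lambda>n. Re (\<psi> (Suc n) * of_real (t ^ Suc n / (1 - t ^ Suc n)))) sums Re f"
    by (rule sums_Re[OF s])
  moreover have "Re (\<psi> (Suc n) * of_real x) = Re (\<psi> (Suc n)) * x" for n x by simp
  ultimately have "(\<lambda>n. g (Suc n)) sums Re f" by (simp only: g_def)
  then have "(\<lambda>N. \<Sum>n<N. g (Suc n)) \<longlonglongrightarrow> Re f" by (simp add: sums_def)
  then have l1: "(\<lambda>N. \<Sum>n\<in>{1..N}. g n) \<longlonglongrightarrow> Re f"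
    by (simp only: sum.atLeast1_atMost_eq One_nat_def)
  have l2: "(\<lambda>N. real N * t ^ Suc N / (1 - t)) \<longlonglongrightarrow> 0 * t / (1 - t)"
  proof -
    have "(\<lambda>N. real N * t ^ N) \<longlonglongrightarrow> 0" using t powser_times_n_limit_0[of t] by simp
    then have "(\<lambda>N. real N * t ^ N * t / (1 - t)) \<longlonglongrightarrow> 0 * t / (1 - t)"
      using t by (intro tendsto_divide tendsto_mult tendsto_const) auto
    then show ?thesis by (simp add: mult_ac)
  qed
  have "(\<lambda>N. (\<Sum>n\<in>{1..N}. g n) + real N * t ^ Suc N / (1 - t)) \<longlonglongrightarrow> Re f + 0 * t / (1 - t)"
    by (intro tendsto_add l1 l2)
  then have lim: "(\<lambda>N. (\<Sum>n\<in>{1..N}. g n) + real N * t ^ Suc N / (1 - t)) \<longlonglongrightarrow> Re f" by simp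
  show ?thesis
  proof (rule tendsto_lowerbound[OF lim])
    show "\<forall>\<^sub>F N in sequentially. (\<Sum>k\<in>{1..K}. t ^ (k\<^sup>2)) \<le> (\<Sum>n\<in>{1..N}. g n) + real N * t ^ Suc N / (1 - t)"
      unfolding eventually_sequentially
    proof (intro exI allI impI)
      fix N assume N: "K\<^sup>2 \<le> N"
      have "Re (\<psi> n) * (\<Sum>j\<in>{1..N div n}. t ^ (n * j)) \<le> g n + t ^ Suc N / (1 - t)"
        if n: "n \<in> {1..N}" for n
      proof -
        define x where "x = t ^ n"
        define q where "q = N div n"
        have x: "0 < x" "x \<le> t" using t n power_decreasing[of 1 n t] by (auto simp: x_def)
        have "(\<Sum>j\<in>{1..q}. x ^ j) = (x - x ^ Suc q) / (1 - x)"
          using x t sum_gp[of x 1 q] by (cases "q = 0") auto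
        also have "\<dots> = x / (1 - x) - x ^ Suc q / (1 - x)" by (rule diff_divide_distrib)
        finally have s: "(\<Sum>j\<in>{1..q}. t ^ (n * j)) = x / (1 - x) - x ^ Suc q / (1 - x)"
          by (simp add: x_def power_mult)
        have "Suc N \<le> n * Suc q" unfolding q_def
          using n dividend_less_times_div[of n N] by simp
        then have "t ^ (n * Suc q) \<le> t ^ Suc N" using t by (intro power_decreasing) auto
        then have "x ^ Suc q / (1 - x) \<le> t ^ Suc N / (1 - t)"
          unfolding x_def power_mult[symmetric] using x t by (intro frac_le) (auto simp: x_def)
        moreover have "0 \<le> x ^ Suc q / (1 - x)" using x t by simp
        moreover have "- Re (\<psi> n) \<le> 1" using real_valued[of n] by auto
        ultimately have "- Re (\<psi> n) * (x ^ Suc q / (1 - x)) \<le> t ^ Suc N / (1 - t)"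
          using mult_right_mono[of "- Re (\<psi> n)" 1 "x ^ Suc q / (1 - x)"] by linarith
        then show ?thesis unfolding q_def[symmetric] s g_def x_def[symmetric]
          by (simp add: right_diff_distrib)
      qed
      then have "(\<Sum>n\<in>{1..N}. Re (\<psi> n) * (\<Sum>j\<in>{1..N div n}. t ^ (n * j))) \<le> (\<Sum>n\<in>{1..N}. g n + t ^ Suc N / (1 - t))"
        by (rule sum_mono)
      then show "(\<Sum>k\<in>{1..K}. t ^ (k\<^sup>2)) \<le> (\<Sum>n\<in>{1..N}. g n) + real N * t ^ Suc N / (1 - t)"
        using sum_squares_le[OF t(1) N] unfolding sum_divisor_sum by (simp add: sum.distrib)
    qed
  qed simp
qed

text \<open>
  If \<open>L(1, \<psi>) = 0\<close>, the Lambert series of \<open>\<psi>\<close> equals, up to sign, its sum against the weights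
  \<open>lambert_weight t\<close>; these decrease from \<open>1\<close> to \<open>0\<close>, so it stays bounded as \<open>t\<close> tends to \<open>1\<close>. But
  its power series has coefficients \<open>divisor_sum\<close>, nonnegative and at least \<open>1\<close> at the squares.
\<close>

lemma nonvanishing_real:
  assumes u: "coprime u l" "\<psi> u \<noteq> 1"
  shows "\<not> (\<lambda>n. \<psi> (Suc n) / of_nat (Suc n)) sums 0"
proof
  assume L: "(\<lambda>n. \<psi> (Suc n) / of_nat (Suc n)) sums 0"
  \<comment> \<open>One square more than the bound \<open>2 * l\<close> permits: as \<open>t\<close>
    tends to 1 the sum over the squares tends to \<open>K\<close>.\<close>
  define K where "K = Suc (2 * l)"
  have bound: "(\<Sum>k\<in>{1..K}. t ^ (k\<^sup>2)) \<le> 2 * l" if t: "0 < t" "t < 1" for t :: real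
  proof -
    define a where "a n = lambert_weight t (Suc n)" for n
    have b: "norm (\<Sum>n<N. \<psi> (Suc n)) \<le> real (2 * l)" for N
      using partial_sums_bounded_from[OF u, of 1 N] unfolding Suc_eq_plus1 .
    have dec: "a (Suc n) \<le> a n" for n unfolding a_def by (rule lambert_weight_dec) (use t in auto)
    have lim: "a \<longlonglongrightarrow> 0" unfolding a_def by (rule lambert_weight_lim[OF t])
    note D = dirichlet_test[OF b dec lim]
    have "a 0 = 1 / (1 - t) - t / (1 - t)" unfolding a_def lambert_weight_def by simp
    also have "\<dots> = (1 - t) / (1 - t)" by (rule diff_divide_distrib[symmetric])
    finally have a0: "a 0 = 1" using t by simp
    have "(\<lambda>n. \<psi> (Suc n) / of_nat (Suc n) * (1 / (1 - of_real t)) - \<psi> (Suc n) * a n) sums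
        (0 * (1 / (1 - of_real t)) - (\<Sum>n. \<psi> (Suc n) * a n))"
      by (intro sums_diff sums_mult2 L summable_sums D(1))
    moreover have "\<psi> (Suc n) / of_nat (Suc n) * (1 / (1 - of_real t)) - \<psi> (Suc n) * a n =
        \<psi> (Suc n) * of_real (t ^ Suc n / (1 - t ^ Suc n))" for n
      unfolding a_def lambert_weight_def by (simp add: right_diff_distrib)
    ultimately have s: "(\<lambda>n. \<psi> (Suc n) * of_real (t ^ Suc n / (1 - t ^ Suc n))) sums
        (- (\<Sum>n. \<psi> (Suc n) * a n))" by simp
    have "(\<Sum>k\<in>{1..K}. t ^ (k\<^sup>2)) \<le> Re (- (\<Sum>n. \<psi> (Suc n) * a n))"
      by (rule lambert_series_ge[OF t s])
    also have "\<dots> \<le> norm (- (\<Sum>n. \<psi> (Suc n) * a n))" by (rule complex_Re_le_cmod)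
    also have "\<dots> \<le> 2 * l" using D(2) a0 by simp
    finally show ?thesis .
  qed
  have "((\<lambda>t::real. \<Sum>k\<in>{1..K}. t ^ (k\<^sup>2)) \<longlongrightarrow> (\<Sum>k\<in>{1..K}. 1 ^ (k\<^sup>2))) (at_left 1)"
    by (intro tendsto_intros)
  moreover have "\<forall>\<^sub>F t in at_left (1::real). (\<Sum>k\<in>{1..K}. t ^ (k\<^sup>2)) \<le> real (2 * l)"
    using eventually_at_left_real[of 0 1] by (rule eventually_mono) (use bound in auto)
  ultimately have "(\<Sum>k\<in>{1..K}. 1 ^ (k\<^sup>2)) \<le> real (2 * l)"
    by (rule tendsto_upperbound) simp
  then show False by (simp add: K_def)
qed

end

end

section \<open>Nonvanishing of \<open>L(1, \<psi>)\<close> for complex characters\<close>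

text \<open>The mean value theorem for \<open>x powr (1 - s)\<close> takes the place of comparing
  the tail with an integral.\<close>

lemma powr_telescope:
  fixes s :: real
  assumes "s > 1" "n \<ge> 1"
  shows "real (Suc n) powr - s \<le> (real n powr (1 - s) - real (Suc n) powr (1 - s)) / (s - 1)"
proof -
  have "\<exists>z. real n < z \<and> z < real (Suc n) \<and>
      real (Suc n) powr (1 - s) - real n powr (1 - s) = (real (Suc n) - real n) * ((1 - s) * z powr - s)"
  proof (rule MVT2)
    fix x assume "real n \<le> x" "x \<le> real (Suc n)"
    then have "x > 0" using assms(2) by simp
    then show "((\<lambda>x. x powr (1 - s)) has_real_derivative (1 - s) * x powr - s) (at x)"
      using has_real_derivative_powr[of x "1 - s"] by simp
  qed simp
  then obtain z where z: "real n < z" "z < real (Suc n)"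
    "real (Suc n) powr (1 - s) - real n powr (1 - s) = (1 - s) * z powr - s" by auto
  have "real (Suc n) powr - s \<le> z powr - s"
    using z assms by (intro powr_mono2') auto
  also have "\<dots> = (real n powr (1 - s) - real (Suc n) powr (1 - s)) / (s - 1)"
    using z(3) assms(1) by (simp add: field_simps)
  finally show ?thesis .
qed

lemma sum_powr_tail:
  fixes s :: real
  assumes "s > 1" "y \<ge> 1"
  shows "(\<Sum>n\<in>{Suc y..N}. real n powr - s) \<le> real y powr (1 - s) / (s - 1)"
proof -
  have "(\<Sum>n\<in>{Suc y..N}. real n powr - s) \<le> (real y powr (1 - s) - real N powr (1 - s)) / (s - 1)" if "y \<le> N"
    using that
  proof (induction N rule: dec_induct)
    case (step n)
    have "(\<Sum>n\<in>{Suc y..Suc n}. real n powr - s) = (\<Sum>n\<in>{Suc y..n}. real n powr - s) + real (Suc n) powr - s"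
      using step by simp
    also have "\<dots> \<le> (real y powr (1 - s) - real n powr (1 - s)) / (s - 1) +
        (real n powr (1 - s) - real (Suc n) powr (1 - s)) / (s - 1)"
      using step powr_telescope[OF assms(1), of n] assms(2) by (intro add_mono) auto
    also have "\<dots> = (real y powr (1 - s) - real (Suc n) powr (1 - s)) / (s - 1)"
      by (simp add: add_divide_distrib[symmetric])
    finally show ?case .
  qed simp
  moreover have "(real y powr (1 - s) - real N powr (1 - s)) / (s - 1) \<le> real y powr (1 - s) / (s - 1)"
    using assms by (intro divide_right_mono) auto
  ultimately show ?thesis using assms by (cases "y \<le> N") (auto intro: order_trans)
qed

lemma powr_summable_on_tail:
  fixes s :: real
  assumes "s > 1" "y \<ge> 1"
  shows "(\<lambda>n. real n powr - s) summable_on {y<..}"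
    "(\<Sum>\<^sub>\<infinity>n\<in>{y<..}. real n powr - s) \<le> real y powr (1 - s) / (s - 1)"
proof -
  have b: "sum (\<lambda>n. real n powr - s) F \<le> real y powr (1 - s) / (s - 1)" if "finite F" "F \<subseteq> {y<..}" for F
  proof -
    have "sum (\<lambda>n. real n powr - s) F \<le> (\<Sum>n\<in>{Suc y..Max (insert y F)}. real n powr - s)"
      using that by (intro sum_mono2) (auto simp: Suc_le_eq)
    also have "\<dots> \<le> real y powr (1 - s) / (s - 1)" by (rule sum_powr_tail[OF assms])
    finally show ?thesis .
  qed
  show s: "(\<lambda>n. real n powr - s) summable_on {y<..}"
    by (rule nonneg_bdd_above_summable_on) (auto intro!: bdd_aboveI2 b)
  show "(\<Sum>\<^sub>\<infinity>n\<in>{y<..}. real n powr - s) \<le> real y powr (1 - s) / (s - 1)"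
    by (rule infsum_le_finite_sums[OF s]) (auto intro!: b)
qed

lemma powr_summable_on:
  fixes s :: real
  assumes "s > 1" "A \<subseteq> {0<..}"
  shows "(\<lambda>n. real n powr - s) summable_on A"
proof -
  have "(\<lambda>n. real n powr - s) summable_on ({1} \<union> {1<..})"
    by (rule summable_on_union) (use powr_summable_on_tail(1)[OF assms(1), of 1] in auto)
  moreover have "{1} \<union> {1<..} = {0::nat<..}" by auto
  ultimately show ?thesis using summable_on_subset assms(2) by metis
qed

section \<open>Sieved Dirichlet series in place of infinite Euler products\<close>

definition rough :: "nat set \<Rightarrow> nat set" where
  "rough S = {n. n > 0 \<and> (\<forall>p\<in>S. \<not> p dvd n)}"

text \<open>General enough to cover \<open>\<psi>\<close>, its square and the constant 1, whose
  series is the zeta function.\<close>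

locale bounded_multiplicative =
  fixes g :: "nat \<Rightarrow> complex"
  assumes g_mult: "g (m * n) = g m * g n" and g_1: "g 1 = 1" and g_norm: "norm (g n) \<le> 1"
begin

text \<open>The whole series for empty \<open>S\<close>, and what remains of the Euler product once
  the factors at the primes of \<open>S\<close> are removed.\<close>

definition euler_tail :: "real \<Rightarrow> nat set \<Rightarrow> complex" where
  "euler_tail s S = (\<Sum>\<^sub>\<infinity>n\<in>rough S. g n * of_real (real n powr - s))"

lemma abs_summable:
  assumes "s > 1" "A \<subseteq> {0<..}"
  shows "(\<lambda>n. norm (g n * of_real (real n powr - s))) summable_on A"
proof (rule Infinite_Sum.abs_summable_on_comparison_test)
  show "(\<lambda>n. norm (real n powr - s)) summable_on A" using powr_summable_on[OF assms] by simp
  fix n show "norm (g n * of_real (real n powr - s)) \<le> norm (real n powr - s)"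
    using mult_right_mono[OF g_norm[of n], of "real n powr - s"] by (simp add: norm_mult)
qed

text \<open>A number free of the primes in \<open>S\<close> is either free of \<open>p\<close> as
  well or \<open>p\<close> times a number free of the primes in \<open>S\<close>.\<close>

lemma euler_tail_insert:
  assumes "s > 1" "prime p" "p \<notin> S" "\<forall>q\<in>S. prime q"
  shows "euler_tail s (insert p S) = (1 - g p * of_real (real p powr - s)) * euler_tail s S"
proof -
  define f where "f n = g n * complex_of_real (real n powr - s)" for n
  have sm: "f summable_on A" if "A \<subseteq> {0<..}" for A
    unfolding f_def by (rule abs_summable_summable, rule abs_summable[OF assms(1) that])
  have p0: "p > 0" using assms(2) by (simp add: prime_gt_0_nat)
  have im: "rough S = rough (insert p S) \<union> (*) p ` rough S"
  proof (intro equalityI subsetI)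
    fix n assume n: "n \<in> rough S"
    show "n \<in> rough (insert p S) \<union> (*) p ` rough S"
    proof (cases "p dvd n")
      case True
      then obtain m where m: "n = p * m" by blast
      have "m \<in> rough S" using n unfolding rough_def m by auto
      then show ?thesis using m by blast
    qed (use n in \<open>auto simp: rough_def\<close>)
  next
    fix n assume "n \<in> rough (insert p S) \<union> (*) p ` rough S"
    then consider "n \<in> rough (insert p S)" | m where "n = p * m" "m \<in> rough S" by blast
    then show "n \<in> rough S"
    proof cases
      case 2
      have "\<not> q dvd n" if "q \<in> S" for q
      proof -
        have "prime q" "\<not> q dvd p" using that assms(2-4) primes_dvd_imp_eq[of q p] by auto
        then show ?thesis using that 2 unfolding rough_def by (auto simp: prime_dvd_mult_iff)
      qed
      then show ?thesis using 2 p0 by (auto simp: rough_def)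
    qed (auto simp: rough_def)
  qed
  have disj: "rough (insert p S) \<inter> (*) p ` rough S = {}" by (auto simp: rough_def)
  have "euler_tail s S = infsum f (rough (insert p S)) + infsum f ((*) p ` rough S)"
    unfolding euler_tail_def f_def[symmetric]
    by (subst im, rule infsum_Un_disjoint[OF sm sm disj]) (use p0 in \<open>auto simp: rough_def\<close>)
  also have "infsum f ((*) p ` rough S) = infsum (f \<circ> (*) p) (rough S)"
    by (rule infsum_reindex) (use p0 in \<open>auto intro!: inj_onI\<close>)
  also have "f \<circ> (*) p = (\<lambda>n. g p * of_real (real p powr - s) * f n)"
    using p0 by (auto simp: f_def g_mult powr_mult o_def)
  also have "infsum \<dots> (rough S) = g p * of_real (real p powr - s) * infsum f (rough S)"
    by (rule infsum_cmult_right')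
  finally have "euler_tail s S =
      euler_tail s (insert p S) + g p * of_real (real p powr - s) * euler_tail s S"
    unfolding euler_tail_def f_def[symmetric] .
  then show ?thesis unfolding left_diff_distrib mult_1 by (metis add_diff_cancel_right')
qed

text \<open>Apart from 1, a number without prime factors up to \<open>y\<close> exceeds
  \<open>y\<close>, so the rest is bounded by a tail of the zeta series.\<close>

lemma euler_tail_lim:
  assumes "s > 1"
  shows "(\<lambda>y. euler_tail s {p. prime p \<and> p \<le> y}) \<longlonglongrightarrow> 1"
proof -
  define f where "f n = g n * complex_of_real (real n powr - s)" for n
  have lim: "(\<lambda>y. real y powr (1 - s) / (s - 1)) \<longlonglongrightarrow> 0"
  proof -
    have "(\<lambda>y. real y powr (1 - s)) \<longlonglongrightarrow> 0"
      using assms by (intro tendsto_neg_powr filterlim_real_sequentially) auto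
    then have "(\<lambda>y. real y powr (1 - s) / (s - 1)) \<longlonglongrightarrow> 0 / (s - 1)"
      using assms by (intro tendsto_divide tendsto_const) auto
    then show ?thesis by simp
  qed
  have "(\<lambda>y. euler_tail s {p. prime p \<and> p \<le> y} - 1) \<longlonglongrightarrow> 0"
  proof (rule Lim_null_comparison[OF _ lim])
    show "\<forall>\<^sub>F y in sequentially. norm (euler_tail s {p. prime p \<and> p \<le> y} - 1) \<le> real y powr (1 - s) / (s - 1)"
      unfolding eventually_sequentially
    proof (intro exI allI impI)
      fix y :: nat assume y: "1 \<le> y"
      define A where "A = rough {p. prime p \<and> p \<le> y} - {1}"
      have A: "rough {p. prime p \<and> p \<le> y} = insert 1 A" "1 \<notin> A"
        by (auto simp: A_def rough_def)
      have sub: "A \<subseteq> {y<..}"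
      proof
        fix n assume n: "n \<in> A"
        then have "n \<noteq> 1" "n > 0" by (auto simp: A_def rough_def)
        then obtain p where p: "prime p" "p dvd n" using prime_factor_nat by blast
        then have "\<not> p \<le> y" using n by (auto simp: A_def rough_def)
        moreover have "p \<le> n" using p \<open>n > 0\<close> by (auto intro: dvd_imp_le)
        ultimately show "n \<in> {y<..}" by simp
      qed
      have ab: "(\<lambda>n. norm (f n)) summable_on A" unfolding f_def
        by (intro abs_summable assms) (use sub in auto)
      have "euler_tail s {p. prime p \<and> p \<le> y} = f 1 + infsum f A"
        unfolding euler_tail_def f_def[symmetric] A(1)
        by (rule infsum_insert[OF abs_summable_summable[OF ab] A(2)])
      then have "norm (euler_tail s {p. prime p \<and> p \<le> y} - 1) = norm (infsum f A)"
        using g_1 by (simp add: f_def)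
      also have "\<dots> \<le> infsum (\<lambda>n. norm (f n)) A" by (rule norm_infsum_bound[OF ab])
      also have "\<dots> \<le> (\<Sum>\<^sub>\<infinity>n\<in>{y<..}. real n powr - s)"
      proof (rule infsum_mono_neutral[OF ab powr_summable_on_tail(1)[OF assms y]])
        fix n
        show "norm (f n) \<le> real n powr - s" unfolding f_def
          using mult_right_mono[OF g_norm[of n], of "real n powr - s"] by (simp add: norm_mult)
      qed (use sub in auto)
      also have "\<dots> \<le> real y powr (1 - s) / (s - 1)" by (rule powr_summable_on_tail(2)[OF assms y])
      finally show "norm (euler_tail s {p. prime p \<and> p \<le> y} - 1) \<le> real y powr (1 - s) / (s - 1)" .
    qed
  qed
  from tendsto_add[OF this tendsto_const[of 1]] show ?thesis by simp
qed

text \<open>Unordered summation suits the sieve, whereas partial summation needs the terms in their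
  natural order.\<close>

lemma euler_tail_sums:
  assumes "s > 1"
  shows "(\<lambda>n. g (Suc n) * of_real (real (Suc n) powr - s)) sums euler_tail s {}"
proof -
  define f where "f n = g n * complex_of_real (real n powr - s)" for n
  have R: "rough {} = range Suc" by (auto simp: rough_def image_iff gr0_conv_Suc)
  have "f summable_on rough {}" unfolding f_def
    by (rule abs_summable_summable, rule abs_summable[OF assms]) (auto simp: rough_def)
  then have "(f has_sum euler_tail s {}) (range Suc)"
    unfolding euler_tail_def f_def[symmetric] R by (rule has_sum_infsum)
  then have "(f \<circ> Suc has_sum euler_tail s {}) UNIV"
    by (subst (asm) has_sum_reindex) auto
  then have "(f \<circ> Suc) sums euler_tail s {}" by (rule has_sum_imp_sums)
  then show ?thesis by (simp add: f_def o_def)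
qed

end

text \<open>The logarithm of the product is a series in which \<open>x ^ n / n\<close> has the
  coefficient \<open>- (3 + 4 * c + (2 * c\<^sup>2 - 1)) = - 2 * (1 + c)\<^sup>2\<close>, where
  \<open>c\<close> is the real part of \<open>z ^ n\<close>. The case \<open>z = 0\<close> belongs
  to primes dividing the modulus.\<close>

lemma three_four_one:
  fixes z :: complex and x :: real
  assumes x: "0 \<le> x" "x < 1" and z: "norm z = 1 \<or> z = 0"
  shows "norm (1 - of_real x :: complex) ^ 3 * norm (1 - z * of_real x) ^ 4 * norm (1 - z\<^sup>2 * of_real x) \<le> 1"
proof (cases "z = 0")
  case True
  have "norm (1 - of_real x :: complex) = 1 - x"
    using x by (metis abs_of_nonneg diff_ge_0_iff_ge less_imp_le norm_of_real of_real_1 of_real_diff)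
  then show ?thesis using x True by (simp add: power_le_one)
next
  case False
  then have nz: "norm z = 1" using z by simp
  define A B C where "A = complex_of_real x" "B = z * of_real x" "C = z\<^sup>2 * of_real x"
  have n: "norm A < 1" "norm B < 1" "norm C < 1"
    using x nz by (auto simp: A_B_C_def norm_mult norm_power)
  have L: "(\<lambda>n. Re (- (w ^ n) / of_nat n)) sums ln (norm (1 - w))" if "norm w < 1" for w :: complex
  proof -
    have e: "(-1) ^ Suc n / of_nat n * (- w) ^ n = - (w ^ n) / of_nat n" for n
    proof -
      have "(- 1 :: complex) ^ n * (- 1) ^ n = 1" by (simp add: power_mult_distrib[symmetric])
      then have "(- 1) ^ Suc n * ((- 1) ^ n * w ^ n) = - (w ^ n)" by (simp add: mult.assoc[symmetric])
      then show ?thesis unfolding power_minus[of w n] by simp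
    qed
    have "(\<lambda>n. (-1) ^ Suc n / of_nat n * (- w) ^ n) sums Ln (1 + - w)"
      by (rule Ln_series) (use that in simp)
    then have "(\<lambda>n. - (w ^ n) / of_nat n) sums Ln (1 - w)" unfolding e by simp
    then have "(\<lambda>n. Re (- (w ^ n) / of_nat n)) sums Re (Ln (1 - w))" by (rule sums_Re)
    moreover have "1 - w \<noteq> 0" using that by auto
    ultimately show ?thesis by simp
  qed
  have S: "(\<lambda>n. 3 * Re (- (A ^ n) / of_nat n) + 4 * Re (- (B ^ n) / of_nat n) + Re (- (C ^ n) / of_nat n))
      sums (3 * ln (norm (1 - A)) + 4 * ln (norm (1 - B)) + ln (norm (1 - C)))"
    by (intro sums_add sums_mult L n)
  have N: "3 * Re (- (A ^ n) / of_nat n) + 4 * Re (- (B ^ n) / of_nat n) + Re (- (C ^ n) / of_nat n) \<le> 0" for n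
  proof -
    define c where "c = Re (z ^ n)"
    have "(Re (z ^ n))\<^sup>2 + (Im (z ^ n))\<^sup>2 = 1" using nz by (simp add: cmod_power2[symmetric] norm_power)
    then have "Re ((z ^ n)\<^sup>2) = 2 * c\<^sup>2 - 1" unfolding c_def by (simp add: power2_eq_square)
    then have r: "Re ((z\<^sup>2) ^ n) = 2 * c\<^sup>2 - 1" by (simp add: power_mult[symmetric] mult.commute)
    have "Re (A ^ n) = x ^ n" "Re (B ^ n) = c * x ^ n" "Re (C ^ n) = (2 * c\<^sup>2 - 1) * x ^ n"
      unfolding A_B_C_def power_mult_distrib of_real_power[symmetric] using r by (simp_all add: c_def)
    moreover have "Re (- w / of_nat n) = - Re w / real n" for w by simp
    ultimately have "3 * Re (- (A ^ n) / of_nat n) + 4 * Re (- (B ^ n) / of_nat n) + Re (- (C ^ n) / of_nat n) =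
        - (2 * (1 + c)\<^sup>2 * x ^ n / n)"
      by (simp only: divide_inverse power2_eq_square) (simp add: algebra_simps)
    also have "\<dots> \<le> 0" using x by simp
    finally show ?thesis .
  qed
  have T: "3 * ln (norm (1 - A)) + 4 * ln (norm (1 - B)) + ln (norm (1 - C)) \<le> 0"
    by (rule sums_le[OF N S sums_zero])
  have p: "norm (1 - A) > 0" "norm (1 - B) > 0" "norm (1 - C) > 0" using n by auto
  have "ln (norm (1 - A) ^ 3 * norm (1 - B) ^ 4 * norm (1 - C)) \<le> 0"
    using T p by (simp add: ln_mult ln_realpow)
  then show ?thesis using p unfolding A_B_C_def by (subst (asm) ln_le_zero_iff) auto
qed

text \<open>The upper bound is linear in \<open>s - 1\<close> and uniform in \<open>n\<close>; it
  will make a zero of the L-series at 1 count at least once.\<close>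

lemma inverse_minus_powr_bounds:
  fixes s :: real
  assumes "s > 1" "n \<ge> 1"
  shows "0 \<le> 1 / real n - real n powr - s" "1 / real n - real n powr - s \<le> s - 1"
proof -
  have e: "real n powr - s = (1 / real n) * real n powr (1 - s)"
    using assms(2) by (simp add: powr_diff powr_minus field_simps)
  have l: "0 \<le> ln (real n)" "ln (real n) \<le> real n - 1" using assms(2) ln_le_minus_one[of "real n"] by auto
  have "real n powr (1 - s) \<le> real n powr 0" using assms by (intro powr_mono) auto
  then have a: "real n powr (1 - s) \<le> 1" using assms(2) by simp
  have "1 + (1 - s) * ln (real n) \<le> exp ((1 - s) * ln (real n))" by (rule exp_ge_add_one_self)
  then have b: "1 - real n powr (1 - s) \<le> (s - 1) * ln (real n)"
    using assms(2) by (simp add: powr_def algebra_simps)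
  have d: "1 / real n - real n powr - s = (1 / real n) * (1 - real n powr (1 - s))"
    unfolding e by (simp add: right_diff_distrib)
  show "0 \<le> 1 / real n - real n powr - s" unfolding d using a by simp
  have "(s - 1) * ln (real n) \<le> (s - 1) * real n" using l assms(1) by (intro mult_left_mono) auto
  then have "1 - real n powr (1 - s) \<le> (s - 1) * real n" using b by linarith
  then have "(1 / real n) * (1 - real n powr (1 - s)) \<le> (1 / real n) * ((s - 1) * real n)"
    by (rule mult_left_mono) simp
  then show "1 / real n - real n powr - s \<le> s - 1" unfolding d using assms(2) by simp
qed

text \<open>The derivative has the sign of \<open>s * x powr (1 - s) - 1\<close>, which is not
  positive once \<open>ln x \<ge> 1\<close>, because \<open>ln s \<le> s - 1\<close>. The start at 3
  is the first integer above \<open>exp 1\<close>.\<close>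

lemma inverse_minus_powr_dec:
  fixes s :: real
  assumes "s > 1" "n \<ge> 3"
  shows "1 / real (Suc n) - real (Suc n) powr - s \<le> 1 / real n - real n powr - s"
proof (rule DERIV_nonpos_imp_nonincreasing[where f = "\<lambda>x. 1 / x - x powr - s"])
  fix x assume x: "real n \<le> x" "x \<le> real (Suc n)"
  have x3: "x \<ge> 3" using x(1) assms(2) by linarith
  have "exp 1 \<le> x" using exp_le x3 by linarith
  then have "1 \<le> ln x" using x3 by (simp add: ln_ge_iff)
  then have "(s - 1) * 1 \<le> (s - 1) * ln x" using assms(1) by (intro mult_left_mono) auto
  moreover have "ln s \<le> s - 1" using assms(1) by (intro ln_le_minus_one) auto
  ultimately have "ln s + (1 - s) * ln x \<le> 0" by (simp add: algebra_simps)
  then have "exp (ln s + (1 - s) * ln x) \<le> 1" by simp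
  then have "s * x powr (1 - s) \<le> 1" using assms(1) x3 by (simp add: exp_add powr_def)
  moreover have "x powr (- s - 1) = x powr (1 - s) / x\<^sup>2"
  proof -
    have "- s - 1 = (1 - s) - 2" by simp
    then have "x powr (- s - 1) = x powr ((1 - s) - 2)" by (simp only:)
    also have "\<dots> = x powr (1 - s) / x powr 2" by (rule powr_diff)
    finally show ?thesis using x3 by simp
  qed
  ultimately have "- 1 / x\<^sup>2 - (- s * x powr (- s - 1)) = (s * x powr (1 - s) - 1) / x\<^sup>2"
    by (simp add: diff_divide_distrib)
  also have "\<dots> \<le> 0" using \<open>s * x powr (1 - s) \<le> 1\<close> by (intro divide_nonpos_nonneg) auto
  finally have "- 1 / x\<^sup>2 - (- s * x powr (- s - 1)) \<le> 0" .
  moreover have "((\<lambda>x. 1 / x - x powr - s) has_real_derivative (- 1 / x\<^sup>2 - (- s * x powr (- s - 1)))) (at x)"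
    using x3 by (auto intro!: derivative_eq_intros simp: power2_eq_square)
  ultimately show "\<exists>y. ((\<lambda>x. 1 / x - x powr - s) has_real_derivative y) (at x) \<and> y \<le> 0" by blast
qed simp

section \<open>The L-series near 1 and the product with exponents 3, 4, 1\<close>

context dirichlet_character
begin

sublocale bounded_multiplicative \<psi>
  by unfold_locales (auto simp: mult norm_le_1 simp del: One_nat_def)

lemma square_character: "dirichlet_character l (\<lambda>n. (\<psi> n)\<^sup>2)"
  by unfold_locales (auto simp: modulus_pos mult power_mult_distrib periodic nonzero_iff)

lemma L_function_bounded:
  fixes s :: real
  assumes "s > 1" "coprime u l" "\<psi> u \<noteq> 1"
  shows "norm (euler_tail s {}) \<le> 2 * l"
proof -
  define a where "a n = real (Suc n) powr - s" for n
  have b: "norm (\<Sum>n<N. \<psi> (Suc n)) \<le> 2 * l" for N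
    using partial_sums_bounded_from[OF assms(2,3), of 1 N] unfolding Suc_eq_plus1 .
  have dec: "a (Suc n) \<le> a n" for n unfolding a_def using assms(1) by (intro powr_mono2') auto
  have lim: "a \<longlonglongrightarrow> 0" unfolding a_def
    using assms(1) by (intro tendsto_neg_powr filterlim_compose[OF filterlim_real_sequentially filterlim_Suc]) auto
  have "norm (\<Sum>n. \<psi> (Suc n) * a n) \<le> (2 * l) * a 0" by (rule dirichlet_test(2)[OF b dec lim])
  moreover have "(\<Sum>n. \<psi> (Suc n) * a n) = euler_tail s {}"
    unfolding a_def by (rule sums_unique[OF euler_tail_sums[OF assms(1)], symmetric])
  ultimately show ?thesis by (simp add: a_def)
qed

text \<open>No derivative of the L-series is taken: the vanishing series at 1 is subtracted
  termwise. From \<open>n = 3\<close> on the weights decrease and are at most \<open>s - 1\<close>,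
  giving \<open>2 * l\<close>; the terms \<open>n = 1\<close> and \<open>n = 2\<close> are bounded
  singly and give the remaining 2.\<close>

lemma L_function_near_1:
  fixes s :: real
  assumes L: "(\<lambda>n. \<psi> (Suc n) / of_nat (Suc n)) sums 0"
    and s: "s > 1" and u: "coprime u l" "\<psi> u \<noteq> 1"
  shows "norm (euler_tail s {}) \<le> (2 * l + 2) * (s - 1)"
proof -
  define a where "a n = 1 / real n - real n powr - s" for n
  have c: "complex_of_real (a n) = 1 / of_nat n - of_real (real n powr - s)" for n by (simp add: a_def)
  have "(\<lambda>n. \<psi> (Suc n) / of_nat (Suc n) - \<psi> (Suc n) * of_real (real (Suc n) powr - s)) sums (0 - euler_tail s {})"
    by (intro sums_diff L euler_tail_sums s)
  then have S: "(\<lambda>n. \<psi> (Suc n) * a (Suc n)) sums (- euler_tail s {})"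
    unfolding c by (simp add: right_diff_distrib)
  then have "(\<lambda>n. \<psi> (Suc (n + 2)) * a (Suc (n + 2))) sums (- euler_tail s {} - (\<Sum>n<2. \<psi> (Suc n) * a (Suc n)))"
    by (rule sums_split_initial_segment)
  then have S3: "(\<lambda>n. \<psi> (n + 3) * a (n + 3)) sums (- euler_tail s {} - (\<psi> 1 * a 1 + \<psi> 2 * a 2))"
    by (simp add: numeral_2_eq_2 numeral_3_eq_3)
  have b: "norm (\<Sum>n<N. \<psi> (n + 3)) \<le> 2 * l" for N by (rule partial_sums_bounded_from[OF u])
  have dec: "a (Suc n + 3) \<le> a (n + 3)" for n
    using inverse_minus_powr_dec[OF s, of "n + 3"] by (simp add: a_def)
  have lim: "(\<lambda>n. a (n + 3)) \<longlonglongrightarrow> 0"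
  proof (rule LIMSEQ_ignore_initial_segment)
    have "a \<longlonglongrightarrow> 0 - 0" unfolding a_def
      using s by (intro tendsto_diff lim_1_over_n tendsto_neg_powr filterlim_real_sequentially) auto
    then show "a \<longlonglongrightarrow> 0" by simp
  qed
  have "norm (\<Sum>n. \<psi> (n + 3) * a (n + 3)) \<le> 2 * l * a (0 + 3)"
    by (rule dirichlet_test(2)[OF b dec lim])
  then have n1: "norm (- euler_tail s {} - (\<psi> 1 * a 1 + \<psi> 2 * a 2)) \<le> 2 * l * a 3"
    using sums_unique[OF S3] by simp
  have ab: "0 \<le> a n" "a n \<le> s - 1" if "n \<ge> 1" for n
    unfolding a_def using inverse_minus_powr_bounds[OF s that] by auto
  have t: "norm (\<psi> n * a n) \<le> s - 1" if "n \<ge> 1" for n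
    using mult_mono[OF norm_le_1[of n] ab(2)[OF that]] ab(1)[OF that] by (simp add: norm_mult)
  have "norm (euler_tail s {}) = norm (- euler_tail s {} - (\<psi> 1 * a 1 + \<psi> 2 * a 2) + (\<psi> 1 * a 1 + \<psi> 2 * a 2))"
    by simp
  also have "\<dots> \<le> 2 * l * a 3 + ((s - 1) + (s - 1))"
    by (intro norm_triangle_le add_mono n1 t) auto
  also have "2 * l * a 3 \<le> 2 * l * (s - 1)" using ab[of 3] by (intro mult_left_mono) auto
  finally show ?thesis by (simp add: algebra_simps)
qed

text \<open>Removing the factors at one more prime from all three series does not increase the
  product, by \<open>three_four_one\<close>, and once all primes are removed its limit is 1.\<close>

lemma euler_product_ge_1:
  fixes s :: real
  assumes s: "s > 1"
  shows "1 \<le> norm (bounded_multiplicative.euler_tail (\<lambda>_. 1) s {}) ^ 3 * norm (euler_tail s {}) ^ 4 *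
    norm (bounded_multiplicative.euler_tail (\<lambda>n. (\<psi> n)\<^sup>2) s {})"
proof -
  interpret Z: bounded_multiplicative "\<lambda>_. 1" by unfold_locales auto
  interpret Q: dirichlet_character l "\<lambda>n. (\<psi> n)\<^sup>2" by (rule square_character)
  define F where "F S = norm (Z.euler_tail s S) ^ 3 * norm (euler_tail s S) ^ 4 * norm (Q.euler_tail s S)" for S
  have mono: "F S \<le> F {}" if "finite S" "\<forall>p\<in>S. prime p" for S
    using that
  proof (induction S rule: finite_induct)
    case (insert p S)
    define x where "x = real p powr - s"
    have p2: "real p > 1" using insert.prems prime_gt_1_nat[of p] by simp
    have x: "0 \<le> x" "x < 1" unfolding x_def using p2 s by (auto simp: powr_less_one)
    have "F (insert p S) = (norm (1 - complex_of_real x) ^ 3 * norm (1 - \<psi> p * of_real x) ^ 4 * norm (1 - (\<psi> p)\<^sup>2 * of_real x)) * F S"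
      unfolding F_def x_def using insert s
      by (simp add: Z.euler_tail_insert euler_tail_insert Q.euler_tail_insert norm_mult power_mult_distrib)
    also have "\<dots> \<le> 1 * F S"
    proof (rule mult_right_mono)
      have "norm (\<psi> p) = 1 \<or> \<psi> p = 0" using norm_1 nonzero_iff by blast
      then show "norm (1 - complex_of_real x) ^ 3 * norm (1 - \<psi> p * of_real x) ^ 4 * norm (1 - (\<psi> p)\<^sup>2 * of_real x) \<le> 1"
        by (rule three_four_one[OF x])
    qed (simp add: F_def)
    also have "1 * F S \<le> F {}" using insert by simp
    finally show ?case .
  qed simp
  have "(\<lambda>y. F {p. prime p \<and> p \<le> y}) \<longlonglongrightarrow> norm (1::complex) ^ 3 * norm (1::complex) ^ 4 * norm (1::complex)"
    unfolding F_def by (intro tendsto_mult tendsto_power tendsto_norm Z.euler_tail_lim euler_tail_lim Q.euler_tail_lim s)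
  moreover have "\<forall>\<^sub>F y in sequentially. F {p. prime p \<and> p \<le> y} \<le> F {}"
    by (intro always_eventually allI mono) auto
  ultimately have "norm (1::complex) ^ 3 * norm (1::complex) ^ 4 * norm (1::complex) \<le> F {}"
    by (rule tendsto_upperbound) simp
  then show ?thesis by (simp add: F_def)
qed

text \<open>If \<open>L(1, \<psi>) = 0\<close>, the product \<open>\<zeta>(s)\<^sup>3 L(s, \<psi>)\<^sup>4 L(s, \<psi>\<^sup>2)\<close> tends to \<open>0\<close> as \<open>s\<close> tends to \<open>1\<close>.\<close>

lemma nonvanishing_complex:
  assumes u: "coprime u l" "(\<psi> u)\<^sup>2 \<noteq> 1"
  shows "\<not> (\<lambda>n. \<psi> (Suc n) / of_nat (Suc n)) sums 0"
proof
  assume L: "(\<lambda>n. \<psi> (Suc n) / of_nat (Suc n)) sums 0"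
  interpret Z: bounded_multiplicative "\<lambda>_. 1" by unfold_locales auto
  interpret Q: dirichlet_character l "\<lambda>n. (\<psi> n)\<^sup>2" by (rule square_character)
  have u1: "\<psi> u \<noteq> 1" using u(2) by auto
  define C where "C = real (2 * l + 2)"
  have C: "C > 0" by (simp add: C_def)
  \<comment> \<open>Chosen so that the final bound \<open>8 * C ^ 5 * (s - 1)\<close> is at most
    \<open>1 / 2\<close>; the cap 1 serves \<open>1 \<le> 1 / (s - 1)\<close> in the zeta
    bound.\<close>
  define s where "s = 1 + min 1 (1 / (16 * C ^ 5))"
  have e: "0 < s - 1" "s - 1 \<le> 1" "s - 1 \<le> 1 / (16 * C ^ 5)" using C by (auto simp: s_def)
  then have s: "s > 1" by simp
  have z: "norm (Z.euler_tail s {}) \<le> 2 / (s - 1)"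
  proof -
    have "norm (Z.euler_tail s {}) \<le> 1 + 1 / (s - 1)"
    proof -
      have "rough {} = insert 1 {1<..}" by (auto simp: rough_def)
      then have "norm (Z.euler_tail s {}) \<le> (\<Sum>\<^sub>\<infinity>n\<in>insert 1 {1<..}. norm (1 * complex_of_real (real n powr - s)))"
        unfolding Z.euler_tail_def by (metis norm_infsum_bound Z.abs_summable[OF s] greaterThan_iff insertE less_trans subsetI zero_less_one)
      also have "\<dots> = (\<Sum>\<^sub>\<infinity>n\<in>insert 1 {1<..}. real n powr - s)" by simp
      also have "\<dots> = 1 + (\<Sum>\<^sub>\<infinity>n\<in>{1<..}. real n powr - s)"
        by (subst infsum_insert) (use powr_summable_on_tail(1)[OF s, of 1] in auto)
      finally show ?thesis using powr_summable_on_tail(2)[OF s, of 1] by simp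
    qed
    also have "\<dots> \<le> 1 / (s - 1) + 1 / (s - 1)" using e by (intro add_right_mono) simp
    finally show ?thesis by simp
  qed
  have p: "norm (euler_tail s {}) \<le> C * (s - 1)"
    unfolding C_def by (rule L_function_near_1[OF L s u(1) u1])
  \<comment> \<open>The square of \<open>\<psi>\<close> is nontrivial at \<open>u\<close>, so its
    series has bounded partial character sums and no pole at 1.\<close>
  have q: "norm (Q.euler_tail s {}) \<le> C"
    using Q.L_function_bounded[OF s u] by (simp add: C_def)
  have "1 \<le> norm (Z.euler_tail s {}) ^ 3 * norm (euler_tail s {}) ^ 4 * norm (Q.euler_tail s {})"
    by (rule euler_product_ge_1[OF s])
  also have "\<dots> \<le> (2 / (s - 1)) ^ 3 * (C * (s - 1)) ^ 4 * C"
    using z p q e C by (intro mult_mono power_mono) auto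
  also have "\<dots> = 8 * C ^ 5 * (s - 1)"
  proof -
    have "(2 / d) ^ 3 * (C * d) ^ 4 * C = 8 * C ^ 5 * d" if "d \<noteq> 0" for d :: real
      using that by (simp add: field_simps eval_nat_numeral)
    then show ?thesis using e(1) by simp
  qed
  also have "\<dots> \<le> 8 * C ^ 5 * (1 / (16 * C ^ 5))" using e(3) C by (intro mult_left_mono) auto
  also have "\<dots> = 1 / 2" using C by simp
  finally show False by simp
qed

theorem L_1_nonzero:
  assumes u: "coprime u l" "\<psi> u \<noteq> 1"
  shows "\<not> (\<lambda>n. \<psi> (Suc n) / of_nat (Suc n)) sums 0"
proof (cases "\<exists>v. coprime v l \<and> (\<psi> v)\<^sup>2 \<noteq> 1")
  case False
  have "\<psi> n \<in> {-1, 0, 1}" for n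
  proof (cases "coprime n l")
    case True
    then have "(\<psi> n)\<^sup>2 = 1" using False by blast
    then show ?thesis by (auto simp: power2_eq_1_iff)
  qed (use nonzero_iff in auto)
  then show ?thesis using nonvanishing_real u by blast
qed (use nonvanishing_complex in blast)

end

section \<open>Linear independence of cotangents\<close>

text \<open>The logarithmic derivative of the reflection formula: the product of
  \<open>Gamma t\<close>, \<open>Gamma (1 - t)\<close> and \<open>sin (pi * t)\<close> is constant
  on the unit interval.\<close>

lemma Digamma_reflection:
  fixes x :: real
  assumes "0 < x" "x < 1"
  shows "Digamma (1 - x) - Digamma x = pi * cot (pi * x)"
proof -
  have ni: "x \<notin> \<int>\<^sub>\<le>\<^sub>0" "1 - x \<notin> \<int>\<^sub>\<le>\<^sub>0" using assms by (auto elim!: nonpos_Ints_cases)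
  have refl: "Gamma t * Gamma (1 - t) * sin (pi * t) = pi" if "0 < t" "t < 1" for t :: real
  proof -
    have "complex_of_real (Gamma t * Gamma (1 - t)) = complex_of_real (pi / sin (pi * t))"
      using Gamma_reflection_complex[of "of_real t"]
      by (simp add: Gamma_complex_of_real[symmetric] sin_of_real[symmetric])
    then have "Gamma t * Gamma (1 - t) = pi / sin (pi * t)" by (simp only: of_real_eq_iff)
    moreover have "sin (pi * t) > 0" using that by (intro sin_gt_zero) auto
    ultimately show ?thesis by simp
  qed
  define G where "G = Gamma x * Gamma (1 - x)"
  have "((\<lambda>t. Gamma t * Gamma (1 - t) * sin (pi * t)) has_real_derivative
      (Gamma x * Digamma x * Gamma (1 - x) + (Gamma (1 - x) * Digamma (1 - x) * - 1) * Gamma x) * sin (pi * x)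
       + (cos (pi * x) * pi) * (Gamma x * Gamma (1 - x))) (at x)"
    using ni by (auto intro!: derivative_eq_intros)
  moreover have "((\<lambda>t. Gamma t * Gamma (1 - t) * sin (pi * t)) has_real_derivative 0) (at x)"
  proof (rule has_field_derivative_transform_within_open[of "\<lambda>_. pi" _ _ "{0<..<1}"])
    show "pi = Gamma t * Gamma (1 - t) * sin (pi * t)" if "t \<in> {0<..<1}" for t using refl[of t] that by simp
  qed (use assms in auto)
  ultimately have "(Gamma x * Digamma x * Gamma (1 - x) + (Gamma (1 - x) * Digamma (1 - x) * - 1) * Gamma x) * sin (pi * x)
       + (cos (pi * x) * pi) * (Gamma x * Gamma (1 - x)) = 0"
    by (rule DERIV_unique)
  then have "G * ((Digamma x - Digamma (1 - x)) * sin (pi * x) + cos (pi * x) * pi) = 0"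
    unfolding G_def by (simp add: algebra_simps)
  moreover have "G \<noteq> 0" using refl[OF assms] by (auto simp: G_def)
  ultimately have "(Digamma x - Digamma (1 - x)) * sin (pi * x) + cos (pi * x) * pi = 0"
    by (metis mult_eq_0_iff)
  then have "(Digamma (1 - x) - Digamma x) * sin (pi * x) = pi * cos (pi * x)"
    by (simp add: algebra_simps)
  moreover have "sin (pi * x) > 0" using assms by (intro sin_gt_zero) auto
  ultimately show ?thesis by (simp add: cot_def field_simps)
qed

text \<open>The difference of the \<open>Digamma\<close> series at \<open>1 - e / l\<close> and at
  \<open>e / l\<close>. The pairing of \<open>e\<close> with \<open>l - e\<close> is the one that an
  odd character produces.\<close>

lemma cot_partial_fractions:
  fixes e l :: nat
  assumes "0 < e" "e < l"
  shows "(\<lambda>k. 1 / real (k * l + e) - 1 / real (k * l + (l - e))) sums (pi / l * cot (pi * e / l))"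
proof -
  define x where "x = real e / real l"
  have x: "0 < x" "x < 1" using assms by (auto simp: x_def)
  have s: "(\<lambda>k. inverse (real (Suc k)) - inverse (z + real k)) sums (Digamma z + euler_mascheroni)" if "z > 0" for z :: real
    using summable_sums[OF summable_Digamma[of z]] that by (auto simp: Digamma_def)
  have "(\<lambda>k. (inverse (real (Suc k)) - inverse (1 - x + real k)) - (inverse (real (Suc k)) - inverse (x + real k)))
      sums ((Digamma (1 - x) + euler_mascheroni) - (Digamma x + euler_mascheroni))"
    by (intro sums_diff s) (use x in auto)
  then have "(\<lambda>k. inverse (x + real k) - inverse (1 - x + real k)) sums (pi * cot (pi * x))"
    using Digamma_reflection[OF x] by simp
  then have "(\<lambda>k. (inverse (x + real k) - inverse (1 - x + real k)) * (1 / l)) sums (pi * cot (pi * x) * (1 / l))"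
    by (rule sums_mult2)
  moreover have "(inverse (x + real k) - inverse (1 - x + real k)) * (1 / l) =
      1 / real (k * l + e) - 1 / real (k * l + (l - e))" for k
  proof -
    have "real l * (x + real k) = real (k * l + e)" "real l * (1 - x + real k) = real (k * l + (l - e))"
      using assms by (simp_all add: x_def of_nat_diff algebra_simps)
    then have "1 / real (k * l + e) = inverse (x + real k) * (1 / l)"
      "1 / real (k * l + (l - e)) = inverse (1 - x + real k) * (1 / l)"
      by (simp_all only: inverse_eq_divide) (metis mult.commute divide_divide_eq_left mult.right_neutral times_divide_times_eq)+
    then show ?thesis by (simp only: left_diff_distrib)
  qed
  ultimately show ?thesis by (simp add: x_def)
qed

lemma sum_powers_roots_unity:
  fixes j n :: nat
  assumes "n > 0"
  shows "(\<Sum>z | z ^ n = (1::complex). z ^ j) = (if n dvd j then of_nat n else 0)"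
proof (cases "n dvd j")
  case True
  then obtain q where "j = n * q" by blast
  then have "(\<Sum>z | z ^ n = (1::complex). z ^ j) = (\<Sum>z | z ^ n = (1::complex). 1)"
    by (intro sum.cong) (auto simp: power_mult)
  then show ?thesis using True card_roots_unity_eq[OF assms] by simp
next
  case False
  define w where "w = cis (2 * pi * real 1 / real n)"
  have w0: "w \<noteq> 0" by (simp add: w_def)
  have w: "w ^ n = 1" using assms by (simp add: w_def Complex.DeMoivre)
  have wj: "w ^ j \<noteq> 1"
  proof
    assume "w ^ j = 1"
    then have "cis (real j * (2 * pi * real 1 / real n)) = 1"
      by (simp only: w_def Complex.DeMoivre)
    then have "exp (2 * of_real pi * \<i> * of_nat j / of_nat n) = 1"
      by (simp add: cis_conv_exp mult_ac)
    then show False using complex_root_unity_eq_1[of n j] False assms by simp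
  qed
  have "(\<Sum>z | z ^ n = (1::complex). z ^ j) = (\<Sum>z | z ^ n = (1::complex). (w * z) ^ j)"
    using w w0 by (intro sum.reindex_bij_witness[of _ "\<lambda>z. w * z" "\<lambda>z. z / w"])
      (auto simp: power_mult_distrib power_divide)
  also have "\<dots> = w ^ j * (\<Sum>z | z ^ n = (1::complex). z ^ j)"
    by (simp add: power_mult_distrib sum_distrib_left)
  finally have "(w ^ j - 1) * (\<Sum>z | z ^ n = (1::complex). z ^ j) = 0" by (simp add: algebra_simps)
  then show ?thesis using wj False by simp
qed

section \<open>Cotangent sums of odd characters\<close>

context dirichlet_character
begin

text \<open>Cutting the L-series into blocks of length \<open>l\<close> and averaging it with its
  reflection \<open>e\<close> to \<open>l - e\<close> turns it into partial fractions of cotangents;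
  the sum is \<open>2 * l / pi\<close> times \<open>L(1, \<psi>)\<close>.\<close>

lemma odd_character_cot_nonzero:
  assumes l: "l \<ge> 2" and odd: "\<psi> (l - 1) = - 1"
  shows "(\<Sum>e<l. \<psi> e * of_real (cot (pi * e / l))) \<noteq> 0"
proof
  assume Z: "(\<Sum>e<l. \<psi> e * of_real (cot (pi * e / l))) = 0"
  have u: "coprime (l - 1) l" "\<psi> (l - 1) \<noteq> 1" using odd nonzero_iff[of "l - 1"] by auto
  have neg: "\<psi> (l - e) = - \<psi> e" if "e < l" for e
  proof -
    have "(l - 1) * e + e = l * e" using l by (cases l) auto
    moreover have "[l * e = 0] (mod l)" by (simp add: cong_0_iff)
    moreover have "[l - e + e = 0] (mod l)" using that by (simp add: cong_0_iff)
    ultimately have "[l - e + e = (l - 1) * e + e] (mod l)" by (metis cong_sym cong_trans)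
    then have "[l - e = (l - 1) * e] (mod l)" by (metis cong_add_rcancel_nat)
    then show ?thesis using cong mult odd by (metis mult_minus1)
  qed
  \<comment> \<open>The index \<open>e = 0\<close>, where \<open>cot\<close> and the fraction in the
    first block take default values, thus carries the coefficient 0.\<close>
  have z0: "\<psi> 0 = 0" using nonzero_iff[of 0] l by auto
  have b: "norm (\<Sum>n<N. \<psi> (Suc n)) \<le> 2 * l" for N
    using partial_sums_bounded_from[OF u, of 1 N] unfolding Suc_eq_plus1 .
  have "summable (\<lambda>n. \<psi> (Suc n) * complex_of_real (inverse (real (Suc n))))"
    by (rule dirichlet_test(1)[OF b _ LIMSEQ_inverse_real_of_nat]) (simp add: field_simps)
  then have "summable (\<lambda>n. \<psi> (Suc n) / of_nat (Suc n))"
    by (simp add: divide_inverse del: of_nat_Suc)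
  then obtain L where L: "(\<lambda>n. \<psi> (Suc n) / of_nat (Suc n)) sums L" by (auto simp: summable_def)
  then have "(\<lambda>n. \<psi> n / of_nat n) sums (L + \<psi> 0 / of_nat 0)" by (subst (asm) sums_Suc_iff) simp
  then have "(\<lambda>N. \<Sum>n<N. \<psi> n / of_nat n) \<longlonglongrightarrow> L" by (simp add: sums_def)
  \<comment> \<open>Only whole blocks are summed, so that \<open>e\<close> and \<open>l - e\<close>
    always occur together.\<close>
  moreover have "filterlim (\<lambda>N. N * l) sequentially sequentially"
    using l by (intro filterlim_subseq strict_monoI) auto
  ultimately have lim: "(\<lambda>N. \<Sum>n<N * l. \<psi> n / of_nat n) \<longlonglongrightarrow> L"
    by (rule filterlim_compose)
  have "2 * (\<Sum>n<N * l. \<psi> n / of_nat n) =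
      (\<Sum>k<N. \<Sum>e<l. \<psi> e * of_real (1 / real (k * l + e) - 1 / real (k * l + (l - e))))" for N
  proof -
    have "(\<Sum>n<N * l. \<psi> n / of_nat n) = (\<Sum>k<N. \<Sum>n\<in>{k * l..<k * l + l}. \<psi> n / of_nat n)"
      by (rule sum.nat_group[symmetric])
    also have "\<dots> = (\<Sum>k<N. \<Sum>e<l. \<psi> e / of_nat (k * l + e))"
    proof (rule sum.cong[OF refl])
      fix k
      have "(\<Sum>n\<in>{k * l..<k * l + l}. \<psi> n / of_nat n) = (\<Sum>e<l. \<psi> (e + k * l) / of_nat (e + k * l))"
        using sum.shift_bounds_nat_ivl[of "\<lambda>n. \<psi> n / of_nat n" 0 "k * l" l]
        by (simp add: lessThan_atLeast0 add.commute)
      then show "(\<Sum>n\<in>{k * l..<k * l + l}. \<psi> n / of_nat n) = (\<Sum>e<l. \<psi> e / of_nat (k * l + e))"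
        using periodic_mult[of _ k] by (simp add: add.commute mult.commute)
    qed
    finally have A: "(\<Sum>n<N * l. \<psi> n / of_nat n) = (\<Sum>k<N. \<Sum>e<l. \<psi> e / of_nat (k * l + e))" .
    have B: "(\<Sum>e<l. \<psi> e / of_nat (k * l + e)) = (\<Sum>e<l. - \<psi> e / of_nat (k * l + (l - e)))" for k
    proof -
      have split: "{..<l} = insert 0 {0<..<l}" using l by auto
      have "(\<Sum>e\<in>{0<..<l}. \<psi> e / of_nat (k * l + e)) = (\<Sum>e\<in>{0<..<l}. - \<psi> e / of_nat (k * l + (l - e)))"
        by (rule sum.reindex_bij_witness[of _ "\<lambda>e. l - e" "\<lambda>e. l - e"]) (auto simp: neg)
      then show ?thesis unfolding split by (simp add: z0 add_diff_eq)
    qed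
    have "2 * (\<Sum>n<N * l. \<psi> n / of_nat n) =
        (\<Sum>k<N. (\<Sum>e<l. \<psi> e / of_nat (k * l + e)) + (\<Sum>e<l. - \<psi> e / of_nat (k * l + (l - e))))"
      unfolding A B[symmetric] by (simp add: sum_distrib_left)
    also have "\<dots> = (\<Sum>k<N. \<Sum>e<l. \<psi> e * of_real (1 / real (k * l + e) - 1 / real (k * l + (l - e))))"
      by (simp add: sum.distrib[symmetric] right_diff_distrib)
    finally show ?thesis .
  qed
  moreover have "(\<lambda>N. \<Sum>k<N. \<Sum>e<l. \<psi> e * of_real (1 / real (k * l + e) - 1 / real (k * l + (l - e)))) \<longlonglongrightarrow>
      (\<Sum>e<l. \<psi> e * of_real (pi / l * cot (pi * e / l)))"
  proof -
    have "(\<lambda>k. \<psi> e * of_real (1 / real (k * l + e) - 1 / real (k * l + (l - e)))) sums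
        (\<psi> e * of_real (pi / l * cot (pi * e / l)))" if "e < l" for e
    proof (cases "e = 0")
      case False
      then show ?thesis using that by (intro sums_mult sums_of_real cot_partial_fractions) auto
    qed (simp add: z0)
    then have "(\<lambda>k. \<Sum>e<l. \<psi> e * of_real (1 / real (k * l + e) - 1 / real (k * l + (l - e)))) sums
        (\<Sum>e<l. \<psi> e * of_real (pi / l * cot (pi * e / l)))" by (intro sums_sum) auto
    then show ?thesis by (simp add: sums_def)
  qed
  moreover have "(\<Sum>e<l. \<psi> e * of_real (pi / l * cot (pi * e / l))) = of_real (pi / l) * (\<Sum>e<l. \<psi> e * of_real (cot (pi * e / l)))"
    by (simp add: sum_distrib_left mult_ac)
  ultimately have "(\<lambda>N. 2 * (\<Sum>n<N * l. \<psi> n / of_nat n)) \<longlonglongrightarrow> 0" using Z by simp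
  moreover have "(\<lambda>N. 2 * (\<Sum>n<N * l. \<psi> n / of_nat n)) \<longlonglongrightarrow> 2 * L" by (intro tendsto_mult tendsto_const lim)
  ultimately have "2 * L = 0" by (rule LIMSEQ_unique[symmetric])
  then show False using L L_1_nonzero[OF u] by simp
qed

end

text \<open>The linear relations between the numbers \<open>cot (\<pi> e / l)\<close>, \<open>e\<close> coprime to \<open>l\<close>, that hold
  together with all their conjugates, up to the trivial ones given by \<open>cot (-t) = - cot t\<close>.\<close>

definition cot_kernel :: "nat \<Rightarrow> (nat \<Rightarrow> complex) set" where
  "cot_kernel l = {f. (\<forall>n. f (n mod l) = f n) \<and> (\<forall>n. \<not> coprime n l \<longrightarrow> f n = 0) \<and>
     (\<forall>n. f ((l - 1) * n) = - f n) \<and>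
     (\<forall>x. coprime x l \<longrightarrow> (\<Sum>e<l. f e * of_real (cot (pi * real (e * x) / l))) = 0)}"

lemma cot_kernelD:
  assumes "f \<in> cot_kernel l"
  shows "f (n mod l) = f n" "\<not> coprime n l \<Longrightarrow> f n = 0" "f ((l - 1) * n) = - f n"
    "coprime x l \<Longrightarrow> (\<Sum>e<l. f e * of_real (cot (pi * real (e * x) / l))) = 0"
  using assms unfolding cot_kernel_def by blast+

lemma cot_mod:
  assumes "l > 0"
  shows "cot (pi * real (m mod l) / l) = cot (pi * real m / l)"
proof -
  have "real m = real (m mod l) + real (m div l) * real l"
    by (metis add.commute div_mult_mod_eq of_nat_add of_nat_mult)
  then have "pi * real m / l = pi * real (m mod l) / l + of_int (int (m div l)) * pi"
    using assms by (simp add: field_simps)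
  then show ?thesis by (simp add: cot_def sin_add cos_add sin_int_times_real)
qed

lemma cot_kernel_linear:
  assumes "\<And>j. j \<in> J \<Longrightarrow> f j \<in> cot_kernel l"
  shows "(\<lambda>n. \<Sum>j\<in>J. c j * f j n) \<in> cot_kernel l"
proof -
  have "(\<Sum>e<l. (\<Sum>j\<in>J. c j * f j e) * of_real (cot (pi * real (e * x) / l))) = 0" if "coprime x l" for x
  proof -
    have "(\<Sum>e<l. (\<Sum>j\<in>J. c j * f j e) * of_real (cot (pi * real (e * x) / l))) =
        (\<Sum>j\<in>J. c j * (\<Sum>e<l. f j e * of_real (cot (pi * real (e * x) / l))))"
      unfolding sum_distrib_right sum_distrib_left by (subst sum.swap) (simp add: mult.assoc)
    also have "\<dots> = 0" using cot_kernelD(4)[OF assms that] by (intro sum.neutral) simp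
    finally show ?thesis .
  qed
  then show ?thesis using assms unfolding cot_kernel_def
    by (auto simp: sum_negf[symmetric] intro!: sum.cong sum.neutral)
qed

text \<open>Substituting the inverse multiple of \<open>e\<close> replaces \<open>x\<close> by
  \<open>v * x\<close>, again a unit. The kernel is stable because it asks for the relation at every
  unit \<open>x\<close>.\<close>

lemma cot_kernel_translate:
  assumes l: "l > 0" and f: "f \<in> cot_kernel l" and u: "coprime u l"
  shows "(\<lambda>n. f (u * n)) \<in> cot_kernel l"
proof -
  have per: "f (n mod l) = f n" and supp: "\<not> coprime n l \<Longrightarrow> f n = 0" and odd: "f ((l - 1) * n) = - f n" for n
    using cot_kernelD[OF f] by blast+
  obtain v where v: "[u * v = 1] (mod l)" using cong_solve_coprime_nat[OF u] by auto
  have "(\<Sum>e<l. f (u * e) * of_real (cot (pi * real (e * x) / l))) = 0" if x: "coprime x l" for x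
  proof -
    have "coprime (u * v) l" using v by (metis coprime_1_left cong_imp_coprime cong_sym)
    then have vx: "coprime (v * x) l" using x by simp
    have uv: "u * (v * n mod l) mod l = n mod l" "v * (u * n mod l) mod l = n mod l" for n
    proof -
      have "[u * v * n = 1 * n] (mod l)" using v by (rule cong_scalar_right)
      then have "u * v * n mod l = n mod l" by (simp add: Cong.cong_def)
      then show "u * (v * n mod l) mod l = n mod l" "v * (u * n mod l) mod l = n mod l"
        by (simp_all add: mod_mult_right_eq mult.assoc mult.left_commute)
    qed
    have "(\<Sum>e<l. f (u * e) * of_real (cot (pi * real (e * x) / l))) =
        (\<Sum>e<l. f e * of_real (cot (pi * real (e * (v * x)) / l)))"
    proof (rule sum.reindex_bij_witness[of _ "\<lambda>e. v * e mod l" "\<lambda>e. u * e mod l"])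
      fix a assume a: "a \<in> {..<l}"
      show "v * (u * a mod l) mod l = a" using uv a by simp
      show "u * a mod l \<in> {..<l}" using l by simp
      have "(u * a mod l) * (v * x) mod l = (v * (u * a mod l) mod l) * x mod l"
        by (metis mod_mult_left_eq mult.assoc mult.commute)
      also have "\<dots> = a * x mod l" using uv a by simp
      finally have "cot (pi * real ((u * a mod l) * (v * x)) / l) = cot (pi * real (a * x) / l)"
        using cot_mod[OF l] by metis
      then show "f (u * a mod l) * of_real (cot (pi * real ((u * a mod l) * (v * x)) / l)) =
          f (u * a) * of_real (cot (pi * real (a * x) / l))" by (simp only: per)
    next
      fix b assume b: "b \<in> {..<l}"
      show "u * (v * b mod l) mod l = b" using uv b by simp
      show "v * b mod l \<in> {..<l}" using l by simp
    qed
    also have "\<dots> = 0" by (rule cot_kernelD(4)[OF f vx])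
    finally show ?thesis .
  qed
  moreover have "f (u * (n mod l)) = f (u * n)" for n by (metis per mod_mult_right_eq)
  moreover have "f (u * n) = 0" if "\<not> coprime n l" for n using that by (intro supp) simp
  moreover have "f (u * ((l - 1) * n)) = - f (u * n)" for n using odd[of "u * n"] by (simp add: mult.left_commute)
  ultimately show ?thesis unfolding cot_kernel_def by blast
qed

text \<open>Translations by units commute and have order dividing \<open>totient l\<close>.
  Averaging translates against the powers of a root of unity \<open>z\<close> projects to an
  eigenspace of \<open>u\<close>; over all \<open>z\<close> the projections add up to a nonzero
  multiple of \<open>g\<close>, so one of them survives, and eigenvalues found earlier
  persist.\<close>

lemma cot_kernel_eigenvector:
  assumes l: "l > 0" and f: "f \<in> cot_kernel l" "f m0 \<noteq> 0"
    and "finite S" "\<forall>u\<in>S. coprime u l"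
  shows "\<exists>g\<in>cot_kernel l. (\<exists>m. g m \<noteq> 0) \<and> (\<forall>u\<in>S. \<exists>c. \<forall>n. g (u * n) = c * g n)"
  using assms(4,5)
proof (induction S rule: finite_induct)
  case empty
  then show ?case using f by auto
next
  case (insert u S)
  then obtain g m where g: "g \<in> cot_kernel l" "g m \<noteq> 0" and eig: "\<forall>u\<in>S. \<exists>c. \<forall>n. g (u * n) = c * g n"
    by auto
  have u: "coprime u l" using insert.prems by simp
  define N where "N = totient l"
  have N: "N > 0" using l by (simp add: N_def)
  have per: "g (n mod l) = g n" for n by (rule cot_kernelD(1)[OF g(1)])
  have uN: "g (u ^ N * n) = g n" for n
  proof -
    have "[u ^ N * n = 1 * n] (mod l)" unfolding N_def by (intro cong_scalar_right euler_theorem u)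
    then show ?thesis by (metis Cong.cong_def mult_1 per)
  qed
  define h where "h z n = (\<Sum>j<N. z ^ j * g (u ^ j * n))" for z n
  have hk: "h z \<in> cot_kernel l" for z unfolding h_def
    by (intro cot_kernel_linear cot_kernel_translate[OF l g(1)]) (simp add: u)
  have hu: "h z (u * n) = inverse z * h z n" if z: "z ^ N = 1" for z n
  proof -
    have z0: "z \<noteq> 0" using z N by (auto simp: power_0_left)
    have "z * h z (u * n) = (\<Sum>j<N. z ^ Suc j * g (u ^ Suc j * n))"
      by (simp add: h_def sum_distrib_left mult_ac)
    also have "\<dots> + z ^ 0 * g (u ^ 0 * n) = (\<Sum>j<Suc N. z ^ j * g (u ^ j * n))"
      by (subst sum.lessThan_Suc_shift) simp
    also have "\<dots> = h z n + z ^ N * g (u ^ N * n)" by (simp add: h_def)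
    finally have "z * h z (u * n) = h z n" using z uN by simp
    then show ?thesis using z0 by (simp add: field_simps)
  qed
  have "(\<Sum>z | z ^ N = 1. h z m) = (\<Sum>j<N. (\<Sum>z | z ^ N = 1. z ^ j) * g (u ^ j * m))"
    unfolding h_def by (subst sum.swap) (simp add: sum_distrib_right)
  also have "\<dots> = (\<Sum>j<N. if j = 0 then of_nat N * g m else 0)"
    by (rule sum.cong) (auto simp: sum_powers_roots_unity[OF N] dest: dvd_imp_le)
  also have "\<dots> = of_nat N * g m" using N by simp
  also have "\<dots> \<noteq> 0" using N g(2) by simp
  finally obtain z where z: "z ^ N = 1" "h z m \<noteq> 0" by (metis (mono_tags, lifting) mem_Collect_eq sum.neutral)
  have "\<exists>c. \<forall>n. h z (v * n) = c * h z n" if v: "v \<in> S" for v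
  proof -
    obtain c where c: "\<And>n. g (v * n) = c * g n" using eig v by blast
    have "h z (v * n) = c * h z n" for n
      unfolding h_def sum_distrib_left using c by (simp add: mult.left_commute)
    then show ?thesis by blast
  qed
  then show ?case using hk z hu[OF z(1)] by (intro bexI[of _ "h z"]) auto
qed

text \<open>A common eigenvector of the translations, divided by its value at 1, is a Dirichlet
  character. It is odd by the third condition of the kernel, and the fourth one at
  \<open>x = 1\<close> makes its cotangent sum vanish.\<close>

theorem cot_kernel_trivial:
  assumes l: "l \<ge> 2" and f: "f \<in> cot_kernel l"
  shows "f n = 0"
proof (rule ccontr)
  assume n: "f n \<noteq> 0"
  have l0: "l > 0" using l by simp
  define U where "U = {u. u < l \<and> coprime u l}"
  have "finite U" "\<forall>u\<in>U. coprime u l" by (simp_all add: U_def)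
  then obtain g m where g: "g \<in> cot_kernel l" "g m \<noteq> 0" and eigU: "\<forall>u\<in>U. \<exists>c. \<forall>n. g (u * n) = c * g n"
    using cot_kernel_eigenvector[OF l0 f n, of U] by metis
  have per: "g (n mod l) = g n" and supp: "\<not> coprime n l \<Longrightarrow> g n = 0" and odd: "g ((l - 1) * n) = - g n" for n
    using cot_kernelD[OF g(1)] by blast+
  have eig: "g (u * n) * g 1 = g u * g n" for u n
  proof (cases "coprime u l")
    case True
    then have "u mod l \<in> U" using l0 by (simp add: U_def)
    then obtain c where c: "\<And>n. g (u mod l * n) = c * g n" using eigU by blast
    have "g (u * n) = c * g n" for n using c by (metis per mod_mult_left_eq)
    from this[of n] this[of 1] show ?thesis by simp
  qed (simp add: supp)
  have g1: "g 1 \<noteq> 0"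
  proof
    assume "g 1 = 0"
    moreover have "coprime m l" using g(2) supp by blast
    then have "m mod l \<in> U" using l0 by (simp add: U_def)
    then obtain c where "\<And>n. g (m mod l * n) = c * g n" using eigU by blast
    from this[of 1] have "g m = c * g 1" using per by simp
    ultimately show False using g(2) by simp
  qed
  define \<psi> where "\<psi> n = g n / g 1" for n
  interpret dirichlet_character l \<psi>
  proof
    show "l > 0" by (rule l0)
    show "\<psi> (m * n) = \<psi> m * \<psi> n" for m n using eig[of m n] g1 by (simp add: \<psi>_def field_simps)
    show "\<psi> (n + l) = \<psi> n" for n unfolding \<psi>_def by (metis per mod_add_self2)
    show "\<psi> n \<noteq> 0 \<longleftrightarrow> coprime n l" for n
    proof
      assume "coprime n l"
      then obtain v where "[n * v = 1] (mod l)" using cong_solve_coprime_nat by auto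
      then have "g (n * v) = g 1" by (metis per Cong.cong_def)
      then have "g n * g v = g 1 * g 1" using eig[of n v] by simp
      then show "\<psi> n \<noteq> 0" using g1 by (auto simp: \<psi>_def)
    qed (use supp in \<open>auto simp: \<psi>_def\<close>)
  qed
  have "\<psi> (l - 1) = - 1" using odd[of 1] g1 by (simp add: \<psi>_def)
  then have "(\<Sum>e<l. \<psi> e * of_real (cot (pi * e / l))) \<noteq> 0" by (rule odd_character_cot_nonzero[OF l])
  moreover have "(\<Sum>e<l. \<psi> e * of_real (cot (pi * e / l))) = (\<Sum>e<l. g e * of_real (cot (pi * real (e * 1) / l))) / g 1"
    by (simp add: \<psi>_def sum_divide_distrib)
  moreover have "(\<Sum>e<l. g e * of_real (cot (pi * real (e * 1) / l))) = 0"
    by (rule cot_kernelD(4)[OF g(1)]) simp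
  ultimately show False by simp
qed

section \<open>Sums of sawtooth functions\<close>

text \<open>The function \<open>((n / l))\<close> of the classical Dedekind sums. The value 0 at
  multiples of \<open>l\<close>, in place of \<open>- 1 / 2\<close>, makes it odd.\<close>

definition sawtooth :: "nat \<Rightarrow> nat \<Rightarrow> real" where
  "sawtooth l n = real (n mod l) / real l - (if l dvd n then 0 else 1 / 2)"

lemma sawtooth_mod: "sawtooth l (n mod l) = sawtooth l n"
  by (simp add: sawtooth_def dvd_mod_iff)

lemma sawtooth_cong: "[m = n] (mod l) \<Longrightarrow> sawtooth l m = sawtooth l n"
  unfolding Cong.cong_def by (metis sawtooth_mod)

lemma sawtooth_neg:
  assumes "l > 0" "[m + n = 0] (mod l)"
  shows "sawtooth l m = - sawtooth l n"
proof -
  have d: "l dvd m + n" using assms(2) by (simp add: cong_0_iff)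
  show ?thesis
  proof (cases "l dvd n")
    case True
    then have "l dvd m" using d by (simp add: dvd_add_left_iff)
    then show ?thesis using True by (simp add: sawtooth_def)
  next
    case False
    then have m: "\<not> l dvd m" using d by (metis dvd_add_right_iff)
    have "l dvd m mod l + n mod l" using d by (metis dvd_eq_mod_eq_0 mod_add_eq)
    moreover have "m mod l + n mod l < 2 * l" using assms(1) by (metis add_less_mono mod_less_divisor mult_2)
    moreover have "m mod l + n mod l > 0" using False by (simp add: dvd_eq_mod_eq_0)
    ultimately have "m mod l + n mod l = l" by (auto elim!: dvdE simp: less_2_cases_iff)
    then have "real (m mod l) = real l - real (n mod l)" by linarith
    then show ?thesis using m False assms(1) by (simp add: sawtooth_def diff_divide_distrib)
  qed
qed

lemma cot_plus_int_pi: "cot (t + of_int n * pi) = cot t"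
proof -
  have "sin (of_int n * pi) = 0" by (auto simp: sin_zero_iff_int2)
  moreover from this have "cos (of_int n * pi) \<noteq> 0" using sin_cos_squared_add[of "of_int n * pi"] by auto
  ultimately show ?thesis by (simp add: cot_def sin_add cos_add)
qed

text \<open>Residues are natural numbers here, so multiplication by \<open>l - 1\<close> stands for
  negation; oddness in \<open>cot_kernel\<close> is expressed in the same way.\<close>

lemma neg_cong: "l > 0 \<Longrightarrow> [(l - 1) * n + n = (0::nat)] (mod l)"
proof -
  assume "l > 0"
  then have "(l - 1) * n + n = l * n" by (cases l) auto
  then show ?thesis by (simp add: cong_0_iff)
qed

lemma sawtooth_mult: "k > 0 \<Longrightarrow> sawtooth (k * l) (k * n) = sawtooth l n"
  by (simp add: sawtooth_def)

text \<open>The finite Fourier transform of the sawtooth. The summand \<open>1 / 2\<close> corrects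
  the term \<open>j = 0\<close>, where the sawtooth departs from
  \<open>j / l - 1 / 2\<close>.\<close>

lemma sum_sawtooth_power:
  fixes z :: complex
  assumes "l > 0" "z ^ l = 1" "z \<noteq> 1"
  shows "(\<Sum>j<l. of_real (sawtooth l j) * z ^ j) = 1 / (z - 1) + 1 / 2"
proof -
  have g: "(\<Sum>j<l. z ^ j) = 0" using geometric_sum[OF assms(3), of l] assms(2) by simp
  have "(z - 1) * (\<Sum>j<n. of_nat j * z ^ j) = of_nat n * z ^ n - (\<Sum>j<n. z ^ j) * z" for n
    by (induction n) (simp_all add: algebra_simps)
  from this[of l] have a: "(z - 1) * (\<Sum>j<l. of_nat j * z ^ j) = of_nat l" using g assms(2) by simp
  have "(\<Sum>j<l. of_real (sawtooth l j) * z ^ j) = (\<Sum>j<l. of_nat j * z ^ j / of_nat l - (1 / 2) * z ^ j + (if j = 0 then 1 / 2 else 0))"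
    by (rule sum.cong) (auto simp: sawtooth_def left_diff_distrib dest: dvd_imp_le)
  also have "\<dots> = (\<Sum>j<l. of_nat j * z ^ j) / of_nat l - (1 / 2) * (\<Sum>j<l. z ^ j) + 1 / 2"
    using assms(1) by (simp add: sum.distrib sum_subtractf sum_divide_distrib sum_distrib_left)
  also have "(\<Sum>j<l. of_nat j * z ^ j) = of_nat l / (z - 1)" using a assms(3) by (simp add: field_simps)
  also have "of_nat l / (z - 1) / of_nat l - (1 / 2) * (\<Sum>j<l. z ^ j) + 1 / 2 = 1 / (z - 1) + 1 / 2"
    using g assms(1) by simp
  finally show ?thesis .
qed

lemma inverse_cis_minus_1:
  assumes "sin t \<noteq> 0"
  shows "1 / (cis (2 * t) - 1) + 1 / 2 = - (\<i> / 2) * of_real (cot t)"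
proof -
  have "cis (2 * t) - 1 = 2 * \<i> * of_real (sin t) * cis t"
    by (rule complex_eqI) (simp_all add: cos_double_sin sin_double power2_eq_square)
  moreover have "cis t \<noteq> 0" by simp
  ultimately have "1 / (cis (2 * t) - 1) + 1 / 2 = (1 + \<i> * of_real (sin t) * cis t) / (2 * \<i> * of_real (sin t) * cis t)"
    using assms by (simp add: field_simps)
  also have "1 + \<i> * of_real (sin t) * cis t = of_real (cos t) * cis t"
    using sin_cos_squared_add[of t] by (intro complex_eqI) (simp_all add: power2_eq_square algebra_simps)
  also have "of_real (cos t) * cis t / (2 * \<i> * of_real (sin t) * cis t) = of_real (cos t) / (2 * \<i> * of_real (sin t))"
    using \<open>cis t \<noteq> 0\<close> by simp
  also have "\<dots> = - (\<i> / 2) * of_real (cot t)" using assms by (simp add: cot_def field_simps)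
  finally show ?thesis .
qed

lemma primitive_root_power_eq_1:
  assumes "l > 0" "coprime x l"
  shows "cis (2 * pi * real x / real l) ^ j = 1 \<longleftrightarrow> l dvd j"
proof -
  have "cis (2 * pi * real x / real l) ^ j = cis (real j * (2 * pi * real x / real l))"
    by (rule Complex.DeMoivre)
  also have "\<dots> = exp (2 * of_real pi * \<i> * of_nat (x * j) / of_nat l)"
    by (simp add: cis_conv_exp mult_ac)
  finally have "cis (2 * pi * real x / real l) ^ j = exp (2 * of_real pi * \<i> * of_nat (x * j) / of_nat l)" .
  then have "cis (2 * pi * real x / real l) ^ j = 1 \<longleftrightarrow> l dvd x * j"
    using complex_root_unity_eq_1[of l "x * j"] assms(1) by simp
  also have "\<dots> \<longleftrightarrow> l dvd j" using assms(2) by (metis coprime_commute coprime_dvd_mult_right_iff)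
  finally show ?thesis .
qed

text \<open>Substituting \<open>c' * j\<close> for \<open>i\<close> moves the multiplier from the
  sawtooth to the root of unity; its power \<open>c'\<close> enters the Fourier transform, which
  half angles turn into a cotangent.\<close>

lemma sum_sawtooth_root:
  assumes l: "l \<ge> 2" and x: "coprime x l" and c: "[c * c' = 1] (mod l)"
  shows "(\<Sum>i<l. of_real (sawtooth l (i * c)) * cis (2 * pi * real x / real l) ^ i) =
    - (\<i> / 2) * of_real (cot (pi * real (c' * x) / l))"
proof -
  define w where "w = cis (2 * pi * real x / real l)"
  have l0: "l > 0" using l by simp
  have wl: "w ^ l = 1" unfolding w_def using primitive_root_power_eq_1[OF l0 x] by simp
  have wm: "w ^ (n mod l) = w ^ n" for n
  proof -
    have "w ^ n = w ^ (l * (n div l) + n mod l)" by simp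
    also have "\<dots> = w ^ (n mod l)" unfolding power_add power_mult wl by simp
    finally show ?thesis by simp
  qed
  have "[c' * c = 1] (mod l)" using c by (simp add: mult.commute)
  have inv: "c' * (i * c mod l) mod l = i mod l" "(c' * i mod l) * c mod l = i mod l" for i
  proof -
    have "[c * c' * i = 1 * i] (mod l)" using c by (rule cong_scalar_right)
    then have "c * c' * i mod l = i mod l" by (simp add: Cong.cong_def)
    then show "c' * (i * c mod l) mod l = i mod l" "(c' * i mod l) * c mod l = i mod l"
      by (simp_all add: mod_mult_right_eq mod_mult_left_eq mult_ac)
  qed
  have "(\<Sum>i<l. of_real (sawtooth l (i * c)) * w ^ i) = (\<Sum>j<l. of_real (sawtooth l j) * (w ^ c') ^ j)"
  proof (rule sum.reindex_bij_witness[of _ "\<lambda>j. c' * j mod l" "\<lambda>i. i * c mod l"])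
    fix a assume a: "a \<in> {..<l}"
    show "c' * (a * c mod l) mod l = a" "a * c mod l \<in> {..<l}" using inv a l0 by auto
    have "w ^ (c' * (a * c mod l)) = w ^ a" by (metis inv(1) wm)
    then show "of_real (sawtooth l (a * c mod l)) * (w ^ c') ^ (a * c mod l) = of_real (sawtooth l (a * c)) * w ^ a"
      by (simp add: sawtooth_mod power_mult)
  next
    fix b assume b: "b \<in> {..<l}"
    show "(c' * b mod l) * c mod l = b" "c' * b mod l \<in> {..<l}" using inv b l0 by auto
  qed
  also have "\<dots> = 1 / (w ^ c' - 1) + 1 / 2"
  proof (rule sum_sawtooth_power[OF l0])
    show "(w ^ c') ^ l = 1" using wl by (metis mult.commute power_mult power_one)
    show "w ^ c' \<noteq> 1"
    proof
      assume "w ^ c' = 1"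
      then have "l dvd c * c'" unfolding w_def using primitive_root_power_eq_1[OF l0 x] by simp
      then have "[0 = 1] (mod l)" using c by (meson cong_0_iff cong_sym cong_trans)
      then show False using l by (auto simp: Cong.cong_def)
    qed
  qed
  also have "w ^ c' = cis (2 * (pi * real (c' * x) / l))"
    by (simp add: w_def Complex.DeMoivre mult_ac)
  also have "1 / (cis (2 * (pi * real (c' * x) / l)) - 1) + 1 / 2 = - (\<i> / 2) * of_real (cot (pi * real (c' * x) / l))"
  proof (rule inverse_cis_minus_1)
    show "sin (pi * real (c' * x) / l) \<noteq> 0"
    proof
      assume "sin (pi * real (c' * x) / l) = 0"
      then obtain n :: int where "pi * real (c' * x) / l = of_int n * pi" by (auto simp: sin_zero_iff_int2)
      then have "real (c' * x) = of_int n * real l" using l0 by (simp add: field_simps)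
      then have "int (c' * x) = n * int l" by (metis of_int_eq_iff of_int_mult of_int_of_nat_eq)
      then have "int l dvd int (c' * x)" by simp
      then have "l dvd c' * x" by (simp only: int_dvd_int_iff)
      then have "l dvd c'" using x by (metis coprime_commute coprime_dvd_mult_left_iff)
      then have "[0 = 1] (mod l)" using c by (meson cong_0_iff cong_sym cong_trans dvd_mult)
      then show False using l by (auto simp: Cong.cong_def)
    qed
  qed
  finally show ?thesis unfolding w_def .
qed

text \<open>Marks the inverse of \<open>c\<close> with 1 and its negative with -1. The second mark
  makes the function odd, as membership in \<open>cot_kernel\<close> demands.\<close>

definition inverse_indicator :: "nat \<Rightarrow> nat \<Rightarrow> nat \<Rightarrow> real" where
  "inverse_indicator l c e = of_bool [c * e = 1] (mod l) - of_bool [c * e + 1 = 0] (mod l)"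

lemma sum_inverse_indicator:
  fixes g :: "nat \<Rightarrow> real"
  assumes l: "l > 0" and c: "[c * c' = 1] (mod l)"
    and per: "\<And>n. g (n mod l) = g n" and odd: "\<And>n. g ((l - 1) * n) = - g n"
  shows "(\<Sum>e<l. inverse_indicator l c e * g e) = 2 * g c'"
proof -
  have u: "coprime c l" using c by (metis coprime_1_left coprime_mult_left_iff cong_imp_coprime cong_sym)
  have A: "[c * e = 1] (mod l) \<longleftrightarrow> e = c' mod l" if "e < l" for e
  proof -
    have "[c * e = 1] (mod l) \<longleftrightarrow> [c * e = c * c'] (mod l)" using c by (meson cong_sym cong_trans)
    also have "\<dots> \<longleftrightarrow> [e = c'] (mod l)" using u by (rule cong_mult_lcancel_nat)
    finally show ?thesis using that by (simp add: Cong.cong_def)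
  qed
  have m: "[c * ((l - 1) * c') + 1 = 0] (mod l)"
  proof -
    have "[(l - 1) * (c * c') + 1 = (l - 1) * 1 + 1] (mod l)" using c by (intro cong_add cong_mult) auto
    also have "(l - 1) * 1 + 1 = l" using l by simp
    also have "[l = 0] (mod l)" by (simp add: cong_0_iff)
    finally show ?thesis by (simp only: mult.left_commute)
  qed
  have B: "[c * e + 1 = 0] (mod l) \<longleftrightarrow> e = (l - 1) * c' mod l" if "e < l" for e
  proof -
    have "[c * e + 1 = 0] (mod l) \<longleftrightarrow> [c * e + 1 = c * ((l - 1) * c') + 1] (mod l)" using m by (meson cong_sym cong_trans)
    also have "\<dots> \<longleftrightarrow> [c * e = c * ((l - 1) * c')] (mod l)" by (rule cong_add_rcancel_nat)
    also have "\<dots> \<longleftrightarrow> [e = (l - 1) * c'] (mod l)" using u by (rule cong_mult_lcancel_nat)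
    finally show ?thesis using that by (simp add: Cong.cong_def)
  qed
  have "(\<Sum>e<l. inverse_indicator l c e * g e) =
      (\<Sum>e<l. (if e = c' mod l then g e else 0) - (if e = (l - 1) * c' mod l then g e else 0))"
  proof (rule sum.cong[OF refl])
    fix e assume "e \<in> {..<l}"
    then have e: "e < l" by simp
    show "inverse_indicator l c e * g e = (if e = c' mod l then g e else 0) - (if e = (l - 1) * c' mod l then g e else 0)"
      unfolding inverse_indicator_def A[OF e] B[OF e] by simp
  qed
  also have "\<dots> = g (c' mod l) - g ((l - 1) * c' mod l)"
    using l by (simp add: sum_subtractf)
  also have "\<dots> = 2 * g c'" using per odd by simp
  finally show ?thesis .
qed

section \<open>Periodic sequences and their Fourier coefficients\<close>

lemma sum_shift_period:
  fixes h :: "nat \<Rightarrow> 'a::ab_group_add"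
  assumes "\<And>i. h (i + N) = h i"
  shows "(\<Sum>i<N. h (i + p)) = (\<Sum>i<N. h i)"
proof (induction p)
  case (Suc p)
  have "(\<Sum>i<N. h (i + Suc p)) + h p = (\<Sum>i<Suc N. h (i + p))"
    by (subst sum.lessThan_Suc_shift) (simp add: add.commute)
  also have "\<dots> = (\<Sum>i<N. h (i + p)) + h p" using assms[of p] by (simp add: add.commute)
  finally show ?case using Suc by simp
qed simp

lemma periodic_add_mult:
  fixes h :: "nat \<Rightarrow> 'a"
  assumes "\<And>i. h (i + l) = h i"
  shows "h (i + l * q) = h i"
proof (induction q)
  case (Suc q)
  then show ?case using assms[of "i + l * q"] by (simp add: algebra_simps)
qed simp

text \<open>Shifting a sum over whole periods by \<open>p\<close> leaves it unchanged, while the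
  period \<open>p\<close> of \<open>w\<close> makes the shift a multiplication by
  \<open>z ^ p\<close>.\<close>

lemma fourier_coefficient_zero:
  fixes w :: "nat \<Rightarrow> complex" and z :: complex
  assumes "\<And>i. w (i + p) = w i" "p dvd N" "z ^ N = 1" "z ^ p \<noteq> 1"
  shows "(\<Sum>i<N. w i * z ^ i) = 0"
proof -
  obtain q where q: "N = p * q" using assms(2) by blast
  have w: "w (i + p * q) = w i" for i q by (rule periodic_add_mult[where h = w]) (rule assms(1))
  have "(\<Sum>i<N. w (i + p) * z ^ (i + p)) = (\<Sum>i<N. w i * z ^ i)"
    by (rule sum_shift_period[of "\<lambda>i. w i * z ^ i"]) (simp add: power_add assms(3)[unfolded q] w q)
  then have "(\<Sum>i<N. w i * z ^ i) * z ^ p = (\<Sum>i<N. w i * z ^ i)"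
    by (simp add: assms(1) power_add sum_distrib_right mult.assoc)
  then show ?thesis using assms(4) by (metis mult_cancel_left2)
qed

lemma sum_multiple_period:
  fixes h :: "nat \<Rightarrow> 'a::comm_ring_1"
  assumes "\<And>i. h (i + l) = h i"
  shows "(\<Sum>i<l * q. h i) = of_nat q * (\<Sum>i<l. h i)"
proof (induction q)
  case (Suc q)
  have h: "h (i + l * q) = h i" for i q by (rule periodic_add_mult[where h = h]) (rule assms)
  have "(\<Sum>i<l * Suc q. h i) = (\<Sum>i<l * q. h i) + (\<Sum>i\<in>{l * q..<l * q + l}. h i)"
    by (subst sum.union_disjoint[symmetric]) (auto intro!: sum.cong)
  also have "(\<Sum>i\<in>{l * q..<l * q + l}. h i) = (\<Sum>i<l. h (i + l * q))"
    using sum.shift_bounds_nat_ivl[of h 0 "l * q" l] by (simp add: lessThan_atLeast0 add.commute)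
  finally show ?case using Suc h by (simp add: algebra_simps)
qed simp

text \<open>
  The Fourier coefficients at primitive \<open>l\<close>-th roots of unity see only the terms of period
  exactly \<open>l\<close>, and by the linear independence of cotangents they determine those terms.
\<close>

theorem sawtooth_sum_period:
  fixes m :: "'i \<Rightarrow> real" and l :: "'i \<Rightarrow> nat" and c d :: "'i \<Rightarrow> nat"
  assumes fin: "finite I" and lpos: "\<And>s. s \<in> I \<Longrightarrow> l s > 0"
    and cop: "\<And>s. s \<in> I \<Longrightarrow> coprime (c s) (l s)" "\<And>s. s \<in> I \<Longrightarrow> coprime (d s) (l s)"
    and per: "\<And>i. (\<Sum>s\<in>I. m s * (sawtooth (l s) ((i + p) * c s) + sawtooth (l s) ((i + p) * d s))) =
      (\<Sum>s\<in>I. m s * (sawtooth (l s) (i * c s) + sawtooth (l s) (i * d s)))"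
    and p: "p > 0" and k: "k > 0" "\<not> k dvd p" and max: "\<And>s. s \<in> I \<Longrightarrow> k dvd l s \<Longrightarrow> l s = k"
  shows "(\<Sum>s\<in>{s\<in>I. l s = k}. m s * (sawtooth k (i * c s) + sawtooth k (i * d s))) = 0"
proof -
  define J where "J = {s\<in>I. l s = k}"
  have J: "finite J" "J \<subseteq> I" "\<And>s. s \<in> J \<Longrightarrow> l s = k" using fin by (auto simp: J_def)
  have k2: "k \<ge> 2" using k by (cases k; cases "k - 1") auto
  define c' where "c' s = (SOME c'. [c s * c' = 1] (mod k))" for s
  define d' where "d' s = (SOME d'. [d s * d' = 1] (mod k))" for s
  have ex: "\<exists>y. [a * y = 1] (mod k)" if "coprime a k" for a
    using cong_solve_coprime_nat[OF that] by simp
  have c': "[c s * c' s = 1] (mod k)" and d': "[d s * d' s = 1] (mod k)" if "s \<in> J" for s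
  proof -
    have cd: "coprime (c s) k" "coprime (d s) k" using that cop[of s] J by auto
    show "[c s * c' s = 1] (mod k)" unfolding c'_def by (rule someI_ex[OF ex[OF cd(1)]])
    show "[d s * d' s = 1] (mod k)" unfolding d'_def by (rule someI_ex[OF ex[OF cd(2)]])
  qed
  define W where "W s i = sawtooth (l s) (i * c s) + sawtooth (l s) (i * d s)" for s i
  have W_period: "W s (i + l s) = W s i" for s i
    unfolding W_def by (intro arg_cong2[where f = "(+)"] sawtooth_cong) (auto simp: Cong.cong_def algebra_simps)
  \<comment> \<open>A common multiple of all periods in play, so that the total and each single term
    have their Fourier coefficients over the same range.\<close>
  define N where "N = p * (k * (\<Prod>s\<in>I. l s))"
  have Npos: "N > 0" using p k lpos fin by (auto simp: N_def prod_pos)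
  have Nl: "l s dvd N" if "s \<in> I" for s unfolding N_def using that fin by (auto intro!: dvd_mult dvd_prodI)
  have Nk: "k dvd N" by (simp add: N_def)
  have cot_sum: "(\<Sum>s\<in>J. m s * (cot (pi * real (c' s * x) / k) + cot (pi * real (d' s * x) / k))) = 0" if x: "coprime x k" for x
  proof -
    define z where "z = cis (2 * pi * real x / real k)"
    have zj: "z ^ j = 1 \<longleftrightarrow> k dvd j" for j unfolding z_def by (rule primitive_root_power_eq_1[OF k(1) x])
    have "0 = (\<Sum>i<N. of_real (\<Sum>s\<in>I. m s * W s i) * z ^ i)"
    proof (rule fourier_coefficient_zero[symmetric, of _ p])
      show "complex_of_real (\<Sum>s\<in>I. m s * W s (i + p)) = of_real (\<Sum>s\<in>I. m s * W s i)" for i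
        using per[of i] unfolding W_def by simp
    qed (use zj k Nk in \<open>auto simp: N_def\<close>)
    also have "\<dots> = (\<Sum>s\<in>I. of_real (m s) * (\<Sum>i<N. of_real (W s i) * z ^ i))"
      unfolding of_real_sum sum_distrib_left sum_distrib_right by (subst sum.swap) (simp add: mult_ac)
    also have "\<dots> = (\<Sum>s\<in>J. of_real (m s) * (\<Sum>i<N. of_real (W s i) * z ^ i))"
    proof (rule sum.mono_neutral_right[OF fin J(2)], intro ballI)
      fix s assume s: "s \<in> I - J"
      \<comment> \<open>The only place for \<open>max\<close>: a term whose period is a proper
        multiple of \<open>k\<close> could have a nonzero coefficient at \<open>z\<close>.\<close>
      then have "\<not> k dvd l s" using max by (auto simp: J_def)
      then have "(\<Sum>i<N. complex_of_real (W s i) * z ^ i) = 0"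
        using s zj Nk Nl W_period by (intro fourier_coefficient_zero[of _ "l s"]) auto
      then show "of_real (m s) * (\<Sum>i<N. complex_of_real (W s i) * z ^ i) = 0" by simp
    qed
    also have "\<dots> = (\<Sum>s\<in>J. of_real (m s) * (of_nat (N div k) * (- (\<i> / 2) * of_real (cot (pi * real (c' s * x) / k) + cot (pi * real (d' s * x) / k)))))"
    proof (rule sum.cong[OF refl])
      fix s assume s: "s \<in> J"
      have "(\<Sum>i<k * (N div k). of_real (W s i) * z ^ i) = of_nat (N div k) * (\<Sum>i<k. of_real (W s i) * z ^ i)"
      proof (rule sum_multiple_period)
        show "of_real (W s (i + k)) * z ^ (i + k) = of_real (W s i) * z ^ i" for i
          using W_period[of s i] J(3)[OF s] zj[of k] by (simp add: power_add)
      qed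
      also have "(\<Sum>i<k. of_real (W s i) * z ^ i) =
          (\<Sum>i<k. of_real (sawtooth k (i * c s)) * z ^ i) + (\<Sum>i<k. of_real (sawtooth k (i * d s)) * z ^ i)"
        using J(3)[OF s] by (simp add: W_def sum.distrib distrib_right)
      also have "\<dots> = - (\<i> / 2) * of_real (cot (pi * real (c' s * x) / k) + cot (pi * real (d' s * x) / k))"
        unfolding z_def by (simp add: sum_sawtooth_root[OF k2 x c'[OF s]] sum_sawtooth_root[OF k2 x d'[OF s]] distrib_left)
      finally show "of_real (m s) * (\<Sum>i<N. of_real (W s i) * z ^ i) =
          of_real (m s) * (of_nat (N div k) * (- (\<i> / 2) * of_real (cot (pi * real (c' s * x) / k) + cot (pi * real (d' s * x) / k))))"
        using Nk by simp
    qed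
    also have "\<dots> = (of_nat (N div k) * (- (\<i> / 2))) * of_real (\<Sum>s\<in>J. m s * (cot (pi * real (c' s * x) / k) + cot (pi * real (d' s * x) / k)))"
      by (simp add: sum_distrib_left mult_ac)
    finally have "(of_nat (N div k) * (- (\<i> / 2))) * complex_of_real (\<Sum>s\<in>J. m s * (cot (pi * real (c' s * x) / k) + cot (pi * real (d' s * x) / k))) = 0" by simp
    moreover have "N div k \<noteq> 0" using Npos Nk k(1) by (simp add: dvd_div_eq_0_iff)
    ultimately show ?thesis by (simp del: of_real_sum)
  qed
  \<comment> \<open>The coefficients of \<open>cot_sum\<close>, antisymmetrised and indexed by
    residues; the relations for all units \<open>x\<close> put \<open>f\<close> into
    \<open>cot_kernel k\<close>.\<close>
  define f where "f e = (\<Sum>s\<in>J. m s * (inverse_indicator k (c s) e + inverse_indicator k (d s) e))" for e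
  have ii: "inverse_indicator k c (e mod k) = inverse_indicator k c e" for c e
  proof -
    have a: "[c * (e mod k) = c * e] (mod k)" by (simp add: Cong.cong_def mod_mult_right_eq)
    then have b: "[c * (e mod k) + 1 = c * e + 1] (mod k)" by (rule cong_add) simp
    show ?thesis unfolding inverse_indicator_def using a b
      by (intro arg_cong2[where f = "(-)"] arg_cong[where f = of_bool]) (meson cong_sym cong_trans)+
  qed
  have iz: "inverse_indicator k c e = 0" if "\<not> coprime e k" for c e
  proof -
    have "\<not> [c * e = 1] (mod k)"
      using that by (metis coprime_1_left coprime_mult_left_iff cong_imp_coprime cong_sym)
    moreover have "\<not> [c * e + 1 = 0] (mod k)"
    proof
      assume "[c * e + 1 = 0] (mod k)"
      then have "k dvd c * e + 1" by (simp add: cong_0_iff)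
      then have "gcd e k dvd c * e + 1" by (meson dvd_trans gcd_dvd2)
      then have "gcd e k dvd 1" by (metis dvd_add_right_iff dvd_mult gcd_dvd1)
      then show False using that by (metis coprime_iff_gcd_eq_1 nat_dvd_1_iff_1)
    qed
    ultimately show ?thesis by (simp add: inverse_indicator_def)
  qed
  have io: "inverse_indicator k c ((k - 1) * e) = - inverse_indicator k c e" for c e
  proof -
    have n: "[c * ((k - 1) * e) + c * e = 0] (mod k)"
      using neg_cong[OF k(1), of "c * e"] by (simp only: mult.left_commute)
    have "[c * ((k - 1) * e) = 1] (mod k) \<longleftrightarrow> [c * ((k - 1) * e) + c * e = 1 + c * e] (mod k)"
      by (rule cong_add_rcancel_nat[symmetric])
    also have "\<dots> \<longleftrightarrow> [c * e + 1 = 0] (mod k)" using n by (metis add.commute cong_sym cong_trans)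
    finally have A: "[c * ((k - 1) * e) = 1] (mod k) \<longleftrightarrow> [c * e + 1 = 0] (mod k)" .
    have "[c * ((k - 1) * e) + 1 = 0] (mod k) \<longleftrightarrow> [c * ((k - 1) * e) + 1 = c * ((k - 1) * e) + c * e] (mod k)"
      using n by (metis cong_sym cong_trans)
    also have "\<dots> \<longleftrightarrow> [c * e = 1] (mod k)" by (metis cong_add_lcancel_nat cong_sym)
    finally show ?thesis unfolding inverse_indicator_def A by simp
  qed
  have "(\<lambda>n. complex_of_real (f n)) \<in> cot_kernel k"
    unfolding cot_kernel_def
  proof (intro CollectI conjI allI impI)
    show "complex_of_real (f (n mod k)) = f n" for n by (simp add: f_def ii)
    show "complex_of_real (f n) = 0" if "\<not> coprime n k" for n using iz[OF that] by (simp add: f_def)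
    show "complex_of_real (f ((k - 1) * n)) = - complex_of_real (f n)" for n
      unfolding of_real_minus[symmetric] of_real_eq_iff f_def io by (simp add: sum_negf[symmetric] algebra_simps)
    fix x assume x: "coprime x k"
    define g where "g e = cot (pi * real (e * x) / k)" for e
    have gper: "g (n mod k) = g n" for n unfolding g_def by (metis cot_mod[OF k(1)] mod_mult_left_eq)
    have godd: "g ((k - 1) * n) = - g n" for n
    proof -
      have "pi * real ((k - 1) * n * x) / k = - (pi * real (n * x) / k) + of_int (int (n * x)) * pi"
        using k(1) by (simp add: of_nat_diff field_simps)
      then have "g ((k - 1) * n) = cot (- (pi * real (n * x) / k))"
        unfolding g_def by (simp only: cot_plus_int_pi)
      then show ?thesis by (simp add: g_def cot_def)
    qed
    have "(\<Sum>e<k. f e * g e) = (\<Sum>s\<in>J. m s * ((\<Sum>e<k. inverse_indicator k (c s) e * g e) + (\<Sum>e<k. inverse_indicator k (d s) e * g e)))"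
      unfolding f_def sum_distrib_right sum.distrib[symmetric] sum_distrib_left by (subst sum.swap) (simp add: algebra_simps)
    also have "\<dots> = (\<Sum>s\<in>J. m s * (2 * g (c' s) + 2 * g (d' s)))"
      using sum_inverse_indicator[OF k(1) c' gper godd] sum_inverse_indicator[OF k(1) d' gper godd] by simp
    also have "\<dots> = 2 * (\<Sum>s\<in>J. m s * (g (c' s) + g (d' s)))" by (simp add: sum_distrib_left algebra_simps)
    also have "\<dots> = 0" using cot_sum[OF x] by (simp add: g_def)
    finally show "(\<Sum>e<k. complex_of_real (f e) * of_real (cot (pi * real (e * x) / k))) = 0"
      unfolding g_def of_real_mult[symmetric] of_real_sum[symmetric] by simp
  qed
  \<comment> \<open>By Euler's theorem the exponent \<open>t\<close> defined next gives an explicit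
    inverse \<open>u ^ t\<close> of every unit \<open>u\<close>.\<close>
  then have f0: "f e = 0" for e using cot_kernel_trivial[OF k2] by fastforce
  define t where "t = totient k - 1"
  have t: "Suc t = totient k" using k(1) by (simp add: t_def)
  have inv_t: "[u * u ^ t = 1] (mod k)" if "coprime u k" for u
    using euler_theorem[OF that] unfolding t[symmetric] by simp
  \<comment> \<open>At an inverse of \<open>c s\<close> this is the sawtooth at
    \<open>i * c s\<close>, so pairing it with \<open>f = 0\<close> leads from the coefficients back
    to the sum of sawtooths.\<close>
  define g where "g e = sawtooth k (i * e ^ t)" for e
  have gper: "g (n mod k) = g n" for n unfolding g_def
    by (intro sawtooth_cong cong_scalar_left cong_pow) simp
  have km: "[(k - 1) ^ t = k - 1] (mod k)"
  proof -
    have "coprime (k - 1) k" using coprime_diff_one_left_nat[OF k(1)] by simp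
    then have "[(k - 1) * (k - 1) ^ t = 1] (mod k)" by (rule inv_t)
    then have "[(k - 1) * (k - 1) ^ t + (k - 1) ^ t = 1 + (k - 1) ^ t] (mod k)" by (rule cong_add) simp
    then have "[0 = 1 + (k - 1) ^ t] (mod k)" using neg_cong[OF k(1)] by (meson cong_sym cong_trans)
    then have "[1 + (k - 1) ^ t = k] (mod k)" by (simp add: Cong.cong_def)
    also have "k = 1 + (k - 1)" using k(1) by simp
    finally show ?thesis by (subst (asm) cong_add_lcancel_nat) (use k(1) in auto)
  qed
  have godd: "g ((k - 1) * n) = - g n" for n unfolding g_def
  proof (rule sawtooth_neg[OF k(1)])
    have "[i * ((k - 1) * n) ^ t + i * n ^ t = i * ((k - 1) * n ^ t) + i * n ^ t] (mod k)"
      unfolding power_mult_distrib by (intro cong_add cong_mult km) auto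
    also have "[i * ((k - 1) * n ^ t) + i * n ^ t = 0] (mod k)"
      using neg_cong[OF k(1), of "i * n ^ t"] by (simp only: mult.left_commute)
    finally show "[i * ((k - 1) * n) ^ t + i * n ^ t = 0] (mod k)" .
  qed
  have gc: "g e' = sawtooth k (i * e)" if "[e * e' = 1] (mod k)" for e e'
  proof -
    have u: "coprime e' k" using that by (metis coprime_1_left coprime_mult_left_iff cong_imp_coprime cong_sym)
    have "[e * e' * e' ^ t = 1 * e' ^ t] (mod k)" using that by (rule cong_scalar_right)
    moreover have "[e * (e' * e' ^ t) = e * 1] (mod k)" using inv_t[OF u] by (rule cong_scalar_left)
    ultimately have "[e' ^ t = e] (mod k)" by (metis cong_sym cong_trans mult.assoc mult.commute mult_1)
    then show ?thesis unfolding g_def by (intro sawtooth_cong cong_scalar_left)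
  qed
  have "0 = (\<Sum>e<k. f e * g e)" by (simp add: f0)
  also have "\<dots> = (\<Sum>s\<in>J. m s * ((\<Sum>e<k. inverse_indicator k (c s) e * g e) + (\<Sum>e<k. inverse_indicator k (d s) e * g e)))"
    unfolding f_def sum_distrib_right sum.distrib[symmetric] sum_distrib_left by (subst sum.swap) (simp add: algebra_simps)
  also have "\<dots> = (\<Sum>s\<in>J. m s * (2 * g (c' s) + 2 * g (d' s)))"
    using sum_inverse_indicator[OF k(1) c' gper godd] sum_inverse_indicator[OF k(1) d' gper godd] by simp
  also have "\<dots> = 2 * (\<Sum>s\<in>J. m s * (g (c' s) + g (d' s)))" by (simp add: sum_distrib_left algebra_simps)
  also have "\<dots> = 2 * (\<Sum>s\<in>J. m s * (sawtooth k (i * c s) + sawtooth k (i * d s)))"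
    using gc[OF c'] gc[OF d'] by simp
  finally show ?thesis unfolding J_def by simp
qed

section \<open>Dedekind sums\<close>

text \<open>What is left of a Dedekind sum when one of its two denominators has cancelled.\<close>

definition root_sum :: "nat \<Rightarrow> nat \<Rightarrow> complex" where
  "root_sum R j = (\<Sum>\<epsilon>\<in>{\<epsilon>. \<epsilon> ^ R = 1 \<and> \<epsilon> \<noteq> 1}. \<epsilon> ^ j / (1 - \<epsilon>)) / of_nat R"

lemma finite_nontrivial_roots: "R > 0 \<Longrightarrow> finite {\<epsilon>::complex. \<epsilon> ^ R = 1 \<and> \<epsilon> \<noteq> 1}"
  by (rule finite_subset[OF _ finite_roots_unity[of R]]) auto

lemma sum_nontrivial_roots_power:
  assumes "R > 0"
  shows "(\<Sum>\<epsilon>\<in>{\<epsilon>::complex. \<epsilon> ^ R = 1 \<and> \<epsilon> \<noteq> 1}. \<epsilon> ^ j) = (if R dvd j then of_nat R else 0) - 1"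
proof -
  have "{\<epsilon>::complex. \<epsilon> ^ R = 1} = insert 1 {\<epsilon>. \<epsilon> ^ R = 1 \<and> \<epsilon> \<noteq> 1}" by auto
  then have "1 + (\<Sum>\<epsilon>\<in>{\<epsilon>::complex. \<epsilon> ^ R = 1 \<and> \<epsilon> \<noteq> 1}. \<epsilon> ^ j) = (if R dvd j then of_nat R else 0)"
    using sum_powers_roots_unity[OF assms, of j] finite_nontrivial_roots[OF assms] by simp
  then show ?thesis by (simp add: eq_diff_eq add.commute)
qed

lemma root_sum_Suc:
  assumes "R > 0"
  shows "root_sum R (Suc j) = root_sum R j - (if R dvd j then 1 else 0) + 1 / of_nat R"
proof -
  have "root_sum R j - root_sum R (Suc j) = (\<Sum>\<epsilon>\<in>{\<epsilon>. \<epsilon> ^ R = 1 \<and> \<epsilon> \<noteq> 1}. \<epsilon> ^ j / (1 - \<epsilon>) - \<epsilon> ^ Suc j / (1 - \<epsilon>)) / of_nat R"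
    by (simp add: root_sum_def sum_subtractf diff_divide_distrib)
  also have "(\<Sum>\<epsilon>\<in>{\<epsilon>. \<epsilon> ^ R = 1 \<and> \<epsilon> \<noteq> 1}. \<epsilon> ^ j / (1 - \<epsilon>) - \<epsilon> ^ Suc j / (1 - \<epsilon>)) =
      (\<Sum>\<epsilon>\<in>{\<epsilon>::complex. \<epsilon> ^ R = 1 \<and> \<epsilon> \<noteq> 1}. \<epsilon> ^ j)"
  proof (rule sum.cong[OF refl])
    fix \<epsilon> :: complex assume "\<epsilon> \<in> {\<epsilon>. \<epsilon> ^ R = 1 \<and> \<epsilon> \<noteq> 1}"
    then have "\<epsilon> ^ j * (1 - \<epsilon>) / (1 - \<epsilon>) = \<epsilon> ^ j" by simp
    then show "\<epsilon> ^ j / (1 - \<epsilon>) - \<epsilon> ^ Suc j / (1 - \<epsilon>) = \<epsilon> ^ j"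
      by (simp only: diff_divide_distrib[symmetric] right_diff_distrib mult_1_right power_Suc2)
  qed
  finally show ?thesis unfolding sum_nontrivial_roots_power[OF assms] using assms by (simp add: field_simps split: if_splits)
qed

text \<open>Each root is paired with its inverse: the two fractions add up to 1.\<close>

lemma root_sum_0:
  assumes "R > 0"
  shows "root_sum R 0 = 1 / 2 - 1 / (2 * of_nat R)"
proof -
  define E where "E = {\<epsilon>::complex. \<epsilon> ^ R = 1 \<and> \<epsilon> \<noteq> 1}"
  have "(\<Sum>\<epsilon>\<in>E. 1 / (1 - \<epsilon>)) = (\<Sum>\<epsilon>\<in>E. 1 / (1 - inverse \<epsilon>))"
    by (rule sum.reindex_bij_witness[of _ inverse inverse]) (auto simp: E_def power_inverse)
  then have "2 * (\<Sum>\<epsilon>\<in>E. 1 / (1 - \<epsilon>)) = (\<Sum>\<epsilon>\<in>E. 1 / (1 - \<epsilon>) + 1 / (1 - inverse \<epsilon>))"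
    by (simp add: sum.distrib)
  also have "\<dots> = (\<Sum>\<epsilon>\<in>E. \<epsilon> ^ 0)"
  proof (rule sum.cong[OF refl])
    fix \<epsilon> assume "\<epsilon> \<in> E"
    then have "\<epsilon> \<noteq> 1" "\<epsilon> \<noteq> 0" using assms by (auto simp: E_def power_0_left)
    then have "1 / (1 - inverse \<epsilon>) = - \<epsilon> / (1 - \<epsilon>)" by (simp add: field_simps)
    then have "1 / (1 - \<epsilon>) + 1 / (1 - inverse \<epsilon>) = (1 - \<epsilon>) / (1 - \<epsilon>)"
      by (simp only: add_divide_distrib[symmetric] add_uminus_conv_diff)
    then show "1 / (1 - \<epsilon>) + 1 / (1 - inverse \<epsilon>) = \<epsilon> ^ 0" using \<open>\<epsilon> \<noteq> 1\<close> by simp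
  qed
  also have "\<dots> = of_nat R - 1" unfolding E_def by (subst sum_nontrivial_roots_power[OF assms]) simp
  finally have "(\<Sum>\<epsilon>\<in>E. 1 / (1 - \<epsilon>)) = (of_nat R - 1) / 2" by (simp add: field_simps)
  then show ?thesis unfolding root_sum_def E_def[symmetric] using assms by (simp add: field_simps)
qed

lemma sawtooth_Suc:
  assumes "R > 0"
  shows "sawtooth R (Suc j) = sawtooth R j + 1 / real R - (if R dvd j then 1 / 2 else 0) - (if R dvd Suc j then 1 / 2 else 0)"
proof (cases "R = 1")
  case True
  then show ?thesis by (simp add: sawtooth_def)
next
  case R1: False
  show ?thesis
  proof (cases "Suc (j mod R) = R")
    case True
    then have r: "real (j mod R) = real R - 1" by linarith
    have "Suc j mod R = 0" using True by (simp add: mod_Suc)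
    moreover have "j mod R \<noteq> 0" using True R1 by auto
    ultimately have "sawtooth R (Suc j) = 0" "sawtooth R j = (real R - 1) / real R - 1 / 2"
      "R dvd Suc j" "\<not> R dvd j"
      using r by (auto simp: sawtooth_def dvd_eq_mod_eq_0)
    then show ?thesis using assms by (simp add: diff_divide_distrib)
  next
    case False
    then have m: "Suc j mod R = Suc (j mod R)" by (simp add: mod_Suc)
    then have "\<not> R dvd Suc j" by (simp add: dvd_eq_mod_eq_0)
    moreover have "sawtooth R (Suc j) = real (j mod R) / real R + 1 / real R - 1 / 2"
      using m by (simp add: sawtooth_def dvd_eq_mod_eq_0 add_divide_distrib)
    ultimately show ?thesis by (simp add: sawtooth_def)
  qed
qed

text \<open>Both sides obey the same recursion in \<open>j\<close>, so it suffices to compare them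
  at 0.\<close>

lemma root_sum_eq:
  assumes "R > 0"
  shows "root_sum R j = of_real (sawtooth R j - 1 / (2 * real R) + (if R dvd j then 1 / 2 else 0))"
proof (induction j)
  case 0
  then show ?case using root_sum_0[OF assms] by (simp add: sawtooth_def)
next
  case (Suc j)
  have "root_sum R (Suc j) = of_real (sawtooth R j - 1 / (2 * real R) + (if R dvd j then 1 / 2 else 0) -
      (if R dvd j then 1 else 0) + 1 / real R)"
    by (simp add: root_sum_Suc[OF assms] Suc)
  also have "sawtooth R j - 1 / (2 * real R) + (if R dvd j then 1 / 2 else 0) - (if R dvd j then 1 else 0) + 1 / real R =
      sawtooth R (Suc j) - 1 / (2 * real R) + (if R dvd Suc j then 1 / 2 else 0)"
    by (simp add: sawtooth_Suc[OF assms])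
  finally show ?case .
qed

lemma root_sum_mod: "R > 0 \<Longrightarrow> [i = j] (mod R) \<Longrightarrow> root_sum R i = root_sum R j"
  by (simp add: root_sum_eq sawtooth_cong cong_dvd_iff)

lemma root_power_cong:
  fixes \<epsilon> :: complex
  assumes "\<epsilon> ^ R = 1" "[i = j] (mod R)"
  shows "\<epsilon> ^ i = \<epsilon> ^ j"
proof -
  have "\<epsilon> ^ n = \<epsilon> ^ (n mod R)" for n
  proof -
    have "\<epsilon> ^ n = \<epsilon> ^ (R * (n div R) + n mod R)" by simp
    also have "\<dots> = \<epsilon> ^ (n mod R)" unfolding power_add power_mult assms(1) by simp
    finally show ?thesis .
  qed
  then show ?thesis using assms(2) unfolding Cong.cong_def by metis
qed

lemma dedekind_sum_cong:
  "[i = j] (mod R) \<Longrightarrow> dedekind_sum R a i = dedekind_sum R a j"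
  unfolding dedekind_sum_def
proof (rule arg_cong[where f = "\<lambda>x. x / _"], rule sum.cong[OF refl])
  fix \<epsilon> :: complex assume ij: "[i = j] (mod R)" and "\<epsilon> \<in> {\<epsilon>. \<epsilon> ^ R = 1 \<and> \<epsilon> \<noteq> 1}"
  then have "\<epsilon> ^ i = \<epsilon> ^ j" using root_power_cong by blast
  then show "\<epsilon> ^ i / ((1 - \<epsilon>) * (1 - \<epsilon> ^ a)) = \<epsilon> ^ j / ((1 - \<epsilon>) * (1 - \<epsilon> ^ a))" by simp
qed

text \<open>The step from \<open>j\<close> to \<open>j + a\<close> cancels the factor
  \<open>1 - \<epsilon> ^ a\<close>, the further step by 1 cancels \<open>1 - \<epsilon>\<close>,
  and replacing \<open>\<epsilon>\<close> by \<open>\<epsilon> ^ b\<close> brings the second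
  remainder to the shape of \<open>root_sum\<close>. The corrections at multiples of
  \<open>R\<close> cancel because \<open>b\<close> is a unit, and the terms in \<open>1 / R\<close>
  cancel too.\<close>

lemma dedekind_sum_diff:
  assumes R: "R > 0" and ab: "[a * b = 1] (mod R)"
  shows "dedekind_sum R a j - dedekind_sum R a (j + (a + 1)) =
    of_real (sawtooth R j + sawtooth R (b * j))"
proof -
  define E where "E = {\<epsilon>::complex. \<epsilon> ^ R = 1 \<and> \<epsilon> \<noteq> 1}"
  have E: "\<epsilon> ^ R = 1" "\<epsilon> \<noteq> 1" "\<epsilon> ^ (a * b) = \<epsilon>" "(\<epsilon> ^ a) ^ b = \<epsilon>" "(\<epsilon> ^ b) ^ a = \<epsilon>" "\<epsilon> ^ a \<noteq> 1" "\<epsilon> ^ b \<noteq> 1" if "\<epsilon> \<in> E" for \<epsilon>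
  proof -
    show e: "\<epsilon> ^ R = 1" "\<epsilon> \<noteq> 1" using that by (auto simp: E_def)
    show p: "\<epsilon> ^ (a * b) = \<epsilon>" using root_power_cong[OF e(1) ab] by simp
    show q: "(\<epsilon> ^ a) ^ b = \<epsilon>" "(\<epsilon> ^ b) ^ a = \<epsilon>" using p by (simp_all add: power_mult[symmetric] mult.commute)
    show "\<epsilon> ^ a \<noteq> 1" "\<epsilon> ^ b \<noteq> 1" using q e by auto
  qed
  have "dedekind_sum R a j - dedekind_sum R a (j + a) = (\<Sum>\<epsilon>\<in>E. \<epsilon> ^ j / ((1 - \<epsilon>) * (1 - \<epsilon> ^ a)) - \<epsilon> ^ (j + a) / ((1 - \<epsilon>) * (1 - \<epsilon> ^ a))) / of_nat R"
    by (simp add: dedekind_sum_def E_def sum_subtractf diff_divide_distrib)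
  also have "(\<Sum>\<epsilon>\<in>E. \<epsilon> ^ j / ((1 - \<epsilon>) * (1 - \<epsilon> ^ a)) - \<epsilon> ^ (j + a) / ((1 - \<epsilon>) * (1 - \<epsilon> ^ a))) = (\<Sum>\<epsilon>\<in>E. \<epsilon> ^ j / (1 - \<epsilon>))"
  proof (rule sum.cong[OF refl])
    fix \<epsilon> assume e: "\<epsilon> \<in> E"
    have "\<epsilon> ^ j / ((1 - \<epsilon>) * (1 - \<epsilon> ^ a)) - \<epsilon> ^ (j + a) / ((1 - \<epsilon>) * (1 - \<epsilon> ^ a)) = (\<epsilon> ^ j * (1 - \<epsilon> ^ a)) / ((1 - \<epsilon>) * (1 - \<epsilon> ^ a))"
      by (simp add: diff_divide_distrib[symmetric] power_add algebra_simps)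
    also have "\<dots> = \<epsilon> ^ j / (1 - \<epsilon>)" using E(6)[OF e] by simp
    finally show "\<epsilon> ^ j / ((1 - \<epsilon>) * (1 - \<epsilon> ^ a)) - \<epsilon> ^ (j + a) / ((1 - \<epsilon>) * (1 - \<epsilon> ^ a)) = \<epsilon> ^ j / (1 - \<epsilon>)" .
  qed
  finally have A: "dedekind_sum R a j - dedekind_sum R a (j + a) = root_sum R j"
    by (simp add: root_sum_def E_def)
  have "dedekind_sum R a (j + a) - dedekind_sum R a (j + a + 1) = (\<Sum>\<epsilon>\<in>E. \<epsilon> ^ (j + a) / ((1 - \<epsilon>) * (1 - \<epsilon> ^ a)) - \<epsilon> ^ (j + a + 1) / ((1 - \<epsilon>) * (1 - \<epsilon> ^ a))) / of_nat R"
    by (simp add: dedekind_sum_def E_def sum_subtractf diff_divide_distrib)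
  also have "(\<Sum>\<epsilon>\<in>E. \<epsilon> ^ (j + a) / ((1 - \<epsilon>) * (1 - \<epsilon> ^ a)) - \<epsilon> ^ (j + a + 1) / ((1 - \<epsilon>) * (1 - \<epsilon> ^ a))) = (\<Sum>\<epsilon>\<in>E. \<epsilon> ^ (j + a) / (1 - \<epsilon> ^ a))"
  proof (rule sum.cong[OF refl])
    fix \<epsilon> assume e: "\<epsilon> \<in> E"
    have "\<epsilon> ^ (j + a) / ((1 - \<epsilon>) * (1 - \<epsilon> ^ a)) - \<epsilon> ^ (j + a + 1) / ((1 - \<epsilon>) * (1 - \<epsilon> ^ a)) = ((1 - \<epsilon>) * \<epsilon> ^ (j + a)) / ((1 - \<epsilon>) * (1 - \<epsilon> ^ a))"
      by (simp add: diff_divide_distrib[symmetric] algebra_simps)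
    also have "\<dots> = \<epsilon> ^ (j + a) / (1 - \<epsilon> ^ a)" using E(2)[OF e] by simp
    finally show "\<epsilon> ^ (j + a) / ((1 - \<epsilon>) * (1 - \<epsilon> ^ a)) - \<epsilon> ^ (j + a + 1) / ((1 - \<epsilon>) * (1 - \<epsilon> ^ a)) = \<epsilon> ^ (j + a) / (1 - \<epsilon> ^ a)" .
  qed
  also have "\<dots> = (\<Sum>\<epsilon>\<in>E. \<epsilon> ^ (b * (j + a)) / (1 - \<epsilon>))"
  proof (rule sum.reindex_bij_witness[of _ "\<lambda>\<epsilon>. \<epsilon> ^ b" "\<lambda>\<epsilon>. \<epsilon> ^ a"])
    fix \<epsilon> assume e: "\<epsilon> \<in> E"
    have "(\<epsilon> ^ a) ^ R = 1" "(\<epsilon> ^ b) ^ R = 1" by (metis E(1)[OF e] mult.commute power_mult power_one)+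
    then show "\<epsilon> ^ a \<in> E" "\<epsilon> ^ b \<in> E" using E(6,7)[OF e] by (simp_all add: E_def)
    show "(\<epsilon> ^ a) ^ b = \<epsilon>" "(\<epsilon> ^ b) ^ a = \<epsilon>" using E(4,5)[OF e] by auto
    show "(\<epsilon> ^ a) ^ (b * (j + a)) / (1 - \<epsilon> ^ a) = \<epsilon> ^ (j + a) / (1 - \<epsilon> ^ a)"
      by (simp only: power_mult E(4)[OF e])
  qed
  finally have "dedekind_sum R a (j + a) - dedekind_sum R a (j + a + 1) = root_sum R (b * (j + a))"
    by (simp add: root_sum_def E_def)
  also have "\<dots> = root_sum R (Suc (b * j))"
  proof (rule root_sum_mod[OF R])
    have "[b * j + a * b = b * j + 1] (mod R)" using ab by (rule cong_add[OF cong_refl])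
    then show "[b * (j + a) = Suc (b * j)] (mod R)" by (simp add: algebra_simps)
  qed
  finally have "dedekind_sum R a j - dedekind_sum R a (j + (a + 1)) = root_sum R j + root_sum R (Suc (b * j))"
    using A by (simp add: add.assoc algebra_simps)
  moreover have "R dvd b * j \<longleftrightarrow> R dvd j"
  proof -
    have "coprime b R" using ab by (metis coprime_1_left coprime_mult_left_iff cong_imp_coprime cong_sym)
    then show ?thesis by (metis coprime_commute coprime_dvd_mult_right_iff)
  qed
  ultimately show ?thesis unfolding root_sum_Suc[OF R] unfolding root_sum_eq[OF R] by simp
qed

section \<open>Waves and orbifold corrections\<close>

fun cyclic_quotient :: "singularity \<Rightarrow> bool" where
  "cyclic_quotient (R, a) \<longleftrightarrow> R > 0 \<and> coprime R a"

text \<open>Up to sign, the first difference of the coefficients of the orbifold correction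
  (\<open>correction_coeff_diff\<close> below).\<close>

fun wave :: "singularity \<Rightarrow> nat \<Rightarrow> real" where
  "wave (R, a) i = sawtooth R (i * (a + 1)) + sawtooth R (i * ((SOME b. [a * b = 1] (mod R)) + 1))"

lemma inverse_unique_cong:
  fixes a b b' R :: nat
  assumes "[a * b = 1] (mod R)" "[a * b' = 1] (mod R)"
  shows "[b = b'] (mod R)"
proof -
  have "coprime a R" using assms(1) by (metis coprime_1_left coprime_mult_left_iff cong_imp_coprime cong_sym)
  moreover have "[a * b = a * b'] (mod R)" using assms by (meson cong_sym cong_trans)
  ultimately show ?thesis by (simp add: cong_mult_lcancel_nat)
qed

lemma wave_eq:
  assumes "[a * b = 1] (mod R)"
  shows "wave (R, a) i = sawtooth R (i * (a + 1)) + sawtooth R (i * (b + 1))"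
proof -
  have "[a * (SOME b. [a * b = 1] (mod R)) = 1] (mod R)" by (rule someI[of _ b]) (rule assms)
  then have "[(SOME b. [a * b = 1] (mod R)) = b] (mod R)" using assms by (rule inverse_unique_cong)
  then have "sawtooth R (i * ((SOME b. [a * b = 1] (mod R)) + 1)) = sawtooth R (i * (b + 1))"
    by (intro sawtooth_cong cong_scalar_left cong_add) auto
  then show ?thesis by simp
qed

lemma cyclic_quotient_inverse:
  assumes "cyclic_quotient (R, a)"
  obtains b where "[a * b = 1] (mod R)"
proof -
  have "coprime a R" using assms by (simp add: coprime_commute)
  from cong_solve_coprime_nat[OF this] show ?thesis using that by auto
qed

text \<open>The defining congruence of the inverse, shifted by one so that width and local index enter symmetrically.\<close>

lemma inverse_shift:
  fixes a b R :: nat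
  shows "[a * b = 1] (mod R) \<longleftrightarrow> [(a + 1) * (b + 1) = (a + 1) + (b + 1)] (mod R)"
proof -
  have "(a + 1) * (b + 1) = a * b + (a + b + 1)" "(a + 1) + (b + 1) = 1 + (a + b + 1)" by simp_all
  then show ?thesis by (simp only: cong_add_rcancel_nat)
qed

text \<open>Multiplication by the unit \<open>a\<close> takes \<open>b + 1\<close> to
  \<open>a + 1\<close> modulo \<open>R\<close>. Hence \<open>a\<close> and its inverse yield the
  same width.\<close>

lemma gcd_inverse_shift:
  fixes a b R :: nat
  assumes "[a * b = 1] (mod R)"
  shows "gcd R (b + 1) = gcd R (a + 1)"
proof -
  have "coprime a R" using assms by (metis coprime_1_left coprime_mult_left_iff cong_imp_coprime cong_sym)
  then have "gcd R (b + 1) = gcd R (a * (b + 1))"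
    by (metis coprime_commute gcd.commute gcd_mult_left_left_cancel)
  also have "[a * (b + 1) = a + 1] (mod R)"
    using cong_add[OF assms cong_refl[of a]] by (simp add: algebra_simps)
  then have "gcd R (a * (b + 1)) = gcd R (a + 1)" by (metis cong_gcd_eq gcd.commute)
  finally show ?thesis .
qed

lemma coprime_cancel_gcd:
  fixes k l c :: nat
  assumes "k > 0" "gcd (k * l) (k * c) = k"
  shows "coprime c l"
proof -
  have "k * gcd l c = k * 1" using gcd_mult_distrib_nat[of k l c] assms(2) by simp
  then have "gcd l c = 1" using assms(1) by (metis mult_left_cancel less_irrefl)
  then show ?thesis by (metis coprime_iff_gcd_eq_1 gcd.commute)
qed

text \<open>Dividing by the width \<open>k\<close> leaves \<open>l\<close>, \<open>c\<close> and
  \<open>d\<close>. What survives of the inverse relation is \<open>k * c * d = c + d\<close> modulo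
  \<open>l\<close>, which involves \<open>k\<close> only modulo \<open>l\<close>; this is why
  passing to the residue can preserve the wave.\<close>

lemma reduced_data:
  assumes "cyclic_quotient (R, a)"
  obtains k l b c d where "R = k * l" "a + 1 = k * c" "b + 1 = k * d" "k > 0" "l > 0" "c > 0" "d > 0"
    "coprime c l" "coprime d l" "[a * b = 1] (mod R)" "[k * c * d = c + d] (mod l)"
    "local_index (R, a) = l" "width (R, a) = k"
    "\<And>i. wave (R, a) i = sawtooth l (i * c) + sawtooth l (i * d)"
proof -
  obtain b where b: "[a * b = 1] (mod R)" using cyclic_quotient_inverse[OF assms] .
  have R: "R > 0" using assms by simp
  define k where "k = gcd R (a + 1)"
  have k: "k > 0" using R by (simp add: k_def)
  have kb: "gcd R (b + 1) = k" unfolding k_def by (rule gcd_inverse_shift[OF b])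
  obtain l where l: "R = k * l" unfolding k_def by (metis gcd_dvd1 dvdE)
  obtain c where c: "a + 1 = k * c" unfolding k_def by (metis gcd_dvd2 dvdE)
  obtain d where d: "b + 1 = k * d" using kb by (metis gcd_dvd2 dvdE)
  have ka: "gcd R (a + 1) = k" by (simp add: k_def)
  have cl: "coprime c l" by (rule coprime_cancel_gcd[OF k ka[unfolded l c]])
  have dl: "coprime d l" by (rule coprime_cancel_gcd[OF k kb[unfolded l d]])
  have "[(k * c) * (k * d) = k * c + k * d] (mod k * l)" using b inverse_shift[of a b R] by (simp only: l c d)
  then have "[k * (k * c * d) = k * (c + d)] (mod k * l)" by (simp add: algebra_simps)
  then have kcd: "[k * c * d = c + d] (mod l)" using k by (simp add: cong_def mult_mod_right[symmetric])
  show ?thesis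
  proof (rule that[OF l c d k _ _ _ cl dl b kcd])
    show "l > 0" using R l by (cases l) auto
    show "c > 0" using c by (cases c) auto
    show "d > 0" using d by (cases d) auto
    show "local_index (R, a) = l" by (simp only: local_index_eq[OF R] ka) (simp add: l k)
    show "width (R, a) = k" by (simp only: width_eq[OF R] ka)
    show "wave (R, a) i = sawtooth l (i * c) + sawtooth l (i * d)" for i
    proof -
      have "i * (a + 1) = k * (i * c)" "i * (b + 1) = k * (i * d)" by (simp_all only: c d mult.left_commute)
      then show ?thesis unfolding wave_eq[OF b] by (simp only: l sawtooth_mult[OF k])
    qed
  qed
qed

lemma wave_reduced:
  assumes "cyclic_quotient s"
  obtains c d where "coprime c (local_index s)" "coprime d (local_index s)"
    "\<And>i. wave s i = sawtooth (local_index s) (i * c) + sawtooth (local_index s) (i * d)"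
proof -
  obtain R a where s: "s = (R, a)" by (cases s)
  obtain k l b c d where D: "R = k * l" "a + 1 = k * c" "b + 1 = k * d" "k > 0" "l > 0" "c > 0" "d > 0"
    "coprime c l" "coprime d l" "[a * b = 1] (mod R)" "[k * c * d = c + d] (mod l)"
    "local_index (R, a) = l" "width (R, a) = k"
    and w: "\<And>i. wave (R, a) i = sawtooth l (i * c) + sawtooth l (i * d)"
    by (rule reduced_data[OF assms[unfolded s]]) (rule that; assumption)
  show ?thesis
    by (rule that[of c d]) (simp_all only: s D(8,9,12) w)
qed

lemma cqs_eq:
  assumes "cyclic_quotient (R, a)"
  obtains b where "cqs R a = (R, b)" "[b = a] (mod R) \<or> [a * b = 1] (mod R)"
proof (rule that)
  show "cqs R a = (R, LEAST b. [b = a] (mod R) \<or> [a * b = 1] (mod R))" by (simp add: cqs_def)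
  show "[(LEAST b. [b = a] (mod R) \<or> [a * b = 1] (mod R)) = a] (mod R) \<or>
      [a * (LEAST b. [b = a] (mod R) \<or> [a * b = 1] (mod R)) = 1] (mod R)"
    by (rule LeastI[of _ a]) simp
qed

text \<open>The representative is congruent to \<open>a\<close> or to its inverse; in the second
  case the two sawtooths of the wave merely change places.\<close>

lemma cqs_invariants:
  assumes "cyclic_quotient (R, a)"
  shows "cyclic_quotient (cqs R a)" "local_index (cqs R a) = local_index (R, a)"
    "width (cqs R a) = width (R, a)" "wave (cqs R a) = wave (R, a)"
proof -
  obtain b where b: "cqs R a = (R, b)" and cases: "[b = a] (mod R) \<or> [a * b = 1] (mod R)"
    using cqs_eq[OF assms] .
  obtain a' where a': "[a * a' = 1] (mod R)" using cyclic_quotient_inverse[OF assms] .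
  have R: "R > 0" using assms by simp
  have cop: "coprime R a" using assms by simp
  have inv: "coprime R x" if "[y * x = 1] (mod R)" for x y
    using that by (metis coprime_1_left coprime_commute coprime_mult_left_iff cong_imp_coprime cong_sym)
  have "coprime R b \<and> gcd R (b + 1) = gcd R (a + 1) \<and> (\<forall>i. wave (R, b) i = wave (R, a) i)"
    using cases
  proof
    assume ba: "[b = a] (mod R)"
    have "[b * a' = a * a'] (mod R)" using ba by (rule cong_scalar_right)
    then have ba': "[b * a' = 1] (mod R)" using a' by (rule cong_trans)
    have "sawtooth R (i * (b + 1)) = sawtooth R (i * (a + 1))" for i
      by (intro sawtooth_cong cong_scalar_left cong_add ba) auto
    then have "wave (R, b) i = wave (R, a) i" for i unfolding wave_eq[OF ba'] wave_eq[OF a'] by simp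
    moreover have "[b + 1 = a + 1] (mod R)" using ba by (rule cong_add) simp
    then have "gcd R (b + 1) = gcd R (a + 1)" by (metis cong_gcd_eq gcd.commute)
    moreover have "coprime R b" using cop ba by (metis cong_imp_coprime cong_sym coprime_commute)
    ultimately show ?thesis by blast
  next
    assume ab: "[a * b = 1] (mod R)"
    then have ba: "[b * a = 1] (mod R)" by (simp add: mult.commute)
    show ?thesis using gcd_inverse_shift[OF ab] inv[OF ab] unfolding wave_eq[OF ba] wave_eq[OF ab] by simp
  qed
  then show "cyclic_quotient (cqs R a)" "local_index (cqs R a) = local_index (R, a)"
    "width (cqs R a) = width (R, a)" "wave (cqs R a) = wave (R, a)"
    using R by (auto simp: b local_index_eq width_eq simp del: wave.simps local_index.simps width.simps)
qed

lemma local_index_pos: "cyclic_quotient s \<Longrightarrow> local_index s > 0"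
  by (cases s) (auto simp: local_index_eq div_greater_zero_iff gcd_le1_nat simp del: local_index.simps)

lemma width_pos: "cyclic_quotient s \<Longrightarrow> width s > 0"
  by (cases s) (auto simp: width_eq simp del: width.simps)

text \<open>Replacing \<open>k\<close> by \<open>r = k mod l\<close> respects the congruence of
  \<open>reduced_data\<close>, so \<open>r * c - 1\<close> and \<open>r * d - 1\<close> are inverse
  modulo \<open>r * l\<close>, with the same \<open>l\<close>, \<open>c\<close>, \<open>d\<close>
  and therefore the same wave.\<close>

lemma residue_invariants:
  assumes s: "cyclic_quotient s" and r: "width s mod local_index s \<noteq> 0"
  shows "cyclic_quotient (residue s)" "local_index (residue s) = local_index s"
    "R_singularity (residue s)" "wave (residue s) = wave s"
proof -
  obtain R a where Ra: "s = (R, a)" by (cases s)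
  obtain k l b c d where D: "R = k * l" "a + 1 = k * c" "b + 1 = k * d" "k > 0" "l > 0" "c > 0" "d > 0"
    "coprime c l" "coprime d l" "[a * b = 1] (mod R)" "[k * c * d = c + d] (mod l)"
    "local_index (R, a) = l" "width (R, a) = k"
    and w: "\<And>i. wave (R, a) i = sawtooth l (i * c) + sawtooth l (i * d)"
    by (rule reduced_data[OF s[unfolded Ra]]) (rule that; assumption)
  define r where "r = k mod l"
  have r0: "r > 0" "r < l" using r Ra D by (auto simp: r_def)
  define a' b' where "a' = r * c - 1" and "b' = r * d - 1"
  have a': "a' + 1 = r * c" and b': "b' + 1 = r * d" using r0 D by (simp_all add: a'_def b'_def Suc_leI)
  have "r * (a + 1) div k = r * c" using D(2,4) by simp
  then have res: "residue s = cqs (r * l) a'"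
    unfolding Ra residue.simps Let_def D(12,13) r_def[symmetric] a'_def by simp
  have "[r = k] (mod l)" by (simp add: r_def)
  then have "[r * (c * d) = k * (c * d)] (mod l)" by (rule cong_scalar_right)
  then have "[r * c * d = c + d] (mod l)" using D(11) by (metis cong_trans mult.assoc)
  then have "[r * (r * c * d) = r * (c + d)] (mod r * l)" by (simp add: cong_def mult_mod_right[symmetric])
  then have "[(a' + 1) * (b' + 1) = (a' + 1) + (b' + 1)] (mod r * l)" unfolding a' b' by (simp add: algebra_simps)
  then have ab': "[a' * b' = 1] (mod r * l)" by (simp only: inverse_shift)
  then have "coprime a' (r * l)" by (metis coprime_1_left coprime_mult_left_iff cong_imp_coprime cong_sym)
  then have v: "cyclic_quotient (r * l, a')" using r0 by (simp add: coprime_commute)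
  have pos: "r * l > 0" using r0 by simp
  have "gcd (r * l) (a' + 1) = r * gcd l c" unfolding a' by (simp only: gcd_mult_distrib_nat)
  also have "gcd l c = 1" using D(8) by (metis coprime_iff_gcd_eq_1 gcd.commute)
  finally have g: "gcd (r * l) (a' + 1) = r" by simp
  have li: "local_index (r * l, a') = l" using local_index_eq[OF pos, of a'] g r0 by simp
  have wi: "width (r * l, a') = r" using width_eq[OF pos, of a'] g by simp
  have "wave (r * l, a') i = wave (R, a) i" for i
    unfolding wave_eq[OF ab'] w a' b' by (simp add: mult.left_commute[of i r] sawtooth_mult[OF r0(1)])
  then have "wave (r * l, a') = wave (R, a)" by (rule ext)
  then show "cyclic_quotient (residue s)" "local_index (residue s) = local_index s"
    "R_singularity (residue s)" "wave (residue s) = wave s"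
    unfolding R_singularity_def res cqs_invariants[OF v] li wi using cqs_invariants(1)[OF v] D r0 Ra by auto
qed

text \<open>If \<open>l\<close> divides \<open>k\<close>, the congruence of
  \<open>reduced_data\<close> reads \<open>c + d = 0\<close> modulo \<open>l\<close>, and the two
  sawtooths cancel.\<close>

lemma wave_T_singularity:
  assumes s: "cyclic_quotient s" and r: "width s mod local_index s = 0"
  shows "wave s i = 0"
proof -
  obtain R a where Ra: "s = (R, a)" by (cases s)
  obtain k l b c d where D: "R = k * l" "a + 1 = k * c" "b + 1 = k * d" "k > 0" "l > 0" "c > 0" "d > 0"
    "coprime c l" "coprime d l" "[a * b = 1] (mod R)" "[k * c * d = c + d] (mod l)"
    "local_index (R, a) = l" "width (R, a) = k"
    and w: "\<And>i. wave (R, a) i = sawtooth l (i * c) + sawtooth l (i * d)"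
    by (rule reduced_data[OF s[unfolded Ra]]) (rule that; assumption)
  have "l dvd k" using r Ra D by (simp add: dvd_eq_mod_eq_0)
  then have "[0 = k * c * d] (mod l)" by (metis cong_0_iff cong_sym dvd_mult2)
  then have "[c + d = 0] (mod l)" using D(11) by (meson cong_sym cong_trans)
  then have "[i * (c + d) = i * 0] (mod l)" by (rule cong_scalar_left)
  then have "[i * c + i * d = 0] (mod l)" by (simp add: algebra_simps)
  then show ?thesis unfolding Ra w using sawtooth_neg[OF D(5)] by simp
qed

text \<open>As \<open>c\<close> is prime to \<open>l\<close>, the gcd of \<open>l * l\<close> and
  \<open>l * c\<close> is \<open>l\<close>.\<close>

lemma T_part_local_index:
  assumes s: "cyclic_quotient s"
  shows "local_index (T_part s) = local_index s"
proof -
  obtain R a where Ra: "s = (R, a)" by (cases s)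
  obtain k l b c d where D: "R = k * l" "a + 1 = k * c" "b + 1 = k * d" "k > 0" "l > 0" "c > 0" "d > 0"
    "coprime c l" "coprime d l" "[a * b = 1] (mod R)" "[k * c * d = c + d] (mod l)"
    "local_index (R, a) = l" "width (R, a) = k"
    and w: "\<And>i. wave (R, a) i = sawtooth l (i * c) + sawtooth l (i * d)"
    by (rule reduced_data[OF s[unfolded Ra]]) (rule that; assumption)
  define a' where "a' = l * c - 1"
  have a': "a' + 1 = l * c" using D by (simp add: a'_def Suc_leI)
  have "l * (a + 1) div k = l * c" using D(2,4) by simp
  then have T: "T_part s = cqs (l * l) a'"
    unfolding Ra T_part.simps Let_def D(12,13) a'_def by simp
  have "coprime l a'"
  proof -
    have "gcd l a' dvd l * c" "gcd l a' dvd a'" by (simp_all add: dvd_mult2)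
    then have "gcd l a' dvd 1" using a' by (metis dvd_add_right_iff)
    then show ?thesis by (metis coprime_iff_gcd_eq_1 nat_dvd_1_iff_1)
  qed
  then have v: "cyclic_quotient (l * l, a')" using D by simp
  have pos: "l * l > 0" using D by simp
  have "gcd (l * l) (a' + 1) = l * gcd l c" unfolding a' by (simp only: gcd_mult_distrib_nat)
  also have "gcd l c = 1" using D(8) by (metis coprime_iff_gcd_eq_1 gcd.commute)
  finally have "local_index (l * l, a') = l" using local_index_eq[OF pos, of a'] D by simp
  then show ?thesis unfolding T cqs_invariants[OF v] using D Ra by simp
qed

section \<open>Orbifold corrections in terms of waves\<close>

fun correction_coeff :: "singularity \<Rightarrow> nat \<Rightarrow> complex" where
  "correction_coeff (R, a) i = dedekind_sum R a ((a + 1) * i) - dedekind_sum R a 0"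

lemma correction_coeff_0: "correction_coeff s 0 = 0"
  by (cases s) simp

lemma correction_coeff_diff:
  assumes "cyclic_quotient s"
  shows "correction_coeff s i - correction_coeff s (Suc i) = of_real (wave s i)"
proof -
  obtain R a where s: "s = (R, a)" by (cases s)
  obtain b where b: "[a * b = 1] (mod R)" using cyclic_quotient_inverse assms s by blast
  have R: "R > 0" using assms s by simp
  have "correction_coeff s i - correction_coeff s (Suc i) =
      dedekind_sum R a ((a + 1) * i) - dedekind_sum R a ((a + 1) * i + (a + 1))"
    by (simp add: s algebra_simps)
  also have "\<dots> = of_real (sawtooth R ((a + 1) * i) + sawtooth R (b * ((a + 1) * i)))"
    by (rule dedekind_sum_diff[OF R b])
  also have "[b * ((a + 1) * i) = i * (b + 1)] (mod R)"
  proof -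
    have "[i * (a * b + b) = i * (1 + b)] (mod R)" using b by (intro cong_scalar_left cong_add) auto
    then show ?thesis by (simp add: algebra_simps)
  qed
  then have "sawtooth R (b * ((a + 1) * i)) = sawtooth R (i * (b + 1))" by (rule sawtooth_cong)
  also have "sawtooth R ((a + 1) * i) + sawtooth R (i * (b + 1)) = wave s i"
    unfolding s wave_eq[OF b] by (simp add: mult.commute)
  finally show ?thesis .
qed

lemma correction_coeff_period:
  assumes "cyclic_quotient s"
  shows "correction_coeff s (i + local_index s) = correction_coeff s i"
proof -
  obtain R a where s: "s = (R, a)" by (cases s)
  have R: "R > 0" using assms s by simp
  have "R dvd (a + 1) * (R div gcd R (a + 1))"
    by (metis dvd_div_mult dvd_mult2 dvd_triv_right gcd_dvd1 gcd_dvd2 mult.commute)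
  then have "[(a + 1) * (R div gcd R (a + 1)) = 0] (mod R)" by (simp only: cong_0_iff)
  then have "[(a + 1) * i + (a + 1) * (R div gcd R (a + 1)) = (a + 1) * i + 0] (mod R)"
    by (rule cong_add[OF cong_refl])
  then have "[(a + 1) * (i + local_index s) = (a + 1) * i] (mod R)"
    unfolding s local_index_eq[OF R] by (simp add: algebra_simps)
  from dedekind_sum_cong[OF this] show ?thesis by (simp add: s del: local_index.simps)
qed

text \<open>A fraction over \<open>1 - t ^ l\<close> is expanded to the denominator
  \<open>1 - t ^ (l * q)\<close>, so that singularities of different local index can be
  added.\<close>

lemma periodic_poly_sum:
  fixes f :: "nat \<Rightarrow> complex"
  assumes "\<And>i. f (i + l) = f i"
  shows "(\<Sum>i<l * q. Polynomial.monom (f (Suc i)) i) * (1 - Polynomial.monom 1 l) =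
    (\<Sum>i<l. Polynomial.monom (f (Suc i)) i) * (1 - Polynomial.monom 1 (l * q))"
proof (induction q)
  case (Suc q)
  have f: "f (i + l * q) = f i" for i q by (rule periodic_add_mult[where h = f]) (rule assms)
  have "(\<Sum>i<l * Suc q. Polynomial.monom (f (Suc i)) i) = (\<Sum>i<l * q. Polynomial.monom (f (Suc i)) i) + (\<Sum>i\<in>{l * q..<l * q + l}. Polynomial.monom (f (Suc i)) i)"
    by (subst sum.union_disjoint[symmetric]) (auto intro!: sum.cong)
  also have "(\<Sum>i\<in>{l * q..<l * q + l}. Polynomial.monom (f (Suc i)) i) = (\<Sum>i<l. Polynomial.monom (f (Suc (i + l * q))) (i + l * q))"
    using sum.shift_bounds_nat_ivl[of "\<lambda>i. Polynomial.monom (f (Suc i)) i" 0 "l * q" l] by (simp add: lessThan_atLeast0 add.commute)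
  also have "\<dots> = (\<Sum>i<l. Polynomial.monom (f (Suc i)) i) * Polynomial.monom 1 (l * q)"
    using f[of "Suc _" q] by (simp add: sum_distrib_right mult_monom)
  finally have "(\<Sum>i<l * Suc q. Polynomial.monom (f (Suc i)) i) * (1 - Polynomial.monom 1 l) =
      (\<Sum>i<l * q. Polynomial.monom (f (Suc i)) i) * (1 - Polynomial.monom 1 l) +
      (\<Sum>i<l. Polynomial.monom (f (Suc i)) i) * Polynomial.monom 1 (l * q) * (1 - Polynomial.monom 1 l)"
    by (simp only: distrib_right)
  also have "\<dots> = (\<Sum>i<l. Polynomial.monom (f (Suc i)) i) * (1 - Polynomial.monom 1 (l * q) + Polynomial.monom 1 (l * q) * (1 - Polynomial.monom 1 l))"
    unfolding Suc.IH by (simp only: distrib_left mult.assoc)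
  also have "1 - Polynomial.monom 1 (l * q) + Polynomial.monom 1 (l * q) * (1 - Polynomial.monom 1 l) = 1 - Polynomial.monom (1 :: complex) (l * Suc q)"
    by (simp add: right_diff_distrib mult_monom add.commute)
  finally show ?case .
qed simp

lemma one_minus_monom_nonzero:
  assumes "l > 0"
  shows "1 - Polynomial.monom (1 :: complex) l \<noteq> 0"
proof
  assume "1 - Polynomial.monom (1 :: complex) l = 0"
  then have "degree (Polynomial.monom (1 :: complex) l) = degree (1 :: complex poly)" by simp
  then show False using assms by (simp add: degree_monom_eq)
qed

definition correction_poly :: "nat \<Rightarrow> singularity \<Rightarrow> complex poly" where
  "correction_poly L s = (\<Sum>i<L. Polynomial.monom (correction_coeff s (Suc i)) i)"

lemma orbifold_correction_eq:
  assumes "cyclic_quotient s" "local_index s dvd L" "L > 0"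
  shows "orbifold_correction s = Fraction_Field.Fract (correction_poly L s) (1 - Polynomial.monom 1 L)"
proof -
  obtain R a where s: "s = (R, a)" by (cases s)
  obtain q where q: "L = local_index s * q" using assms(2) by blast
  have l: "local_index s > 0" by (rule local_index_pos[OF assms(1)])
  have "orbifold_correction s = Fraction_Field.Fract (\<Sum>i = 1..local_index s. Polynomial.monom (correction_coeff s i) (i - 1)) (1 - Polynomial.monom 1 (local_index s))"
    by (simp add: s Let_def del: local_index.simps)
  also have "(\<Sum>i = 1..local_index s. Polynomial.monom (correction_coeff s i) (i - 1)) = correction_poly (local_index s) s"
    by (simp add: correction_poly_def sum.atLeast1_atMost_eq)
  also have "Fraction_Field.Fract (correction_poly (local_index s) s) (1 - Polynomial.monom 1 (local_index s)) =
      Fraction_Field.Fract (correction_poly L s) (1 - Polynomial.monom 1 L)"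
    using periodic_poly_sum[where f = "correction_coeff s" and l = "local_index s" and q = q, OF correction_coeff_period[OF assms(1)]]
      one_minus_monom_nonzero[OF l] one_minus_monom_nonzero[OF assms(3)]
    by (subst eq_fract) (auto simp: correction_poly_def q)
  finally show ?thesis .
qed

lemma sum_orbifold_correction:
  assumes "\<forall>s\<in>#A. cyclic_quotient s \<and> local_index s dvd L" "L > 0"
  shows "(\<Sum>s\<in>#A. orbifold_correction s) =
    Fraction_Field.Fract (\<Sum>i<L. Polynomial.monom (\<Sum>s\<in>#A. correction_coeff s (Suc i)) i) (1 - Polynomial.monom 1 L)"
  using assms(1)
proof (induction A)
  case empty
  then show ?case by (simp add: Zero_fract_def[symmetric] fract_collapse)
next
  case (add s A)
  have "(\<Sum>s\<in>#add_mset s A. orbifold_correction s) = Fraction_Field.Fract (correction_poly L s) (1 - Polynomial.monom 1 L) +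
      Fraction_Field.Fract (\<Sum>i<L. Polynomial.monom (\<Sum>s\<in>#A. correction_coeff s (Suc i)) i) (1 - Polynomial.monom 1 L)"
    using add orbifold_correction_eq[of s L] assms(2) by simp
  also have "\<dots> = Fraction_Field.Fract ((correction_poly L s + (\<Sum>i<L. Polynomial.monom (\<Sum>s\<in>#A. correction_coeff s (Suc i)) i)) * (1 - Polynomial.monom 1 L)) ((1 - Polynomial.monom 1 L) * (1 - Polynomial.monom 1 L))"
    using one_minus_monom_nonzero[OF assms(2)] by (simp add: algebra_simps)
  also have "\<dots> = Fraction_Field.Fract (correction_poly L s + (\<Sum>i<L. Polynomial.monom (\<Sum>s\<in>#A. correction_coeff s (Suc i)) i)) (1 - Polynomial.monom 1 L)"
    using one_minus_monom_nonzero[OF assms(2)] by (simp add: eq_fract)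
  also have "correction_poly L s + (\<Sum>i<L. Polynomial.monom (\<Sum>s\<in>#A. correction_coeff s (Suc i)) i) =
      (\<Sum>i<L. Polynomial.monom (\<Sum>s\<in>#add_mset s A. correction_coeff s (Suc i)) i)"
    by (simp add: correction_poly_def sum.distrib[symmetric] add_monom)
  finally show ?case .
qed

text \<open>Over a common denominator the sum vanishes iff the total coefficients do. These start
  from 0 at index 0, and their successive differences are the total wave.\<close>

lemma sum_orbifold_correction_eq_0_iff:
  assumes A: "\<forall>s\<in>#A. cyclic_quotient s"
  shows "(\<Sum>s\<in>#A. orbifold_correction s) = 0 \<longleftrightarrow> (\<forall>i. (\<Sum>s\<in>#A. wave s i) = 0)"
proof -
  define L where "L = (\<Prod>s\<in>#A. local_index s)"
  have "L \<noteq> 0"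
  proof
    assume "L = 0"
    then have "0 \<in># image_mset local_index A" unfolding L_def by (simp only: prod_mset_zero_iff)
    then obtain s where "s \<in># A" "local_index s = 0" by auto
    then show False using A local_index_pos[of s] by auto
  qed
  then have L: "L > 0" by simp
  have Ld: "\<forall>s\<in>#A. cyclic_quotient s \<and> local_index s dvd L"
  proof
    fix s assume s: "s \<in># A"
    then have "local_index s \<in># image_mset local_index A" by (metis image_eqI set_image_mset)
    then show "cyclic_quotient s \<and> local_index s dvd L" using A s unfolding L_def by (metis dvd_prod_mset)
  qed
  define c where "c i = (\<Sum>s\<in>#A. correction_coeff s i)" for i
  have c0: "c 0 = 0" unfolding c_def by (simp add: correction_coeff_0)
  have cd: "c i - c (Suc i) = of_real (\<Sum>s\<in>#A. wave s i)" for i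
    unfolding c_def using A
    by (induction A) (auto simp: correction_coeff_diff[symmetric])
  have cp: "c (i + L) = c i" for i
  proof -
    have "correction_coeff s (i + L) = correction_coeff s i" if "s \<in># A" for s
    proof -
      obtain q where q: "L = local_index s * q" using Ld \<open>s \<in># A\<close> by blast
      show ?thesis unfolding q
        by (rule periodic_add_mult[where h = "correction_coeff s"], rule correction_coeff_period) (use A that in blast)
    qed
    then show ?thesis unfolding c_def by (intro arg_cong[where f = sum_mset] image_mset_cong) auto
  qed
  have "(\<Sum>s\<in>#A. orbifold_correction s) = 0 \<longleftrightarrow> (\<Sum>i<L. Polynomial.monom (c (Suc i)) i) = 0"
    unfolding sum_orbifold_correction[OF Ld L] c_def[symmetric] Zero_fract_def
    using one_minus_monom_nonzero[OF L] by (subst eq_fract) auto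
  also have "\<dots> \<longleftrightarrow> (\<forall>i<L. c (Suc i) = 0)"
  proof -
    have "Polynomial.coeff (\<Sum>i<L. Polynomial.monom (c (Suc i)) i) n = (if n < L then c (Suc n) else 0)" for n
      by (simp add: Polynomial.coeff_sum sum.delta)
    then show ?thesis unfolding poly_eq_iff by auto
  qed
  also have "\<dots> \<longleftrightarrow> (\<forall>i. c i = 0)"
  proof
    assume c: "\<forall>i<L. c (Suc i) = 0"
    have "c i = 0" for i
    proof (induction i rule: less_induct)
      case (less i)
      show ?case
      proof (cases "i \<le> L")
        case True
        then show ?thesis using c c0 by (cases i) auto
      next
        case False
        then have "c (i - L) = 0" using less L by simp
        then show ?thesis using cp[of "i - L"] False by simp
      qed
    qed
    then show "\<forall>i. c i = 0" ..
  qed auto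
  also have "\<dots> \<longleftrightarrow> (\<forall>i. (\<Sum>s\<in>#A. wave s i) = 0)"
  proof
    assume "\<forall>i. c i = 0"
    then show "\<forall>i. (\<Sum>s\<in>#A. wave s i) = 0" using cd by (metis diff_self of_real_eq_0_iff)
  next
    assume w: "\<forall>i. (\<Sum>s\<in>#A. wave s i) = 0"
    have "c i = 0" for i
    proof (induction i)
      case (Suc i)
      then show ?case using cd[of i] w by simp
    qed (rule c0)
    then show "\<forall>i. c i = 0" ..
  qed
  finally show ?thesis .
qed

section \<open>Quasi-polynomials\<close>

text \<open>\<open>f\<close> is a quadratic polynomial minus the partial sums \<open>W\<close> of
  \<open>w\<close>. Oddness makes \<open>w\<close> sum to zero over a period, so \<open>W\<close>
  inherits the periods of \<open>w\<close>; conversely the constant coefficient of a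
  quasi-polynomial is forced to be \<open>1 - W k\<close>, and its period passes to the
  increments.\<close>

lemma quasi_polynomial_of_period_iff:
  fixes f :: "nat \<Rightarrow> nat" and w :: "nat \<Rightarrow> real" and \<beta> :: real
  assumes N: "N > 0" and per: "\<And>i. w (i + N) = w i" and odd: "\<And>i. i \<le> N \<Longrightarrow> w (N - i) = - w i"
    and f: "\<And>k. real (f k) = 1 + \<beta> * (real k * (real k + 1) / 2) - (\<Sum>i<k. w (Suc i))"
    and p: "p > 0"
  shows "quasi_polynomial_of_period f p \<longleftrightarrow> (\<forall>i. w (i + p) = w i)"
proof -
  define W where "W k = (\<Sum>i<k. w (Suc i))" for k
  have w0: "w 0 = 0" using per[of 0] odd[of 0] by simp
  have zero: "(\<Sum>i<N. w i) = 0"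
  proof -
    have "(\<Sum>i\<le>N. w i) = (\<Sum>i\<le>N. w (N - i))"
      by (rule sum.nat_diff_reindex[symmetric, of w "Suc N", simplified lessThan_Suc_atMost, simplified])
    also have "\<dots> = - (\<Sum>i\<le>N. w i)" using odd by (simp add: sum_negf)
    finally have "(\<Sum>i\<le>N. w i) = 0" by simp
    then show ?thesis using per[of 0] w0 by (simp add: lessThan_Suc_atMost[symmetric])
  qed
  have shift: "W (k + q) = W k" if q: "\<And>i. w (i + q) = w i" and q0: "q > 0" for k q
  proof -
    \<comment> \<open>A period \<open>q\<close> need not be related to \<open>N\<close>: the sum
      over \<open>q * N\<close> terms is a multiple both of the sum over \<open>q\<close> terms and
      of the vanishing one over \<open>N\<close> terms.\<close>
    have "of_nat N * (\<Sum>i<q. w i) = (\<Sum>i<q * N. w i)" by (rule sum_multiple_period[where h = w and l = q, OF q, symmetric])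
    also have "\<dots> = of_nat q * (\<Sum>i<N. w i)" by (subst mult.commute) (rule sum_multiple_period[where h = w and l = N, OF per])
    finally have s: "(\<Sum>i<q. w i) = 0" using zero N by simp
    have "W (k + q) = W k + (\<Sum>i\<in>{k..<k + q}. w (Suc i))"
      unfolding W_def by (subst sum.union_disjoint[symmetric]) (auto intro!: sum.cong)
    also have "(\<Sum>i\<in>{k..<k + q}. w (Suc i)) = (\<Sum>i<q. w (i + Suc k))"
      using sum.shift_bounds_nat_ivl[of "\<lambda>i. w (Suc i)" 0 k q] by (simp add: lessThan_atLeast0 add.commute)
    also have "\<dots> = (\<Sum>i<q. w i)" by (rule sum_shift_period[where h = w and N = q, OF q])
    finally show ?thesis using s by simp
  qed
  show ?thesis
  proof
    assume "\<forall>i. w (i + p) = w i"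
    then have Wp: "W (k + p) = W k" for k using p by (intro shift) auto
    define c where "c i k = (if i = 0 then 1 - W k else \<beta> / 2)" for i :: nat and k
    show "quasi_polynomial_of_period f p"
      unfolding quasi_polynomial_of_period_def
    proof (intro exI[of _ 2] exI[of _ c] conjI allI)
      show "c i (k + p) = c i k" for i k by (simp add: c_def Wp)
      show "real (f k) = (\<Sum>i\<le>2. c i k * real k ^ i)" for k
        unfolding f W_def[symmetric] by (simp add: c_def numeral_2_eq_2 field_simps)
    qed
  next
    assume "quasi_polynomial_of_period f p"
    then obtain n c where c: "\<And>i k. c i (k + p) = c i k" and fc: "\<And>k. real (f k) = (\<Sum>i\<le>n. c i k * real k ^ i)"
      unfolding quasi_polynomial_of_period_def by blast
    have c0: "c 0 k = 1 - W k" for k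
    proof -
      \<comment> \<open>Along the progression \<open>k + p * (N * t)\<close> all coefficients and
        \<open>W\<close> are constant, so \<open>A\<close> has infinitely many zeros.\<close>
      define A where "A = (\<Sum>i\<le>n. Polynomial.monom (c i k) i) - [:1 - W k, \<beta> / 2, \<beta> / 2:]"
      have "poly A (real (k + p * (N * t))) = 0" for t
      proof -
        have ck: "c i (k + p * (N * t)) = c i k" for i by (rule periodic_add_mult[where h = "c i"]) (rule c)
        have "W (k + N * (p * t)) = W k" by (rule periodic_add_mult[where h = W], rule shift) (rule per, rule N)
        then have Wk: "W (k + p * (N * t)) = W k" by (simp add: mult.left_commute)
        have "(\<Sum>i\<le>n. c i k * real (k + p * (N * t)) ^ i) = 1 + \<beta> * (real (k + p * (N * t)) * (real (k + p * (N * t)) + 1) / 2) - W k"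
          using fc[of "k + p * (N * t)"] f[of "k + p * (N * t)"] unfolding ck W_def[symmetric] Wk by simp
        then show ?thesis unfolding A_def
          by (simp only: poly_diff poly_sum poly_monom) (simp add: field_simps)
      qed
      then have "range (\<lambda>t. real (k + p * (N * t))) \<subseteq> {x. poly A x = 0}" by auto
      moreover have "infinite (range (\<lambda>t. real (k + p * (N * t))))"
        using p N by (intro range_inj_infinite) (auto intro!: injI)
      ultimately have "A = 0" using poly_roots_finite infinite_super by blast
      then have "Polynomial.coeff A 0 = 0" by simp
      then show ?thesis by (simp add: A_def Polynomial.coeff_sum)
    qed
    have Wp: "W (k + p) = W k" for k using c0[of k] c0[of "k + p"] c[of 0 k] by simp
    have wS: "w (Suc i + p) = w (Suc i)" for i using Wp[of "Suc i"] Wp[of i] by (simp add: W_def)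
    show "\<forall>i. w (i + p) = w i"
    proof
      fix i
      \<comment> \<open>\<open>wS\<close> speaks of positive arguments only; the detour through
        \<open>N\<close> reaches \<open>i = 0\<close>.\<close>
      have "w (i + p) = w (i + p + N)" by (rule per[symmetric])
      also have "\<dots> = w (Suc (i + N - 1) + p)" using N by (simp add: add_ac)
      also have "\<dots> = w (i + N)" unfolding wS using N by simp
      finally show "w (i + p) = w i" using per by simp
    qed
  qed
qed

section \<open>Fano polygons and their edges\<close>

definition cross2 :: "real ^ 2 \<Rightarrow> real ^ 2 \<Rightarrow> real" where
  "cross2 u v = u $ 1 * v $ 2 - u $ 2 * v $ 1"

text \<open>A quarter turn; pairing with \<open>rot v\<close> is the determinant with
  \<open>v\<close>, and its multiples are the functionals vanishing at \<open>v\<close>.\<close>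

definition rot :: "real ^ 2 \<Rightarrow> real ^ 2" where
  "rot v = vector [- v $ 2, v $ 1]"

lemma rot_nth [simp]: "rot v $ 1 = - v $ 2" "rot v $ 2 = v $ 1"
  by (simp_all add: rot_def)

lemma inner2: "(u :: real ^ 2) \<bullet> v = u $ 1 * v $ 1 + u $ 2 * v $ 2"
  by (simp add: inner_vec_def sum_2)

lemma vec2_eq_iff: "(u :: real ^ 2) = v \<longleftrightarrow> u $ 1 = v $ 1 \<and> u $ 2 = v $ 2"
  by (simp add: vec_eq_iff forall_2)

lemma inner_rot: "rot u \<bullet> v = cross2 u v"
  by (simp add: inner2 cross2_def)

lemma cross2_swap: "cross2 v u = - cross2 u v"
  by (simp add: cross2_def)

lemma cross2_self [simp]: "cross2 u u = 0"
  by (simp add: cross2_def)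

lemma orthogonal_rot:
  assumes "w \<bullet> u = 0" "u \<noteq> 0"
  obtains c where "w = c *\<^sub>R rot u"
proof
  have nz: "u \<bullet> u \<noteq> 0" using assms(2) by simp
  have o: "w $ 1 * u $ 1 + w $ 2 * u $ 2 = 0" using assms(1) by (simp add: inner2)
  have "w $ 1 * (u \<bullet> u) - (w \<bullet> rot u) * (- u $ 2) = u $ 1 * (w $ 1 * u $ 1 + w $ 2 * u $ 2)"
    "w $ 2 * (u \<bullet> u) - (w \<bullet> rot u) * u $ 1 = u $ 2 * (w $ 1 * u $ 1 + w $ 2 * u $ 2)"
    by (simp_all add: inner2 algebra_simps)
  then have "w $ 1 * (u \<bullet> u) = (w \<bullet> rot u) * (- u $ 2)" "w $ 2 * (u \<bullet> u) = (w \<bullet> rot u) * u $ 1"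
    unfolding o by simp_all
  then have "w $ 1 = (w \<bullet> rot u) / (u \<bullet> u) * (- u $ 2)" "w $ 2 = (w \<bullet> rot u) / (u \<bullet> u) * u $ 1"
    using nz by (simp_all add: field_simps)
  then show "w = ((w \<bullet> rot u) / (u \<bullet> u)) *\<^sub>R rot u" by (simp add: vec2_eq_iff)
qed

text \<open>Proportional vectors on a line that misses the origin coincide.\<close>

lemma cross2_zero_imp_eq:
  assumes "n \<bullet> x = -1" "n \<bullet> y = -1" "cross2 x y = 0"
  shows "x = y"
proof -
  have "x $ 1 * (n \<bullet> y) - y $ 1 * (n \<bullet> x) = n $ 2 * cross2 x y"
    "x $ 2 * (n \<bullet> y) - y $ 2 * (n \<bullet> x) = - n $ 1 * cross2 x y"
    by (simp_all add: inner2 cross2_def algebra_simps)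
  then have "x $ 1 = y $ 1" "x $ 2 = y $ 2" unfolding assms by simp_all
  then show ?thesis by (simp add: vec2_eq_iff)
qed

locale fano =
  fixes P :: "(real ^ 2) set"
  assumes fano: "fano_polygon P"
begin

definition vertices :: "(real ^ 2) set" where
  "vertices = {v. v extreme_point_of P}"

lemma polytope_P: "polytope P"
  using fano unfolding fano_polygon_def lattice_polytope_def polytope_def by blast

lemma convex_P: "convex P" and compact_P: "compact P" and polyhedron_P: "polyhedron P"
  using polytope_P polytope_imp_convex polytope_imp_compact polytope_imp_polyhedron by blast+

lemma P_eq: "P = convex hull vertices"
  unfolding vertices_def by (rule Krein_Milman_Minkowski[OF compact_P convex_P])

lemma finite_vertices: "finite vertices"
  unfolding vertices_def using polytope_P finite_polyhedron_extreme_points polyhedron_P by blast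

lemma vertices_subset: "vertices \<subseteq> P"
  by (auto simp: vertices_def extreme_point_of_def)

lemma primitive_vertices: "v \<in> vertices \<Longrightarrow> primitive v"
  using fano by (simp add: fano_polygon_def vertices_def)

lemma aff_dim_P: "aff_dim P = 2"
  using fano by (simp add: fano_polygon_def)

lemma zero_interior: "0 \<in> interior P"
  using fano by (simp add: fano_polygon_def)

lemma inner_ge_P:
  assumes "\<And>v. v \<in> vertices \<Longrightarrow> n \<bullet> v \<ge> c" "x \<in> P"
  shows "n \<bullet> x \<ge> c"
proof -
  have "convex hull vertices \<subseteq> {x. n \<bullet> x \<ge> c}"
    using assms(1) by (intro hull_minimal) (auto simp: convex_halfspace_ge)
  then show ?thesis using assms(2) P_eq by auto
qed

text \<open>With the origin in the interior every supporting line stays away from it. This allows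
  the functional exposing a face to be scaled to the value -1 there.\<close>

lemma supporting_pos:
  assumes "a \<noteq> 0" "\<And>x. x \<in> P \<Longrightarrow> a \<bullet> x \<le> b"
  shows "b > 0"
proof -
  obtain e where e: "e > 0" "ball 0 e \<subseteq> P" using zero_interior mem_interior by blast
  have "(e / 2 / norm a) *\<^sub>R a \<in> ball 0 e" using assms(1) e(1) by simp
  then have "a \<bullet> ((e / 2 / norm a) *\<^sub>R a) \<le> b" using e assms(2) by blast
  moreover have "a \<bullet> ((e / 2 / norm a) *\<^sub>R a) > 0" using assms(1) e(1) by simp
  ultimately show ?thesis by linarith
qed

lemma supporting_functional:
  assumes "F face_of P" "F \<noteq> {}" "F \<noteq> P"
  obtains n where "\<And>x. x \<in> P \<Longrightarrow> n \<bullet> x \<ge> -1" "F = P \<inter> {x. n \<bullet> x = -1}"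
proof -
  have "F exposed_face_of P" using exposed_face_of_polyhedron[OF polyhedron_P] assms(1) by blast
  then obtain a b where ab: "a \<noteq> 0" "P \<subseteq> {x. a \<bullet> x \<le> b}" "F = P \<inter> {x. a \<bullet> x = b}"
    using assms unfolding exposed_face_of by blast
  have b: "b > 0" by (rule supporting_pos[OF ab(1)]) (use ab(2) in auto)
  show ?thesis
  proof
    show "((- 1 / b) *\<^sub>R a) \<bullet> x \<ge> -1" if "x \<in> P" for x
      using that ab(2) b by (auto simp: field_simps)
    show "F = P \<inter> {x. ((- 1 / b) *\<^sub>R a) \<bullet> x = -1}"
      using ab(3) b by (auto simp: field_simps)
  qed
qed

section \<open>Oriented edges and their cyclic order\<close>

definition edges :: "(real ^ 2) set set" where
  "edges = {E. E edge_of P}"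

text \<open>The positive determinant orders the end points counterclockwise, and \<open>n\<close> is
  the vertex of the dual polygon that corresponds to the edge.\<close>

definition edge_data :: "(real ^ 2) set \<Rightarrow> real ^ 2 \<Rightarrow> real ^ 2 \<Rightarrow> real ^ 2 \<Rightarrow> bool" where
  "edge_data E n x y \<longleftrightarrow> E = closed_segment x y \<and> x \<in> vertices \<and> y \<in> vertices \<and> cross2 x y > 0 \<and>
    (\<forall>v\<in>P. n \<bullet> v \<ge> -1) \<and> E = P \<inter> {v. n \<bullet> v = -1}"

lemma edge_data_exists:
  assumes "E \<in> edges"
  shows "\<exists>n x y. edge_data E n x y"
proof -
  have E: "E face_of P" "aff_dim E = 1" using assms by (auto simp: edges_def edge_of_def)
  have ne: "E \<noteq> {}" "E \<noteq> P" using E(2) aff_dim_P by auto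
  obtain n where n: "\<And>x. x \<in> P \<Longrightarrow> n \<bullet> x \<ge> -1" "E = P \<inter> {x. n \<bullet> x = -1}"
    using supporting_functional[OF E(1) ne] by metis
  have cc: "compact E" "convex E" using E(1) face_of_imp_compact compact_P convex_P face_of_imp_convex by blast+
  have "collinear E" using E(2) by (simp add: collinear_aff_dim)
  then obtain x y where xy: "E = closed_segment x y"
    using compact_convex_collinear_segment[OF ne(1) cc] by metis
  have "x \<noteq> y" using E(2) xy by auto
  have ext: "x extreme_point_of E" "y extreme_point_of E" unfolding xy extreme_point_of_segment by auto
  then have vertices: "x \<in> vertices" "y \<in> vertices" using extreme_point_of_face[OF E(1)] by (auto simp: vertices_def)
  have "n \<bullet> x = -1" "n \<bullet> y = -1" using n(2) xy by auto
  then have "cross2 x y \<noteq> 0" using cross2_zero_imp_eq \<open>x \<noteq> y\<close> by blast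
  then consider "cross2 x y > 0" | "cross2 y x > 0" using cross2_swap[of x y] by linarith
  then show ?thesis
  proof cases
    case 1
    then have "edge_data E n x y" using n vertices xy unfolding edge_data_def by blast
    then show ?thesis by blast
  next
    case 2
    then have "edge_data E n y x" using n vertices xy unfolding edge_data_def by (metis closed_segment_commute)
    then show ?thesis by blast
  qed
qed

definition edge_normal where "edge_normal E = (SOME n. \<exists>x y. edge_data E n x y)"
definition edge_start where "edge_start E = (SOME x. \<exists>y. edge_data E (edge_normal E) x y)"
definition edge_end where "edge_end E = (SOME y. edge_data E (edge_normal E) (edge_start E) y)"

lemma edge_data:
  assumes "E \<in> edges"
  shows "edge_data E (edge_normal E) (edge_start E) (edge_end E)"
proof -
  have "\<exists>x y. edge_data E (edge_normal E) x y"
    unfolding edge_normal_def by (rule someI_ex) (rule edge_data_exists[OF assms])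
  then have "\<exists>y. edge_data E (edge_normal E) (edge_start E) y" unfolding edge_start_def by (rule someI_ex)
  then show ?thesis unfolding edge_end_def by (rule someI_ex)
qed

lemma edgeD:
  assumes "E \<in> edges"
  shows "E = closed_segment (edge_start E) (edge_end E)" "edge_start E \<in> vertices" "edge_end E \<in> vertices" "cross2 (edge_start E) (edge_end E) > 0"
    "\<And>v. v \<in> P \<Longrightarrow> edge_normal E \<bullet> v \<ge> -1" "E = P \<inter> {v. edge_normal E \<bullet> v = -1}"
    "edge_normal E \<bullet> edge_start E = -1" "edge_normal E \<bullet> edge_end E = -1"
proof -
  note D = edge_data[OF assms, unfolded edge_data_def]
  show "E = closed_segment (edge_start E) (edge_end E)" "edge_start E \<in> vertices" "edge_end E \<in> vertices" "cross2 (edge_start E) (edge_end E) > 0"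
    "\<And>v. v \<in> P \<Longrightarrow> edge_normal E \<bullet> v \<ge> -1" "E = P \<inter> {v. edge_normal E \<bullet> v = -1}" using D by blast+
  have "edge_start E \<in> E" "edge_end E \<in> E" using D by (metis ends_in_segment)+
  then show "edge_normal E \<bullet> edge_start E = -1" "edge_normal E \<bullet> edge_end E = -1" using D by blast+
qed

lemma finite_edges: "finite edges"
proof (rule finite_subset)
  show "edges \<subseteq> {F. F face_of P}" by (auto simp: edges_def edge_of_def)
  show "finite {F. F face_of P}" by (rule finite_polytope_faces[OF polytope_P])
qed

lemma vertex_in_edge:
  assumes "E \<in> edges" "v \<in> vertices" "edge_normal E \<bullet> v = -1"
  shows "v = edge_start E \<or> v = edge_end E"
proof -
  have "E face_of P" using assms(1) by (simp add: edges_def edge_of_def)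
  moreover have "v \<in> E" using assms vertices_subset edgeD(6)[OF assms(1)] by auto
  ultimately have "v extreme_point_of E" using extreme_point_of_face assms(2) by (auto simp: vertices_def)
  then show ?thesis using edgeD(1)[OF assms(1)] extreme_point_of_segment by metis
qed

lemma edge_normal_inj: "E \<in> edges \<Longrightarrow> E' \<in> edges \<Longrightarrow> edge_normal E = edge_normal E' \<Longrightarrow> E = E'"
  using edgeD(6) by metis

lemma vertices_nonzero: "v \<in> vertices \<Longrightarrow> v \<noteq> 0"
  using primitive_vertices unfolding primitive_def by (force simp: vec2_eq_iff)

text \<open>Both normals are -1 at \<open>v\<close>, so they differ by
  \<open>c *\<^sub>R rot v\<close>. Each is at least -1 at the vertex of the other edge, and for
  \<open>w\<close>, \<open>w'\<close> on the same side of \<open>v\<close> this bounds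
  \<open>c\<close> from both sides by 0.\<close>

lemma edge_unique:
  assumes E: "E \<in> edges" "E' \<in> edges" and v: "v \<in> vertices" "w \<in> vertices" "w' \<in> vertices"
    and n: "edge_normal E \<bullet> v = -1" "edge_normal E' \<bullet> v = -1" "edge_normal E \<bullet> w = -1" "edge_normal E' \<bullet> w' = -1"
    and s: "cross2 v w * cross2 v w' > 0"
  shows "E = E'"
proof -
  have "(edge_normal E - edge_normal E') \<bullet> v = 0" using n by (simp add: inner_diff_left)
  then obtain c where c: "edge_normal E - edge_normal E' = c *\<^sub>R rot v" using orthogonal_rot vertices_nonzero[OF v(1)] by blast
  have "edge_normal E \<bullet> w' \<ge> -1" "edge_normal E' \<bullet> w \<ge> -1" using edgeD(5) E v vertices_subset by blast+
  then have "(edge_normal E - edge_normal E') \<bullet> w' \<ge> 0" "(edge_normal E - edge_normal E') \<bullet> w \<le> 0" using n by (simp_all add: inner_diff_left)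
  then have *: "c * cross2 v w' \<ge> 0" "c * cross2 v w \<le> 0" unfolding c by (simp_all add: inner_rot)
  have "c = 0"
  proof (rule ccontr)
    assume "c \<noteq> 0"
    have "(c * c) * (cross2 v w * cross2 v w') = (c * cross2 v w) * (c * cross2 v w')" by simp
    also have "\<dots> \<le> 0" using * by (simp add: mult_nonpos_nonneg)
    finally show False using s \<open>c \<noteq> 0\<close> by (metis mult_pos_pos not_le not_real_square_gt_zero)
  qed
  then show ?thesis using edge_normal_inj[OF E] c by simp
qed

lemma edge_start_inj: "inj_on edge_start edges"
proof (rule inj_onI)
  fix E E' assume E: "E \<in> edges" "E' \<in> edges" "edge_start E = edge_start E'"
  show "E = E'"
  proof (rule edge_unique[OF E(1,2)])
    show "edge_start E \<in> vertices" "edge_end E \<in> vertices" "edge_end E' \<in> vertices" "edge_normal E \<bullet> edge_start E = -1" "edge_normal E' \<bullet> edge_start E = -1"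
      "edge_normal E \<bullet> edge_end E = -1" "edge_normal E' \<bullet> edge_end E' = -1"
      using edgeD(2,3,7,8)[OF E(1)] edgeD(2,3,7,8)[OF E(2)] E(3) by simp_all
    show "cross2 (edge_start E) (edge_end E) * cross2 (edge_start E) (edge_end E') > 0"
      using edgeD(4)[OF E(1)] edgeD(4)[OF E(2)] E(3) by simp
  qed
qed

lemma edge_end_inj: "inj_on edge_end edges"
proof (rule inj_onI)
  fix E E' assume E: "E \<in> edges" "E' \<in> edges" "edge_end E = edge_end E'"
  show "E = E'"
  proof (rule edge_unique[OF E(1,2)])
    show "edge_end E \<in> vertices" "edge_start E \<in> vertices" "edge_start E' \<in> vertices" "edge_normal E \<bullet> edge_end E = -1" "edge_normal E' \<bullet> edge_end E = -1"
      "edge_normal E \<bullet> edge_start E = -1" "edge_normal E' \<bullet> edge_start E' = -1"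
      using edgeD(2,3,7,8)[OF E(1)] edgeD(2,3,7,8)[OF E(2)] E(3) by simp_all
    show "cross2 (edge_end E) (edge_start E) * cross2 (edge_end E) (edge_start E') > 0"
      using edgeD(4)[OF E(1)] edgeD(4)[OF E(2)] E(3) cross2_swap[of "edge_start E" "edge_end E"] cross2_swap[of "edge_start E'" "edge_end E"]
      by (simp add: mult_neg_neg)
  qed
qed

lemma edge_of_functional:
  assumes nP: "\<And>x. x \<in> P \<Longrightarrow> n \<bullet> x \<ge> -1" and v: "v \<in> vertices" "w \<in> vertices" "v \<noteq> w"
    and n: "n \<bullet> v = -1" "n \<bullet> w = -1"
  shows "P \<inter> {x. n \<bullet> x = -1} \<in> edges"
proof -
  define E where "E = P \<inter> {x. n \<bullet> x = -1}"
  have "n \<noteq> 0" using n by auto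
  have "E face_of P" unfolding E_def by (rule face_of_Int_supporting_hyperplane_ge[OF convex_P nP])
  moreover have "aff_dim E = 1"
  proof (rule antisym)
    have "aff_dim E \<le> aff_dim {x. n \<bullet> x = -1}" by (rule aff_dim_subset) (auto simp: E_def)
    then show "aff_dim E \<le> 1" using \<open>n \<noteq> 0\<close> by simp
    have "{v, w} \<subseteq> E" using v n vertices_subset by (auto simp: E_def)
    then have "aff_dim {v, w} \<le> aff_dim E" by (rule aff_dim_subset)
    then show "1 \<le> aff_dim E" using v(3) by simp
  qed
  ultimately show ?thesis by (simp add: edges_def edge_of_def E_def)
qed

text \<open>A functional exposing \<open>v\<close> is tilted along \<open>rot v\<close>, which keeps
  its value at \<open>v\<close>, until a vertex counterclockwise from \<open>v\<close> becomes
  tight.\<close>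

lemma ex_next_edge:
  assumes v: "v \<in> vertices"
  shows "\<exists>E\<in>edges. edge_start E = v"
proof -
  have vf: "{v} face_of P" using v by (simp add: vertices_def face_of_singleton)
  have "{v} \<noteq> P" using aff_dim_P by auto
  then obtain m where m: "\<And>x. x \<in> P \<Longrightarrow> m \<bullet> x \<ge> -1" "{v} = P \<inter> {x. m \<bullet> x = -1}"
    using supporting_functional[OF vf] by blast
  have mv: "m \<bullet> v = -1" using m(2) by auto
  have mw: "m \<bullet> w > -1" if "w \<in> vertices" "w \<noteq> v" for w
  proof -
    have "m \<bullet> w \<ge> -1" "m \<bullet> w \<noteq> -1" using m that vertices_subset by auto
    then show ?thesis by simp
  qed
  define W where "W = {w\<in>vertices. cross2 v w > 0}"
  have finW: "finite W" using finite_vertices by (simp add: W_def)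
  \<comment> \<open>Otherwise the polygon would lie on one side of the line through \<open>v\<close>
    and the origin.\<close>
  have "W \<noteq> {}"
  proof
    assume "W = {}"
    then have "cross2 v w \<le> 0" if "w \<in> vertices" for w using that by (auto simp: W_def not_less)
    then have "- rot v \<bullet> w \<ge> 0" if "w \<in> vertices" for w using that by (simp add: inner_rot)
    then have "- rot v \<bullet> x \<ge> 0" if "x \<in> P" for x by (rule inner_ge_P[OF _ that])
    then have "rot v \<bullet> x \<le> 0" if "x \<in> P" for x using that by fastforce
    moreover have "rot v \<noteq> 0" using vertices_nonzero[OF v] by (auto simp: vec2_eq_iff)
    ultimately have "(0::real) > 0" using supporting_pos[of "rot v" 0] by blast
    then show False by simp
  qed
  \<comment> \<open>The tilt at which \<open>w\<close> becomes tight. On \<open>W\<close> all tilts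
    are negative, so the largest is the first one met.\<close>
  define t where "t w = (-1 - m \<bullet> w) / cross2 v w" for w
  have "Max (t ` W) \<in> t ` W" using finW \<open>W \<noteq> {}\<close> by (intro Max_in) auto
  then obtain w where w: "w \<in> W" "t w = Max (t ` W)" by (metis imageE)
  have tmax: "t u \<le> t w" if "u \<in> W" for u unfolding w(2) using finW that by simp
  have wV: "w \<in> vertices" "cross2 v w > 0" using w by (auto simp: W_def)
  have "w \<noteq> v" using wV by auto
  have tneg: "t w < 0" using mw[OF wV(1) \<open>w \<noteq> v\<close>] wV(2) by (simp add: t_def divide_neg_pos)
  define n where "n = m + t w *\<^sub>R rot v"
  have nx: "n \<bullet> x = m \<bullet> x + t w * cross2 v x" for x by (simp add: n_def inner_add_left inner_rot)
  have nv: "n \<bullet> v = -1" using mv by (simp add: nx)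
  have nw: "n \<bullet> w = -1" using wV(2) by (simp add: nx t_def)
  have nV: "n \<bullet> u \<ge> -1" if "u \<in> vertices" for u
  proof (cases "cross2 v u > 0")
    case True
    then have "t u \<le> t w" using tmax that by (simp add: W_def)
    then have "t u * cross2 v u \<le> t w * cross2 v u" using True by (intro mult_right_mono) auto
    moreover have "t u * cross2 v u = -1 - m \<bullet> u" using True by (simp add: t_def)
    ultimately show ?thesis by (simp add: nx)
  next
    case False
    then have "t w * cross2 v u \<ge> 0" using tneg by (simp add: mult_nonpos_nonpos)
    moreover have "m \<bullet> u \<ge> -1" using m(1) that vertices_subset by blast
    ultimately show ?thesis by (simp add: nx)
  qed
  have nP: "n \<bullet> x \<ge> -1" if "x \<in> P" for x using nV that by (rule inner_ge_P)
  define E where "E = P \<inter> {x. n \<bullet> x = -1}"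
  have E: "E \<in> edges" unfolding E_def by (rule edge_of_functional[OF nP v wV(1) \<open>w \<noteq> v\<close>[symmetric] nv nw])
  have "v \<in> E" "w \<in> E" using v wV nv nw vertices_subset by (auto simp: E_def)
  then have "edge_normal E \<bullet> v = -1" "edge_normal E \<bullet> w = -1" using edgeD(6)[OF E] by auto
  then have "v = edge_start E \<or> v = edge_end E" "w = edge_start E \<or> w = edge_end E" using vertex_in_edge[OF E] v wV by blast+
  moreover have "\<not> cross2 (edge_end E) (edge_start E) > 0" using edgeD(4)[OF E] cross2_swap[of "edge_end E" "edge_start E"] by linarith
  ultimately have "edge_start E = v" using wV(2) \<open>w \<noteq> v\<close> by auto
  then show ?thesis using E by blast
qed

lemma bij_edge_start: "bij_betw edge_start edges vertices"
proof -
  have "edge_start ` edges = vertices" using ex_next_edge edgeD(2) by blast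
  then show ?thesis using edge_start_inj by (simp add: bij_betw_def)
qed

lemma bij_edge_end: "bij_betw edge_end edges vertices"
proof -
  have "edge_end ` edges = vertices"
  proof (rule card_subset_eq[OF finite_vertices])
    show "edge_end ` edges \<subseteq> vertices" using edgeD(3) by blast
    show "card (edge_end ` edges) = card vertices" using card_image[OF edge_end_inj] bij_betw_same_card[OF bij_edge_start] by simp
  qed
  then show ?thesis using edge_end_inj by (simp add: bij_betw_def)
qed

end

section \<open>The Ehrhart quasi-polynomial of the dual polygon\<close>

lemma int_lattice_iff: "v \<in> int_lattice \<longleftrightarrow> v $ 1 \<in> \<int> \<and> v $ 2 \<in> \<int>"
  by (simp add: int_lattice_def forall_2)

lemma int_lattice_inner: "u \<in> int_lattice \<Longrightarrow> v \<in> int_lattice \<Longrightarrow> u \<bullet> v \<in> \<int>"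
  by (simp add: int_lattice_iff inner2)

lemma int_lattice_cross2: "u \<in> int_lattice \<Longrightarrow> v \<in> int_lattice \<Longrightarrow> cross2 u v \<in> \<int>"
  by (simp add: int_lattice_iff cross2_def)

lemma int_lattice_rot: "u \<in> int_lattice \<Longrightarrow> rot u \<in> int_lattice"
  by (simp add: int_lattice_iff)

lemma int_lattice_add: "u \<in> int_lattice \<Longrightarrow> v \<in> int_lattice \<Longrightarrow> u + v \<in> int_lattice"
  by (simp add: int_lattice_iff)

lemma int_lattice_diff: "u \<in> int_lattice \<Longrightarrow> v \<in> int_lattice \<Longrightarrow> u - v \<in> int_lattice"
  by (simp add: int_lattice_iff)

lemma int_lattice_scale: "c \<in> \<int> \<Longrightarrow> u \<in> int_lattice \<Longrightarrow> c *\<^sub>R u \<in> int_lattice"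
  by (simp add: int_lattice_iff)

lemma primitive_int_lattice: "primitive v \<Longrightarrow> v \<in> int_lattice"
  by (auto simp: primitive_def int_lattice_iff)

lemma primitive_dual_vector:
  assumes "primitive v"
  shows "\<exists>s\<in>int_lattice. s \<bullet> v = -1"
proof -
  obtain x y :: int where xy: "coprime x y" "v = vector [of_int x, of_int y]"
    using assms by (auto simp: primitive_def)
  obtain a b where ab: "a * x + b * y = 1" using bezout_int[of x y] xy(1) by auto
  define s :: "real ^ 2" where "s = vector [of_int (- a), of_int (- b)]"
  have "s \<bullet> v = of_int (- (a * x + b * y))" by (simp add: s_def inner2 xy(2))
  then have "s \<bullet> v = -1" using ab by simp
  moreover have "s \<in> int_lattice" by (simp add: s_def int_lattice_iff)
  ultimately show ?thesis by blast
qed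

lemma orthogonal_both_zero:
  assumes "w \<bullet> x = 0" "w \<bullet> y = 0" "cross2 x y \<noteq> 0"
  shows "w = 0"
proof -
  have "w $ 1 * cross2 x y = y $ 2 * (w \<bullet> x) - x $ 2 * (w \<bullet> y)"
    "w $ 2 * cross2 x y = x $ 1 * (w \<bullet> y) - y $ 1 * (w \<bullet> x)"
    by (simp_all add: inner2 cross2_def algebra_simps)
  then show ?thesis using assms by (simp add: vec2_eq_iff)
qed

text \<open>If \<open>s \<bullet> v = -1\<close> then \<open>s\<close> and \<open>rot v\<close> form a basis of the dual lattice.\<close>

lemma rot_coordinate_int:
  assumes "s \<in> int_lattice" "s \<bullet> v = -1" "c *\<^sub>R rot v \<in> int_lattice"
  shows "c \<in> \<int>"
proof -
  have "(c *\<^sub>R rot v) \<bullet> rot s = c * (s \<bullet> v)" by (simp add: inner2 algebra_simps)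
  then have "c = - ((c *\<^sub>R rot v) \<bullet> rot s)" using assms(2) by simp
  moreover have "(c *\<^sub>R rot v) \<bullet> rot s \<in> \<int>"
    by (rule int_lattice_inner[OF assms(3) int_lattice_rot[OF assms(1)]])
  ultimately show ?thesis by (metis Ints_minus)
qed

lemma lattice_line_coordinate:
  assumes "s \<in> int_lattice" "s \<bullet> v = -1" "v \<noteq> 0" "u \<in> int_lattice" "u \<bullet> v = - real k"
  obtains t :: int where "u = real k *\<^sub>R s + of_int t *\<^sub>R rot v"
proof -
  have "(u - real k *\<^sub>R s) \<bullet> v = 0" using assms by (simp add: inner_diff_left)
  then obtain c where c: "u - real k *\<^sub>R s = c *\<^sub>R rot v" using orthogonal_rot assms(3) by blast
  have "u - real k *\<^sub>R s \<in> int_lattice" by (intro int_lattice_diff int_lattice_scale assms) simp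
  then have "c \<in> \<int>" using rot_coordinate_int assms(1,2) c by metis
  then obtain t where "c = of_int t" by (auto elim: Ints_cases)
  then have "u = real k *\<^sub>R s + of_int t *\<^sub>R rot v" using c by (metis add.commute diff_add_cancel)
  then show ?thesis by (rule that)
qed

context fano
begin

text \<open>A lattice point on the line of the dual side belonging to \<open>v\<close>; its
  multiples are the base points for counting on the dilated sides.\<close>

definition foot :: "real ^ 2 \<Rightarrow> real ^ 2" where
  "foot v = (SOME s. s \<in> int_lattice \<and> s \<bullet> v = -1)"

lemma foot:
  assumes "v \<in> vertices"
  shows "foot v \<in> int_lattice" "foot v \<bullet> v = -1"
proof -
  have "\<exists>s. s \<in> int_lattice \<and> s \<bullet> v = -1" using primitive_dual_vector[OF primitive_vertices[OF assms]] by blast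
  then have "foot v \<in> int_lattice \<and> foot v \<bullet> v = -1" unfolding foot_def by (rule someI_ex)
  then show "foot v \<in> int_lattice" "foot v \<bullet> v = -1" by auto
qed

lemma vertices_int_lattice: "v \<in> vertices \<Longrightarrow> v \<in> int_lattice"
  using primitive_vertices primitive_int_lattice by blast

text \<open>The cone over \<open>E\<close> is the singularity \<open>1/R(1,a)\<close> with \<open>R = edge_index E\<close> and
  \<open>a = start_pairing E\<close>; \<open>end_pairing E\<close> is an inverse of \<open>a\<close> modulo \<open>R\<close>.\<close>

definition edge_index :: "(real ^ 2) set \<Rightarrow> int" where "edge_index E = \<lfloor>cross2 (edge_start E) (edge_end E)\<rfloor>"
definition start_pairing :: "(real ^ 2) set \<Rightarrow> int" where "start_pairing E = \<lfloor>foot (edge_end E) \<bullet> edge_start E\<rfloor>"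
definition end_pairing :: "(real ^ 2) set \<Rightarrow> int" where "end_pairing E = \<lfloor>foot (edge_start E) \<bullet> edge_end E\<rfloor>"

lemma edge_ints:
  assumes "E \<in> edges"
  shows "of_int (edge_index E) = cross2 (edge_start E) (edge_end E)" "of_int (start_pairing E) = foot (edge_end E) \<bullet> edge_start E"
    "of_int (end_pairing E) = foot (edge_start E) \<bullet> edge_end E" "edge_index E > 0"
proof -
  note D = edgeD[OF assms]
  have "cross2 (edge_start E) (edge_end E) \<in> \<int>" "foot (edge_end E) \<bullet> edge_start E \<in> \<int>" "foot (edge_start E) \<bullet> edge_end E \<in> \<int>"
    using D(2,3) vertices_int_lattice foot by (auto intro!: int_lattice_cross2 int_lattice_inner)
  then show "of_int (edge_index E) = cross2 (edge_start E) (edge_end E)" "of_int (start_pairing E) = foot (edge_end E) \<bullet> edge_start E"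
    "of_int (end_pairing E) = foot (edge_start E) \<bullet> edge_end E" unfolding edge_index_def start_pairing_def end_pairing_def by (simp_all add: Ints_def)
  then show "edge_index E > 0" using D(4) by (metis of_int_0_less_iff)
qed

text \<open>The values at the two end vertices determine the normal. The two forms give its
  position, as a corner of the dual polygon, on the two sides meeting there.\<close>

lemma edge_normal_eq:
  assumes E: "E \<in> edges"
  shows "edge_normal E = foot (edge_end E) + ((start_pairing E + 1) / edge_index E) *\<^sub>R rot (edge_end E)"
    "edge_normal E = foot (edge_start E) + (- (end_pairing E + 1) / edge_index E) *\<^sub>R rot (edge_start E)"
proof -
  note D = edgeD[OF E] and I = edge_ints[OF E]
  have R: "real_of_int (edge_index E) \<noteq> 0" using I(4) by simp
  have c: "cross2 (edge_end E) (edge_start E) = - of_int (edge_index E)" using I(1) cross2_swap[of "edge_end E" "edge_start E"] by simp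
  have "(edge_normal E - (foot (edge_end E) + ((start_pairing E + 1) / edge_index E) *\<^sub>R rot (edge_end E))) = 0"
  proof (rule orthogonal_both_zero)
    show "(edge_normal E - (foot (edge_end E) + ((start_pairing E + 1) / edge_index E) *\<^sub>R rot (edge_end E))) \<bullet> edge_start E = 0"
      using R by (simp add: inner_diff_left inner_add_left inner_rot D(7) I(2)[symmetric] c)
    show "(edge_normal E - (foot (edge_end E) + ((start_pairing E + 1) / edge_index E) *\<^sub>R rot (edge_end E))) \<bullet> edge_end E = 0"
      using foot(2)[OF D(3)] by (simp add: inner_diff_left inner_add_left inner_rot D(8))
  qed (use D(4) in simp)
  then show "edge_normal E = foot (edge_end E) + ((start_pairing E + 1) / edge_index E) *\<^sub>R rot (edge_end E)" by simp
  have "(edge_normal E - (foot (edge_start E) + (- (end_pairing E + 1) / edge_index E) *\<^sub>R rot (edge_start E))) = 0"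
  proof (rule orthogonal_both_zero)
    show "(edge_normal E - (foot (edge_start E) + (- (end_pairing E + 1) / edge_index E) *\<^sub>R rot (edge_start E))) \<bullet> edge_start E = 0"
      using foot(2)[OF D(2)] by (simp add: inner_diff_left inner_add_left inner_rot D(7))
    show "(edge_normal E - (foot (edge_start E) + (- (end_pairing E + 1) / edge_index E) *\<^sub>R rot (edge_start E))) \<bullet> edge_end E = 0"
      using R by (simp add: inner_diff_left inner_add_left inner_rot D(8) I(3)[symmetric] I(1)[symmetric])
  qed (use D(4) in simp)
  then show "edge_normal E = foot (edge_start E) + (- (end_pairing E + 1) / edge_index E) *\<^sub>R rot (edge_start E)" by simp
qed

text \<open>The planar Lagrange identity equates the determinant of the four pairings with a product
  of two \<open>cross2\<close> values, one of which is the index.\<close>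

lemma edge_inverse:
  assumes E: "E \<in> edges"
  shows "[start_pairing E * end_pairing E = 1] (mod edge_index E)"
proof -
  note D = edgeD[OF E] and I = edge_ints[OF E]
  have "cross2 (foot (edge_end E)) (foot (edge_start E)) \<in> \<int>" using D(2,3) foot by (intro int_lattice_cross2) auto
  then obtain c where c: "cross2 (foot (edge_end E)) (foot (edge_start E)) = of_int c" by (auto elim: Ints_cases)
  have "(foot (edge_end E) \<bullet> edge_end E) * (foot (edge_start E) \<bullet> edge_start E) - (foot (edge_end E) \<bullet> edge_start E) * (foot (edge_start E) \<bullet> edge_end E) =
      - cross2 (foot (edge_end E)) (foot (edge_start E)) * cross2 (edge_start E) (edge_end E)"
    by (simp add: inner2 cross2_def algebra_simps)
  then have "1 - real_of_int (start_pairing E) * of_int (end_pairing E) = - of_int c * of_int (edge_index E)"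
    using foot(2)[OF D(3)] foot(2)[OF D(2)] by (simp add: I(1-3) c)
  then have "real_of_int (start_pairing E * end_pairing E - 1) = of_int (c * edge_index E)" by simp
  then have "start_pairing E * end_pairing E - 1 = c * edge_index E" by linarith
  then show ?thesis by (simp add: cong_iff_dvd_diff)
qed

section \<open>Layers of lattice points between successive dilates\<close>

definition dilate :: "nat \<Rightarrow> (real ^ 2) set" where
  "dilate k = {u \<in> int_lattice. \<forall>v\<in>vertices. u \<bullet> v \<ge> - real k}"

text \<open>With \<open>E'\<close> the preceding edge, the side of the \<open>k\<close>-th dilate
  dual to the vertex \<open>edge_start E\<close>, half open: the corner at \<open>E\<close> is left
  to the next side.\<close>

definition assigned :: "nat \<Rightarrow> (real ^ 2) set \<Rightarrow> (real ^ 2) set \<Rightarrow> (real ^ 2) set" where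
  "assigned k E' E = {u \<in> int_lattice. u \<bullet> edge_start E = - real k \<and> u \<bullet> edge_end E > - real k \<and> u \<bullet> edge_start E' \<ge> - real k}"

definition prev_edge :: "(real ^ 2) set \<Rightarrow> (real ^ 2) set" where
  "prev_edge E = inv_into edges edge_end (edge_start E)"

lemma prev_edge:
  assumes "E \<in> edges"
  shows "prev_edge E \<in> edges" "edge_end (prev_edge E) = edge_start E"
proof -
  have "edge_start E \<in> edge_end ` edges" using bij_edge_end edgeD(2)[OF assms] by (simp add: bij_betw_def)
  then show "prev_edge E \<in> edges" "edge_end (prev_edge E) = edge_start E"
    unfolding prev_edge_def by (rule inv_into_into, rule f_inv_into_f)
qed

lemma bij_prev_edge: "bij_betw prev_edge edges edges"
proof -
  have "inj_on prev_edge edges" using edge_start_inj prev_edge(2) by (metis inj_on_def)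
  moreover have "prev_edge ` edges \<subseteq> edges" using prev_edge(1) by blast
  ultimately show ?thesis using finite_edges by (simp add: bij_betw_def endo_inj_surj)
qed

text \<open>The order of the two corners on their common side is read off at
  \<open>edge_end E\<close>, where \<open>edge_normal E\<close> is minimal. It keeps the floor
  difference in \<open>card_assigned\<close> from being negative.\<close>

lemma prev_next_order:
  assumes E: "E \<in> edges"
  shows "- (end_pairing E + 1) / edge_index E \<le> (start_pairing (prev_edge E) + 1) / edge_index (prev_edge E)"
proof -
  define x where "x = (start_pairing (prev_edge E) + 1) / edge_index (prev_edge E)"
  define y where "y = - (end_pairing E + 1) / edge_index E"
  note D = edgeD[OF E] and p = prev_edge[OF E]
  have "edge_normal (prev_edge E) = foot (edge_start E) + x *\<^sub>R rot (edge_start E)" using edge_normal_eq(1)[OF p(1)] p(2) by (simp add: x_def)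
  moreover have "edge_normal E = foot (edge_start E) + y *\<^sub>R rot (edge_start E)" unfolding y_def by (rule edge_normal_eq(2)[OF E])
  ultimately have d: "edge_normal (prev_edge E) - edge_normal E = (x - y) *\<^sub>R rot (edge_start E)" by (simp add: scaleR_diff_left)
  have "edge_normal (prev_edge E) \<bullet> edge_end E \<ge> -1" using edgeD(5)[OF p(1)] D(3) vertices_subset by blast
  then have "(edge_normal (prev_edge E) - edge_normal E) \<bullet> edge_end E \<ge> 0" using D(8) by (simp add: inner_diff_left)
  then have "(x - y) * cross2 (edge_start E) (edge_end E) \<ge> 0" unfolding d by (simp add: inner_rot)
  then have "x - y \<ge> 0" using D(4) by (simp add: zero_le_mult_iff)
  then show ?thesis by (simp add: x_def y_def)
qed

text \<open>Lattice points on the line of the side are \<open>k\<close> times the foot plus an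
  integer multiple of \<open>rot v\<close>. The corner at \<open>E\<close> bounds the multiplier
  strictly from below, the other corner weakly from above.\<close>

lemma card_assigned:
  assumes E: "E \<in> edges"
  shows "finite (assigned k (prev_edge E) E)"
    "int (card (assigned k (prev_edge E) E)) =
      \<lfloor>real k * ((start_pairing (prev_edge E) + 1) / edge_index (prev_edge E))\<rfloor> - \<lfloor>real k * (- (end_pairing E + 1) / edge_index E)\<rfloor>"
proof -
  define x where "x = (start_pairing (prev_edge E) + 1) / edge_index (prev_edge E)"
  define y where "y = - (end_pairing E + 1) / edge_index E"
  note D = edgeD[OF E] and p = prev_edge[OF E]
  note Dp = edgeD[OF p(1)]
  define v where "v = edge_start E"
  have v: "v \<in> vertices" "v \<noteq> 0" using D(2) vertices_nonzero by (auto simp: v_def)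
  have nx: "edge_normal (prev_edge E) = foot v + x *\<^sub>R rot v" using edge_normal_eq(1)[OF p(1)] p(2) by (simp add: x_def v_def)
  have ny: "edge_normal E = foot v + y *\<^sub>R rot v" unfolding y_def v_def by (rule edge_normal_eq(2)[OF E])
  define g where "g t = real k *\<^sub>R foot v + of_int t *\<^sub>R rot v" for t :: int
  have gl: "g t \<in> int_lattice" for t unfolding g_def
    using foot[OF v(1)] vertices_int_lattice[OF v(1)] by (intro int_lattice_add int_lattice_scale int_lattice_rot) auto
  have gv: "g t \<bullet> v = - real k" for t
    using foot(2)[OF v(1)] by (simp add: g_def inner_add_left inner_rot)
  have ge: "g t \<bullet> edge_end E > - real k \<longleftrightarrow> real k * y < of_int t" for t
  proof -
    have "g t = real k *\<^sub>R edge_normal E + (of_int t - real k * y) *\<^sub>R rot v" by (simp add: g_def ny algebra_simps)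
    then have "g t \<bullet> edge_end E = - real k + (of_int t - real k * y) * cross2 v (edge_end E)"
      by (simp add: inner_add_left inner_rot D(8))
    then show ?thesis using D(4) by (simp add: v_def zero_less_mult_iff)
  qed
  have gs: "g t \<bullet> edge_start (prev_edge E) \<ge> - real k \<longleftrightarrow> of_int t \<le> real k * x" for t
  proof -
    have "g t = real k *\<^sub>R edge_normal (prev_edge E) + (of_int t - real k * x) *\<^sub>R rot v" by (simp add: g_def nx algebra_simps)
    then have "g t \<bullet> edge_start (prev_edge E) = - real k - (of_int t - real k * x) * cross2 (edge_start (prev_edge E)) v"
      by (simp add: inner_add_left inner_rot Dp(7) cross2_swap[of v])
    moreover have "cross2 (edge_start (prev_edge E)) v > 0" using Dp(4) p(2) by (simp add: v_def)
    ultimately show ?thesis by (simp add: mult_le_0_iff)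
  qed
  have eq: "assigned k (prev_edge E) E = g ` {\<lfloor>real k * y\<rfloor><..\<lfloor>real k * x\<rfloor>}"
  proof (intro equalityI subsetI)
    fix u assume "u \<in> assigned k (prev_edge E) E"
    then have u: "u \<in> int_lattice" "u \<bullet> v = - real k" "u \<bullet> edge_end E > - real k" "u \<bullet> edge_start (prev_edge E) \<ge> - real k"
      by (auto simp: assigned_def v_def)
    obtain t where t: "u = g t"
      using lattice_line_coordinate[OF foot[OF v(1)] v(2) u(1,2)] unfolding g_def by metis
    then have "real k * y < of_int t" "of_int t \<le> real k * x" using u ge gs by auto
    then have "t \<in> {\<lfloor>real k * y\<rfloor><..\<lfloor>real k * x\<rfloor>}" by (simp add: floor_less_iff le_floor_iff)
    then show "u \<in> g ` {\<lfloor>real k * y\<rfloor><..\<lfloor>real k * x\<rfloor>}" using t by blast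
  next
    fix u assume "u \<in> g ` {\<lfloor>real k * y\<rfloor><..\<lfloor>real k * x\<rfloor>}"
    then obtain t where t: "u = g t" "\<lfloor>real k * y\<rfloor> < t" "t \<le> \<lfloor>real k * x\<rfloor>" by auto
    then have "real k * y < of_int t" "of_int t \<le> real k * x" by (simp_all add: floor_less_iff le_floor_iff)
    then show "u \<in> assigned k (prev_edge E) E" using t gl gv ge gs by (auto simp: assigned_def v_def)
  qed
  have "inj g"
  proof (rule injI)
    fix t t' assume "g t = g t'"
    then have "of_int t *\<^sub>R rot v = of_int t' *\<^sub>R rot v" by (simp add: g_def)
    moreover have "rot v \<noteq> 0" using v(2) by (auto simp: vec2_eq_iff)
    ultimately show "t = t'" by simp
  qed
  then have c: "card (assigned k (prev_edge E) E) = nat (\<lfloor>real k * x\<rfloor> - \<lfloor>real k * y\<rfloor>)"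
    unfolding eq by (simp add: card_image inj_on_subset)
  have "real k * y \<le> real k * x" using prev_next_order[OF E] by (intro mult_left_mono) (auto simp: x_def y_def)
  then have "\<lfloor>real k * y\<rfloor> \<le> \<lfloor>real k * x\<rfloor>" by (rule floor_mono)
  then show "int (card (assigned k (prev_edge E) E)) =
      \<lfloor>real k * ((start_pairing (prev_edge E) + 1) / edge_index (prev_edge E))\<rfloor> - \<lfloor>real k * (- (end_pairing E + 1) / edge_index E)\<rfloor>"
    using c by (simp add: x_def y_def)
  show "finite (assigned k (prev_edge E) E)" unfolding eq by simp
qed

end

lemma wave_period:
  assumes "cyclic_quotient s" "local_index s dvd N"
  shows "wave s (i + N) = wave s i"
proof -
  obtain c d where w: "\<And>i. wave s i = sawtooth (local_index s) (i * c) + sawtooth (local_index s) (i * d)"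
    using wave_reduced[OF assms(1)] by blast
  have "[i + N = i] (mod local_index s)"
    using assms(2) by (simp add: cong_add_lcancel_0_nat cong_0_iff del: local_index.simps)
  then show ?thesis unfolding w by (intro arg_cong2[where f = "(+)"] sawtooth_cong cong_scalar_right)
qed

lemma wave_odd:
  assumes "cyclic_quotient s" "local_index s dvd N" "i \<le> N"
  shows "wave s (N - i) = - wave s i"
proof -
  obtain c d where w: "\<And>i. wave s i = sawtooth (local_index s) (i * c) + sawtooth (local_index s) (i * d)"
    using wave_reduced[OF assms(1)] by blast
  have "sawtooth (local_index s) ((N - i) * e) = - sawtooth (local_index s) (i * e)" for e
  proof (rule sawtooth_neg[OF local_index_pos[OF assms(1)]])
    have "(N - i) * e + i * e = N * e" using assms(3) by (metis add_mult_distrib le_add_diff_inverse2)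
    moreover have "local_index s dvd N * e" using assms(2) by (rule dvd_mult2)
    ultimately show "[(N - i) * e + i * e = 0] (mod local_index s)" by (simp only: cong_0_iff)
  qed
  then show ?thesis unfolding w by simp
qed

lemma floor_sawtooth:
  fixes R m :: int and n :: nat
  assumes "R > 0" "[int n = m] (mod R)"
  shows "real_of_int \<lfloor>real_of_int m / real_of_int R\<rfloor> =
    m / R - sawtooth (nat R) n - (if R dvd m then 0 else 1 / 2)"
proof -
  have mod: "int (n mod nat R) = m mod R" using assms by (simp add: cong_def zmod_int)
  have dvd: "nat R dvd n \<longleftrightarrow> R dvd m"
  proof -
    have "nat R dvd n \<longleftrightarrow> n mod nat R = 0" by (simp add: dvd_eq_mod_eq_0)
    also have "\<dots> \<longleftrightarrow> m mod R = 0" using mod by linarith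
    finally show ?thesis by (simp add: dvd_eq_mod_eq_0)
  qed
  have "real_of_int m = real_of_int (m div R * R + m mod R)" by simp
  then have "real_of_int m / R = real_of_int (m div R) + real_of_int (m mod R) / R"
    using assms(1) by (simp only: of_int_add of_int_mult) (simp add: add_divide_distrib)
  moreover have "real (n mod nat R) = real_of_int (m mod R)" using mod by (metis of_int_of_nat_eq)
  moreover have "real (nat R) = real_of_int R" using assms(1) by simp
  ultimately show ?thesis unfolding floor_divide_of_int_eq sawtooth_def dvd by simp
qed

context fano
begin

definition edge_type :: "(real ^ 2) set \<Rightarrow> singularity" where
  "edge_type E = (nat (edge_index E), nat (start_pairing E mod edge_index E))"

lemma edge_type_inverse:
  assumes E: "E \<in> edges"
  shows "[nat (start_pairing E mod edge_index E) * nat (end_pairing E mod edge_index E) = 1] (mod nat (edge_index E))"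
proof -
  have R: "edge_index E > 0" by (rule edge_ints(4)[OF E])
  have "[start_pairing E mod edge_index E * (end_pairing E mod edge_index E) = start_pairing E * end_pairing E] (mod edge_index E)" by (simp add: cong_def mod_mult_eq)
  then have "[start_pairing E mod edge_index E * (end_pairing E mod edge_index E) = 1] (mod edge_index E)" using edge_inverse[OF E] by (rule cong_trans)
  moreover have "int (nat (start_pairing E mod edge_index E) * nat (end_pairing E mod edge_index E)) = start_pairing E mod edge_index E * (end_pairing E mod edge_index E)"
    using R by simp
  moreover have "int (nat (edge_index E)) = edge_index E" using R by simp
  ultimately show ?thesis by (metis cong_int_iff of_nat_1)
qed

lemma cyclic_quotient_edge_type:
  assumes "E \<in> edges"
  shows "cyclic_quotient (edge_type E)"
proof -
  have "coprime (nat (start_pairing E mod edge_index E)) (nat (edge_index E))"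
    using edge_type_inverse[OF assms] by (metis coprime_1_left coprime_mult_left_iff cong_imp_coprime cong_sym)
  then show ?thesis using edge_ints(4)[OF assms] by (simp add: edge_type_def coprime_commute)
qed

text \<open>Each floor is its argument minus a sawtooth minus a half, the half being absent at
  integers. These corrections agree at both ends, since the unit \<open>end_pairing E\<close> takes
  \<open>start_pairing E + 1\<close> to \<open>end_pairing E + 1\<close> modulo the index.\<close>

lemma floor_difference_wave:
  assumes E: "E \<in> edges"
  shows "real_of_int (\<lfloor>real k * ((start_pairing E + 1) / edge_index E)\<rfloor> - \<lfloor>real k * (- (end_pairing E + 1) / edge_index E)\<rfloor>) =
    real k * ((start_pairing E + end_pairing E + 2) / edge_index E) - wave (edge_type E) k"
proof -
  define R A B where "R = edge_index E" and "A = nat (start_pairing E mod R)" and "B = nat (end_pairing E mod R)"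
  have R: "R > 0" unfolding R_def by (rule edge_ints(4)[OF E])
  have A: "[int (k * (A + 1)) = int k * (start_pairing E + 1)] (mod R)"
    and B: "[int (k * (B + 1)) = int k * (end_pairing E + 1)] (mod R)"
  proof -
    have "int (k * (A + 1)) = int k * (start_pairing E mod R + 1)" "int (k * (B + 1)) = int k * (end_pairing E mod R + 1)"
      using R by (simp_all add: A_def B_def distrib_left)
    moreover have "[int k * (x mod R + 1) = int k * (x + 1)] (mod R)" for x
      by (intro cong_scalar_left cong_add) auto
    ultimately show "[int (k * (A + 1)) = int k * (start_pairing E + 1)] (mod R)"
      "[int (k * (B + 1)) = int k * (end_pairing E + 1)] (mod R)" by simp_all
  qed
  have nR: "nat R > 0" "int (nat R) = R" using R by auto
  have ab: "[A * B = 1] (mod nat R)" using edge_type_inverse[OF E] by (simp add: A_def B_def R_def)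
  have w: "wave (edge_type E) k = sawtooth (nat R) (k * (A + 1)) + sawtooth (nat R) (k * (B + 1))"
    using wave_eq[OF ab] by (simp add: edge_type_def R_def A_def B_def del: wave.simps)
  have B': "[int ((nat R - 1) * (k * (B + 1))) = - (int k * (end_pairing E + 1))] (mod R)"
  proof -
    have "[(nat R - 1) * (k * (B + 1)) + k * (B + 1) = 0] (mod nat R)" by (rule neg_cong[OF nR(1)])
    then have "[int ((nat R - 1) * (k * (B + 1))) + int (k * (B + 1)) = 0] (mod R)"
      using nR(2) by (metis cong_int_iff of_nat_0 of_nat_add)
    then have "[int ((nat R - 1) * (k * (B + 1))) + int (k * (B + 1)) - int (k * (B + 1)) = 0 - int k * (end_pairing E + 1)] (mod R)"
      using B by (rule cong_diff)
    then show ?thesis by simp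
  qed
  have s: "sawtooth (nat R) ((nat R - 1) * (k * (B + 1))) = - sawtooth (nat R) (k * (B + 1))"
    by (rule sawtooth_neg[OF nR(1) neg_cong[OF nR(1)]])
  have dvd: "R dvd - (int k * (end_pairing E + 1)) \<longleftrightarrow> R dvd int k * (start_pairing E + 1)"
  proof -
    have "[end_pairing E * (start_pairing E + 1) = end_pairing E + 1] (mod R)"
      using cong_add[OF edge_inverse[OF E] cong_refl[of "end_pairing E"]] by (simp add: R_def algebra_simps)
    then have "[int k * (end_pairing E * (start_pairing E + 1)) = int k * (end_pairing E + 1)] (mod R)" by (rule cong_scalar_left)
    then have "R dvd int k * (end_pairing E + 1) \<longleftrightarrow> R dvd int k * (end_pairing E * (start_pairing E + 1))"
      by (metis cong_dvd_iff)
    also have "\<dots> \<longleftrightarrow> R dvd end_pairing E * (int k * (start_pairing E + 1))" by (simp only: mult.left_commute)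
    also have "\<dots> \<longleftrightarrow> R dvd int k * (start_pairing E + 1)"
    proof -
      have "coprime (end_pairing E) R"
        using edge_inverse[OF E] unfolding R_def by (metis coprime_1_left coprime_mult_left_iff cong_imp_coprime cong_sym)
      then show ?thesis by (metis coprime_commute coprime_dvd_mult_right_iff)
    qed
    finally show ?thesis by (simp only: dvd_minus_iff)
  qed
  have f1: "real_of_int \<lfloor>real k * ((start_pairing E + 1) / edge_index E)\<rfloor> =
      real_of_int (int k * (start_pairing E + 1)) / R - sawtooth (nat R) (k * (A + 1)) - (if R dvd int k * (start_pairing E + 1) then 0 else 1 / 2)"
    using floor_sawtooth[OF R A] by (simp add: R_def)
  have f2: "real_of_int \<lfloor>real k * (- (end_pairing E + 1) / edge_index E)\<rfloor> =
      real_of_int (- (int k * (end_pairing E + 1))) / R + sawtooth (nat R) (k * (B + 1)) - (if R dvd int k * (start_pairing E + 1) then 0 else 1 / 2)"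
    using floor_sawtooth[OF R B'] unfolding s dvd by (simp add: R_def algebra_simps)
  show ?thesis unfolding of_int_diff f1 f2 w unfolding R_def[symmetric]
    by (simp add: add_divide_distrib diff_divide_distrib algebra_simps)
qed

lemma dilate_0: "dilate 0 = {0}"
proof (intro equalityI subsetI)
  fix u assume "u \<in> dilate 0"
  then have u: "u \<bullet> v \<ge> 0" if "v \<in> vertices" for v using that by (simp add: dilate_def)
  have "u \<bullet> x \<ge> 0" if "x \<in> P" for x using u that by (rule inner_ge_P)
  then have "- u \<bullet> x \<le> 0" if "x \<in> P" for x using that by simp
  then have "u = 0" using supporting_pos[of "- u" 0] by (metis less_irrefl neg_equal_0_iff_equal)
  then show "u \<in> {0}" by simp
qed (simp add: dilate_def int_lattice_iff)

text \<open>A point on the side is reached from the corner at \<open>E\<close> by a nonnegative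
  multiple of \<open>rot (edge_start E)\<close>, and from the other corner by a nonpositive one. For
  each vertex \<open>w\<close> the expression with the favourable sign is used.\<close>

lemma assigned_subset:
  assumes E: "E \<in> edges"
  shows "assigned k (prev_edge E) E \<subseteq> dilate k"
proof
  fix u assume "u \<in> assigned k (prev_edge E) E"
  then have u: "u \<in> int_lattice" "u \<bullet> edge_start E = - real k" "u \<bullet> edge_end E > - real k" "u \<bullet> edge_start (prev_edge E) \<ge> - real k"
    by (auto simp: assigned_def)
  note D = edgeD[OF E] and p = prev_edge[OF E]
  note Dp = edgeD[OF p(1)]
  have v0: "edge_start E \<noteq> 0" by (rule vertices_nonzero[OF D(2)])
  have np: "edge_normal (prev_edge E) \<bullet> edge_start E = -1" using Dp(8) p(2) by simp
  have "(u - real k *\<^sub>R edge_normal E) \<bullet> edge_start E = 0" using u D(7) by (simp add: inner_diff_left)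
  then obtain c where c: "u - real k *\<^sub>R edge_normal E = c *\<^sub>R rot (edge_start E)" using orthogonal_rot[OF _ v0] by metis
  have "(u - real k *\<^sub>R edge_normal E) \<bullet> edge_end E \<ge> 0" using u D(8) by (simp add: inner_diff_left)
  then have c0: "c \<ge> 0" using D(4) unfolding c by (simp add: inner_rot zero_le_mult_iff)
  have "(u - real k *\<^sub>R edge_normal (prev_edge E)) \<bullet> edge_start E = 0" using u np by (simp add: inner_diff_left)
  then obtain d where d: "u - real k *\<^sub>R edge_normal (prev_edge E) = d *\<^sub>R rot (edge_start E)" using orthogonal_rot[OF _ v0] by metis
  have "(u - real k *\<^sub>R edge_normal (prev_edge E)) \<bullet> edge_start (prev_edge E) \<ge> 0" using u Dp(7) by (simp add: inner_diff_left)
  moreover have "cross2 (edge_start E) (edge_start (prev_edge E)) < 0" using Dp(4) p(2) cross2_swap[of "edge_start E"] by simp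
  ultimately have d0: "d \<le> 0" unfolding d by (simp add: inner_rot zero_le_mult_iff)
  have "u \<bullet> w \<ge> - real k" if w: "w \<in> vertices" for w
  proof (cases "cross2 (edge_start E) w \<ge> 0")
    case True
    have "u \<bullet> w = real k * (edge_normal E \<bullet> w) + c * cross2 (edge_start E) w"
      using arg_cong[OF c, of "\<lambda>x. x \<bullet> w"] by (simp add: inner_diff_left inner_rot)
    moreover have "real k * (edge_normal E \<bullet> w) \<ge> real k * -1" using D(5) w vertices_subset by (intro mult_left_mono) auto
    ultimately show ?thesis using True c0 by (simp add: mult_nonneg_nonneg add_increasing2)
  next
    case False
    have "u \<bullet> w = real k * (edge_normal (prev_edge E) \<bullet> w) + d * cross2 (edge_start E) w"
      using arg_cong[OF d, of "\<lambda>x. x \<bullet> w"] by (simp add: inner_diff_left inner_rot)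
    moreover have "real k * (edge_normal (prev_edge E) \<bullet> w) \<ge> real k * -1" using Dp(5) w vertices_subset by (intro mult_left_mono) auto
    moreover have "d * cross2 (edge_start E) w \<ge> 0" using False d0 by (simp add: mult_nonpos_nonpos)
    ultimately show ?thesis by linarith
  qed
  then show "u \<in> dilate k" using u(1) by (simp add: dilate_def)
qed

lemma next_edge:
  assumes "E \<in> edges"
  obtains E' where "E' \<in> edges" "edge_start E' = edge_end E"
  using ex_next_edge[OF edgeD(3)[OF assms]] that by blast

text \<open>Each lattice point on the boundary of the dilated dual polygon is counted at the last vertex,
  in counterclockwise order, at which it attains its minimum.\<close>

lemma dilate_Suc:
  "dilate (Suc k) = dilate k \<union> (\<Union>E\<in>edges. assigned (Suc k) (prev_edge E) E)"
proof (intro equalityI subsetI)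
  fix u assume u: "u \<in> dilate (Suc k)"
  show "u \<in> dilate k \<union> (\<Union>E\<in>edges. assigned (Suc k) (prev_edge E) E)"
  proof (cases "u \<in> dilate k")
    case False
    have ul: "u \<in> int_lattice" and uV: "\<And>v. v \<in> vertices \<Longrightarrow> u \<bullet> v \<ge> - real (Suc k)" using u by (auto simp: dilate_def)
    obtain v where v: "v \<in> vertices" "\<not> u \<bullet> v \<ge> - real k" using False ul by (auto simp: dilate_def)
    have "u \<bullet> v \<in> \<int>" by (rule int_lattice_inner[OF ul vertices_int_lattice[OF v(1)]])
    then obtain z where z: "u \<bullet> v = of_int z" by (auto elim: Ints_cases)
    \<comment> \<open>Integrality of the vertex leaves a single value for the pairing: a lattice
      point new in this dilate lies on its boundary.\<close>
    have "z < - int k" "z \<ge> - int (Suc k)" using v(2) uV[OF v(1)] unfolding z by linarith+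
    then have uv: "u \<bullet> v = - real (Suc k)" using z by simp
    obtain E where E: "E \<in> edges" "edge_start E = v" using ex_next_edge[OF v(1)] by blast
    note D = edgeD[OF E(1)]
    have in_assigned: "u \<in> assigned (Suc k) (prev_edge F) F"
      if "F \<in> edges" "u \<bullet> edge_start F = - real (Suc k)" "u \<bullet> edge_end F > - real (Suc k)" for F
      using that ul uV edgeD(2)[OF prev_edge(1)[OF that(1)]] by (auto simp: assigned_def)
    show ?thesis
    proof (cases "u \<bullet> edge_end E > - real (Suc k)")
      case True
      then show ?thesis using in_assigned[OF E(1)] E uv by blast
    next
      case False
      then have ue: "u \<bullet> edge_end E = - real (Suc k)" using uV[OF D(3)] by simp
      have tight: "u = real (Suc k) *\<^sub>R edge_normal F" if F: "F \<in> edges" "u \<bullet> edge_start F = - real (Suc k)" "u \<bullet> edge_end F = - real (Suc k)" for F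
      proof -
        have "u - real (Suc k) *\<^sub>R edge_normal F = 0"
        proof (rule orthogonal_both_zero[of _ "edge_start F" "edge_end F"])
          show "(u - real (Suc k) *\<^sub>R edge_normal F) \<bullet> edge_start F = 0" "(u - real (Suc k) *\<^sub>R edge_normal F) \<bullet> edge_end F = 0"
            using F edgeD(7,8)[OF F(1)] by (simp_all add: inner_diff_left)
        qed (use edgeD(4)[OF F(1)] in simp)
        then show ?thesis by simp
      qed
      \<comment> \<open>Here \<open>u\<close> is the corner left out at \<open>E\<close>. The next
        side takes it, as a second tight end would force two distinct edges to share a
        normal.\<close>
      obtain F where F: "F \<in> edges" "edge_start F = edge_end E" using next_edge[OF E(1)] .
      have "u \<bullet> edge_end F > - real (Suc k)"
      proof (rule ccontr)
        assume "\<not> u \<bullet> edge_end F > - real (Suc k)"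
        then have "u \<bullet> edge_end F = - real (Suc k)" using uV[OF edgeD(3)[OF F(1)]] by simp
        then have "u = real (Suc k) *\<^sub>R edge_normal F" using tight F ue by simp
        moreover have "u = real (Suc k) *\<^sub>R edge_normal E" using tight E uv ue by simp
        ultimately have "edge_normal F = edge_normal E" by simp
        then have "F = E" using edge_normal_inj F E by blast
        then have "edge_start E = edge_end E" using F by simp
        then show False using D(4) by simp
      qed
      then show ?thesis using in_assigned[OF F(1)] F ue by auto
    qed
  qed simp
next
  fix u assume "u \<in> dilate k \<union> (\<Union>E\<in>edges. assigned (Suc k) (prev_edge E) E)"
  then show "u \<in> dilate (Suc k)" using assigned_subset by (fastforce simp: dilate_def)
qed

text \<open>A common point, scaled by \<open>1 / k\<close>, exposes an edge whose end points are the
  two start vertices. That edge is \<open>E\<close> or \<open>F\<close>, and its tight end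
  contradicts the strict inequality in \<open>assigned\<close>.\<close>

lemma assigned_disjoint:
  assumes E: "E \<in> edges" "F \<in> edges" "E \<noteq> F" and k: "k > 0"
  shows "assigned k (prev_edge E) E \<inter> assigned k (prev_edge F) F = {}"
proof (rule ccontr)
  assume "assigned k (prev_edge E) E \<inter> assigned k (prev_edge F) F \<noteq> {}"
  then obtain u where u: "u \<in> assigned k (prev_edge E) E" "u \<in> assigned k (prev_edge F) F" by blast
  define n where "n = (1 / real k) *\<^sub>R u"
  have d: "u \<in> dilate k" using assigned_subset[OF E(1)] u by blast
  have "n \<bullet> v \<ge> -1" if "v \<in> vertices" for v using d that k by (auto simp: dilate_def n_def field_simps)
  then have nP: "n \<bullet> x \<ge> -1" if "x \<in> P" for x using that by (rule inner_ge_P)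
  have ne: "edge_start E \<noteq> edge_start F" using edge_start_inj E by (auto dest: inj_onD)
  have n: "n \<bullet> edge_start E = -1" "n \<bullet> edge_start F = -1" "n \<bullet> edge_end E > -1" "n \<bullet> edge_end F > -1"
    using u k by (auto simp: assigned_def n_def field_simps)
  define G where "G = P \<inter> {x. n \<bullet> x = -1}"
  note vertices = edgeD(2)[OF E(1)] edgeD(2)[OF E(2)]
  have G: "G \<in> edges" unfolding G_def by (rule edge_of_functional[OF nP vertices ne n(1,2)])
  have "edge_start E \<in> G" "edge_start F \<in> G" using vertices n vertices_subset by (auto simp: G_def)
  then have "edge_normal G \<bullet> edge_start E = -1" "edge_normal G \<bullet> edge_start F = -1" using edgeD(6)[OF G] by auto
  then have "edge_start E = edge_start G \<or> edge_start E = edge_end G" "edge_start F = edge_start G \<or> edge_start F = edge_end G" using vertex_in_edge[OF G] vertices by blast+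
  then have "edge_start E = edge_start G \<and> edge_start F = edge_end G \<or> edge_start F = edge_start G \<and> edge_start E = edge_end G" using ne by auto
  then show False
  proof (elim disjE conjE)
    assume s: "edge_start E = edge_start G" "edge_start F = edge_end G"
    have "E = G" by (rule inj_onD[OF edge_start_inj s(1) E(1) G])
    then show False using n(2,3) s(2) by simp
  next
    assume s: "edge_start F = edge_start G" "edge_start E = edge_end G"
    have "F = G" by (rule inj_onD[OF edge_start_inj s(1) E(2) G])
    then show False using n(1,4) s(2) by simp
  qed
qed

lemma dilate_disjoint:
  assumes "E \<in> edges"
  shows "dilate k \<inter> assigned (Suc k) (prev_edge E) E = {}"
proof -
  have False if "u \<in> dilate k" "u \<in> assigned (Suc k) (prev_edge E) E" for u
  proof -
    have "u \<bullet> edge_start E \<ge> - real k" using that(1) edgeD(2)[OF assms] by (simp add: dilate_def)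
    moreover have "u \<bullet> edge_start E = - real (Suc k)" using that(2) by (simp add: assigned_def)
    ultimately show False by simp
  qed
  then show ?thesis by blast
qed

text \<open>The lattice length of the boundary of the dual polygon, regrouped from its sides to its
  corners, that is, to the edges of \<open>P\<close>.\<close>

definition perimeter :: real where
  "perimeter = (\<Sum>E\<in>edges. (start_pairing E + end_pairing E + 2) / edge_index E)"

lemma card_dilate:
  "finite (dilate k) \<and> real (card (dilate k)) =
    1 + perimeter * (real k * (real k + 1) / 2) - (\<Sum>i<k. \<Sum>E\<in>edges. wave (edge_type E) (Suc i))"
proof (induction k)
  case 0
  then show ?case by (simp add: dilate_0)
next
  case (Suc k)
  let ?U = "\<Union>E\<in>edges. assigned (Suc k) (prev_edge E) E"
  have fU: "finite ?U" using finite_edges card_assigned(1) by blast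
  have "card (dilate (Suc k)) = card (dilate k) + card ?U"
    unfolding dilate_Suc by (rule card_Un_disjoint) (use Suc fU dilate_disjoint in auto)
  also have "card ?U = (\<Sum>E\<in>edges. card (assigned (Suc k) (prev_edge E) E))"
    by (rule card_UN_disjoint) (use finite_edges card_assigned(1) assigned_disjoint in auto)
  finally have "real (card (dilate (Suc k))) = real (card (dilate k)) +
      (\<Sum>E\<in>edges. real_of_int (int (card (assigned (Suc k) (prev_edge E) E))))" by simp
  also have "(\<Sum>E\<in>edges. real_of_int (int (card (assigned (Suc k) (prev_edge E) E)))) =
      (\<Sum>E\<in>edges. real_of_int \<lfloor>real (Suc k) * ((start_pairing (prev_edge E) + 1) / edge_index (prev_edge E))\<rfloor> -
        real_of_int \<lfloor>real (Suc k) * (- (end_pairing E + 1) / edge_index E)\<rfloor>)"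
    by (rule sum.cong[OF refl]) (simp only: card_assigned(2) of_int_diff)
  also have "\<dots> = (\<Sum>E\<in>edges. real_of_int \<lfloor>real (Suc k) * ((start_pairing (prev_edge E) + 1) / edge_index (prev_edge E))\<rfloor>) -
      (\<Sum>E\<in>edges. real_of_int \<lfloor>real (Suc k) * (- (end_pairing E + 1) / edge_index E)\<rfloor>)"
    by (rule sum_subtractf)
  \<comment> \<open>Going once round the cycle of edges unites the two floors that belong to the
    same edge.\<close>
  also have "(\<Sum>E\<in>edges. real_of_int \<lfloor>real (Suc k) * ((start_pairing (prev_edge E) + 1) / edge_index (prev_edge E))\<rfloor>) =
      (\<Sum>E\<in>edges. real_of_int \<lfloor>real (Suc k) * ((start_pairing E + 1) / edge_index E)\<rfloor>)"
    by (rule sum.reindex_bij_betw[OF bij_prev_edge])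
  also have "\<dots> - (\<Sum>E\<in>edges. real_of_int \<lfloor>real (Suc k) * (- (end_pairing E + 1) / edge_index E)\<rfloor>) =
      (\<Sum>E\<in>edges. real (Suc k) * ((start_pairing E + end_pairing E + 2) / edge_index E) - wave (edge_type E) (Suc k))"
    unfolding sum_subtractf[symmetric] of_int_diff[symmetric]
    by (rule sum.cong[OF refl]) (rule floor_difference_wave)
  also have "\<dots> = real (Suc k) * perimeter - (\<Sum>E\<in>edges. wave (edge_type E) (Suc k))"
    by (simp only: perimeter_def sum_subtractf sum_distrib_left)
  finally have "real (card (dilate (Suc k))) = real (card (dilate k)) + (real (Suc k) * perimeter - (\<Sum>E\<in>edges. wave (edge_type E) (Suc k)))" .
  moreover have "finite (dilate (Suc k))" unfolding dilate_Suc using Suc fU by blast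
  ultimately show ?case using Suc by (simp add: field_simps)
qed

lemma zero_in_dual: "0 \<in> dual_polygon P"
  by (simp add: dual_polygon_def)

lemma ehrhart_dual: "ehrhart (dual_polygon P) k = card (dilate k)"
proof (cases "k = 0")
  case True
  have "(\<lambda>x. real k *\<^sub>R x) ` dual_polygon P \<inter> int_lattice = {0}"
    using zero_in_dual by (auto simp: True int_lattice_iff)
  then show ?thesis by (simp add: ehrhart_def dilate_0 True)
next
  case False
  have "(\<lambda>x. real k *\<^sub>R x) ` dual_polygon P \<inter> int_lattice = dilate k"
  proof (intro equalityI subsetI)
    fix u assume "u \<in> (\<lambda>x. real k *\<^sub>R x) ` dual_polygon P \<inter> int_lattice"
    then obtain x where x: "u = real k *\<^sub>R x" "\<forall>v\<in>P. x \<bullet> v \<ge> -1" "u \<in> int_lattice" by (auto simp: dual_polygon_def)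
    have "u \<bullet> v \<ge> - real k" if "v \<in> vertices" for v
    proof -
      have "real k * (x \<bullet> v) \<ge> real k * -1" using x(2) that vertices_subset by (intro mult_left_mono) auto
      then show ?thesis by (simp add: x(1))
    qed
    then show "u \<in> dilate k" using x(3) by (simp add: dilate_def)
  next
    fix u assume u: "u \<in> dilate k"
    define n where "n = (1 / real k) *\<^sub>R u"
    have "n \<bullet> v \<ge> -1" if "v \<in> vertices" for v using u that False by (auto simp: dilate_def n_def field_simps)
    then have "n \<bullet> x \<ge> -1" if "x \<in> P" for x using that by (rule inner_ge_P)
    then have "n \<in> dual_polygon P" by (simp add: dual_polygon_def)
    moreover have "u = real k *\<^sub>R n" using False by (simp add: n_def)
    ultimately show "u \<in> (\<lambda>x. real k *\<^sub>R x) ` dual_polygon P \<inter> int_lattice" using u by (auto simp: dilate_def)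
  qed
  then show ?thesis by (simp add: ehrhart_def)
qed

theorem quasi_polynomial_of_period_dual_iff:
  assumes p: "p > 0"
  shows "quasi_polynomial_of_period (ehrhart (dual_polygon P)) p \<longleftrightarrow>
    (\<forall>i. (\<Sum>E\<in>edges. wave (edge_type E) (i + p)) = (\<Sum>E\<in>edges. wave (edge_type E) i))"
proof -
  define N where "N = (\<Prod>E\<in>edges. local_index (edge_type E))"
  have N: "N > 0" unfolding N_def using local_index_pos cyclic_quotient_edge_type by (intro prod_pos) auto
  have d: "local_index (edge_type E) dvd N" if "E \<in> edges" for E
    unfolding N_def using finite_edges that by (intro dvd_prodI) auto
  show ?thesis
  proof (rule quasi_polynomial_of_period_iff[OF N _ _ _ p])
    show "(\<Sum>E\<in>edges. wave (edge_type E) (i + N)) = (\<Sum>E\<in>edges. wave (edge_type E) i)" for i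
      by (intro sum.cong refl wave_period cyclic_quotient_edge_type d)
    show "(\<Sum>E\<in>edges. wave (edge_type E) (N - i)) = - (\<Sum>E\<in>edges. wave (edge_type E) i)" if "i \<le> N" for i
      unfolding sum_negf[symmetric] using that by (intro sum.cong refl wave_odd cyclic_quotient_edge_type d)
    show "real (ehrhart (dual_polygon P) k) = 1 + perimeter * (real k * (real k + 1) / 2) -
        (\<Sum>i<k. \<Sum>E\<in>edges. wave (edge_type E) (Suc i))" for k
      using card_dilate by (simp add: ehrhart_dual)
  qed
qed

end

section \<open>The singularity of an edge\<close>

lemma convex_cone_hull_2:
  fixes x y :: "'a::real_vector"
  shows "convex_cone hull {x, y} = {\<alpha> *\<^sub>R x + \<beta> *\<^sub>R y | \<alpha> \<beta>. 0 \<le> \<alpha> \<and> 0 \<le> \<beta>}"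
proof (rule hull_unique)
  show "{x, y} \<subseteq> {\<alpha> *\<^sub>R x + \<beta> *\<^sub>R y | \<alpha> \<beta>. 0 \<le> \<alpha> \<and> 0 \<le> \<beta>}"
  proof -
    have "x = 1 *\<^sub>R x + 0 *\<^sub>R y" "y = 0 *\<^sub>R x + 1 *\<^sub>R y" by simp_all
    then show ?thesis by (smt (verit) insert_subset mem_Collect_eq empty_subsetI)
  qed
  show "convex_cone {\<alpha> *\<^sub>R x + \<beta> *\<^sub>R y | \<alpha> \<beta>. 0 \<le> \<alpha> \<and> 0 \<le> \<beta>}"
    unfolding convex_cone_iff
  proof (intro conjI ballI allI impI)
    show "0 \<in> {\<alpha> *\<^sub>R x + \<beta> *\<^sub>R y | \<alpha> \<beta>. 0 \<le> \<alpha> \<and> 0 \<le> \<beta>}"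
      by (intro CollectI exI[of _ 0]) simp
    fix u v assume "u \<in> {\<alpha> *\<^sub>R x + \<beta> *\<^sub>R y | \<alpha> \<beta>. 0 \<le> \<alpha> \<and> 0 \<le> \<beta>}" "v \<in> {\<alpha> *\<^sub>R x + \<beta> *\<^sub>R y | \<alpha> \<beta>. 0 \<le> \<alpha> \<and> 0 \<le> \<beta>}"
    then obtain a b c d where "u = a *\<^sub>R x + b *\<^sub>R y" "v = c *\<^sub>R x + d *\<^sub>R y" "0 \<le> a" "0 \<le> b" "0 \<le> c" "0 \<le> d" by auto
    then have "u + v = (a + c) *\<^sub>R x + (b + d) *\<^sub>R y" "0 \<le> a + c" "0 \<le> b + d" by (simp_all add: algebra_simps)
    then show "u + v \<in> {\<alpha> *\<^sub>R x + \<beta> *\<^sub>R y | \<alpha> \<beta>. 0 \<le> \<alpha> \<and> 0 \<le> \<beta>}" by blast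
  next
    fix u c assume "u \<in> {\<alpha> *\<^sub>R x + \<beta> *\<^sub>R y | \<alpha> \<beta>. 0 \<le> \<alpha> \<and> 0 \<le> \<beta>}" "(0::real) \<le> c"
    then obtain a b where "u = a *\<^sub>R x + b *\<^sub>R y" "0 \<le> a" "0 \<le> b" "0 \<le> c" by auto
    then have "c *\<^sub>R u = (c * a) *\<^sub>R x + (c * b) *\<^sub>R y" "0 \<le> c * a" "0 \<le> c * b" by (simp_all add: algebra_simps)
    then show "c *\<^sub>R u \<in> {\<alpha> *\<^sub>R x + \<beta> *\<^sub>R y | \<alpha> \<beta>. 0 \<le> \<alpha> \<and> 0 \<le> \<beta>}" by blast
  qed
  fix t assume t: "{x, y} \<subseteq> t" "convex_cone t"
  then show "{\<alpha> *\<^sub>R x + \<beta> *\<^sub>R y | \<alpha> \<beta>. 0 \<le> \<alpha> \<and> 0 \<le> \<beta>} \<subseteq> t" unfolding convex_cone_iff by auto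
qed

lemma conic_hull_segment: "conic hull (closed_segment x y) = convex_cone hull {x, y}"
proof -
  have z: "0 \<in> conic hull (closed_segment x y)"
    unfolding conic_hull_explicit by (intro CollectI exI[of _ 0] exI[of _ x]) auto
  have "(\<Union>v\<in>convex hull {x, y}. \<Union>c\<in>{0..}. {c *\<^sub>R v}) = conic hull (closed_segment x y)"
    unfolding segment_convex_hull conic_hull_explicit by auto
  then show ?thesis unfolding convex_cone_hull_convex_hull using insert_absorb[OF z] by simp
qed

lemma convex_cone_hull_2_image:
  fixes A :: "real ^ 2 ^ 2"
  shows "(*v) A ` (convex_cone hull {x, y}) = convex_cone hull {A *v x, A *v y}"
  by (subst convex_cone_hull_linear_image[symmetric]) (auto simp: matrix_vector_mul_linear)

text \<open>Pairing with dual lattice vectors shows that \<open>c\<close> and its inverse are both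
  integers.\<close>

lemma primitive_scale:
  assumes "primitive x" "primitive y" "y = c *\<^sub>R x" "c > 0"
  shows "y = x"
proof -
  obtain s where s: "s \<in> int_lattice" "s \<bullet> x = -1" using primitive_dual_vector[OF assms(1)] by blast
  obtain t where t: "t \<in> int_lattice" "t \<bullet> y = -1" using primitive_dual_vector[OF assms(2)] by blast
  have "s \<bullet> y = - c" "c * (t \<bullet> x) = -1" using s t assms(3) by simp_all
  moreover have "s \<bullet> y \<in> \<int>" "t \<bullet> x \<in> \<int>" using s t assms primitive_int_lattice int_lattice_inner by blast+
  ultimately obtain m n :: int where "- c = of_int m" "t \<bullet> x = of_int n" by (metis Ints_cases)
  then have c: "c = of_int (- m)" "c * of_int n = -1" using \<open>c * (t \<bullet> x) = -1\<close> by simp_all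
  then have "real_of_int (m * n) = of_int 1" by simp
  then have "m * n = 1" by (simp only: of_int_eq_iff)
  then have "m = -1" using c(1) assms(4) by (auto simp: zmult_eq_1_iff)
  then show ?thesis using c(1) assms(3) by simp
qed

lemma combination_unique:
  assumes "a *\<^sub>R x + b *\<^sub>R y = c *\<^sub>R x + d *\<^sub>R y" "cross2 x y \<noteq> 0"
  shows "a = c \<and> b = d"
proof -
  have "cross2 (a *\<^sub>R x + b *\<^sub>R y) y = a * cross2 x y" "cross2 (c *\<^sub>R x + d *\<^sub>R y) y = c * cross2 x y"
    "cross2 x (a *\<^sub>R x + b *\<^sub>R y) = b * cross2 x y" "cross2 x (c *\<^sub>R x + d *\<^sub>R y) = d * cross2 x y"
    by (simp_all add: cross2_def algebra_simps)
  then have "a * cross2 x y = c * cross2 x y" "b * cross2 x y = d * cross2 x y" using assms(1) by metis+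
  then show ?thesis using assms(2) by simp
qed

text \<open>A nonnegative matrix with nonnegative inverse is monomial.\<close>

lemma cone_generators_unique:
  assumes eq: "convex_cone hull {x, y} = convex_cone hull {x', y'}"
    and p: "primitive x" "primitive y" "primitive x'" "primitive y'"
    and c: "cross2 x y \<noteq> 0" "cross2 x' y' \<noteq> 0"
  shows "x = x' \<and> y = y' \<or> x = y' \<and> y = x'"
proof -
  have mem: "x \<in> convex_cone hull {x', y'}" "y \<in> convex_cone hull {x', y'}"
    "x' \<in> convex_cone hull {x, y}" "y' \<in> convex_cone hull {x, y}"
    by (simp_all add: eq[symmetric] hull_inc) (simp_all add: eq hull_inc)
  obtain a1 b1 where x: "x = a1 *\<^sub>R x' + b1 *\<^sub>R y'" "0 \<le> a1" "0 \<le> b1" using mem(1) unfolding convex_cone_hull_2 by blast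
  obtain a2 b2 where y: "y = a2 *\<^sub>R x' + b2 *\<^sub>R y'" "0 \<le> a2" "0 \<le> b2" using mem(2) unfolding convex_cone_hull_2 by blast
  obtain a3 b3 where x': "x' = a3 *\<^sub>R x + b3 *\<^sub>R y" "0 \<le> a3" "0 \<le> b3" using mem(3) unfolding convex_cone_hull_2 by blast
  obtain a4 b4 where y': "y' = a4 *\<^sub>R x + b4 *\<^sub>R y" "0 \<le> a4" "0 \<le> b4" using mem(4) unfolding convex_cone_hull_2 by blast
  have "1 *\<^sub>R x + 0 *\<^sub>R y = (a1 * a3 + b1 * a4) *\<^sub>R x + (a1 * b3 + b1 * b4) *\<^sub>R y"
  proof -
    have "x = a1 *\<^sub>R (a3 *\<^sub>R x + b3 *\<^sub>R y) + b1 *\<^sub>R (a4 *\<^sub>R x + b4 *\<^sub>R y)" using x(1) x'(1) y'(1) by metis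
    then show ?thesis by (simp add: algebra_simps)
  qed
  from combination_unique[OF this c(1)] have e1: "a1 * a3 + b1 * a4 = 1" "a1 * b3 + b1 * b4 = 0" by auto
  have "0 *\<^sub>R x + 1 *\<^sub>R y = (a2 * a3 + b2 * a4) *\<^sub>R x + (a2 * b3 + b2 * b4) *\<^sub>R y"
  proof -
    have "y = a2 *\<^sub>R (a3 *\<^sub>R x + b3 *\<^sub>R y) + b2 *\<^sub>R (a4 *\<^sub>R x + b4 *\<^sub>R y)" using y(1) x'(1) y'(1) by metis
    then show ?thesis by (simp add: algebra_simps)
  qed
  from combination_unique[OF this c(1)] have e2: "a2 * a3 + b2 * a4 = 0" "a2 * b3 + b2 * b4 = 1" by auto
  have z: "a1 * b3 = 0" "b1 * b4 = 0" "a2 * a3 = 0" "b2 * a4 = 0"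
    using e1(2) e2(1) x(2,3) y(2,3) x'(2,3) y'(2,3)
    by (simp_all add: add_nonneg_eq_0_iff)
  show ?thesis
  proof (cases "b3 = 0")
    case True
    then have "b4 \<noteq> 0" "b2 \<noteq> 0" using e2(2) by auto
    then have "b1 = 0" "a4 = 0" using z by auto
    then have "a1 \<noteq> 0" using e1(1) by auto
    have "a3 \<noteq> 0" using e1(1) \<open>b1 = 0\<close> by auto
    then have "a2 = 0" using z by auto
    have "x = a1 *\<^sub>R x'" "y = b2 *\<^sub>R y'" using x(1) y(1) \<open>b1 = 0\<close> \<open>a2 = 0\<close> by simp_all
    then show ?thesis using primitive_scale[OF p(3,1), of a1] primitive_scale[OF p(4,2), of b2] \<open>a1 \<noteq> 0\<close> \<open>b2 \<noteq> 0\<close> x y by auto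
  next
    case False
    then have "a1 = 0" using z by auto
    then have "b1 \<noteq> 0" "a4 \<noteq> 0" using e1(1) by auto
    then have "b2 = 0" "b4 = 0" using z by auto
    then have "a2 \<noteq> 0" using e2(2) by auto
    have "x = b1 *\<^sub>R y'" "y = a2 *\<^sub>R x'" using x(1) y(1) \<open>a1 = 0\<close> \<open>b2 = 0\<close> by simp_all
    then show ?thesis using primitive_scale[OF p(4,1), of b1] primitive_scale[OF p(3,2), of a2] \<open>b1 \<noteq> 0\<close> \<open>a2 \<noteq> 0\<close> x y by auto
  qed
qed

lemma matrix_vector_2:
  fixes A :: "real ^ 2 ^ 2"
  shows "(A *v v) $ i = A $ i $ 1 * v $ 1 + A $ i $ 2 * v $ 2"
  by (simp add: matrix_vector_mult_def sum_2)

text \<open>Bezout's identity gives a form without coordinates that can be carried along unimodular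
  maps.\<close>

lemma primitive_iff: "primitive v \<longleftrightarrow> v \<in> int_lattice \<and> (\<exists>s\<in>int_lattice. s \<bullet> v = -1)"
proof
  assume "v \<in> int_lattice \<and> (\<exists>s\<in>int_lattice. s \<bullet> v = -1)"
  then obtain s :: "real ^ 2" where v: "v $ 1 \<in> \<int>" "v $ 2 \<in> \<int>" "s $ 1 \<in> \<int>" "s $ 2 \<in> \<int>" "s $ 1 * v $ 1 + s $ 2 * v $ 2 = -1"
    by (auto simp: int_lattice_iff inner2)
  obtain x y a b :: int where i: "v $ 1 = of_int x" "v $ 2 = of_int y" "s $ 1 = of_int a" "s $ 2 = of_int b"
    using v(1-4) by (auto elim!: Ints_cases)
  have "real_of_int (a * x + b * y) = of_int (-1)" using v(5) unfolding i by simp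
  then have "(- a) * x + (- b) * y = 1" by (simp only: of_int_eq_iff)
  then have "coprime x y" by (metis coprimeI dvd_add dvd_mult2 dvd_mult mult.commute)
  moreover have "v = vector [of_int x, of_int y]" by (simp add: vec2_eq_iff i)
  ultimately show "primitive v" unfolding primitive_def by blast
qed (use primitive_int_lattice primitive_dual_vector in blast)

lemma det_cross2:
  fixes A :: "real ^ 2 ^ 2"
  shows "cross2 (A *v x) (A *v y) = det A * cross2 x y"
  by (simp add: cross2_def matrix_vector_2 det_2 algebra_simps)

lemma unimodular_int_lattice:
  assumes "unimodular A" "v \<in> int_lattice"
  shows "A *v v \<in> int_lattice"
  using assms by (simp add: unimodular_def int_lattice_iff matrix_vector_2)

lemma unimodular_primitive:
  assumes A: "unimodular A" and v: "primitive v"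
  shows "primitive (A *v v)"
proof -
  obtain s where s: "s \<in> int_lattice" "s \<bullet> v = -1" "v \<in> int_lattice" using v primitive_iff by blast
  have d: "det A = 1 \<or> det A = -1" and Ai: "A $ i $ j \<in> \<int>" for i j using A by (auto simp: unimodular_def)
  text \<open>\<open>s\<close> composed with the inverse of \<open>A\<close>, by Cramer's rule\<close>
  define t :: "real ^ 2" where "t = det A *\<^sub>R vector [s $ 1 * A $ 2 $ 2 - s $ 2 * A $ 2 $ 1, s $ 2 * A $ 1 $ 1 - s $ 1 * A $ 1 $ 2]"
  have "det A \<in> \<int>" using d by auto
  then have t: "t \<in> int_lattice" using s Ai by (simp add: t_def int_lattice_iff)
  have "t \<bullet> (A *v v) = det A * det A * (s \<bullet> v)"
    by (simp add: t_def inner2 matrix_vector_2 det_2 algebra_simps)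
  also have "\<dots> = -1" using d s by auto
  finally show ?thesis using t unimodular_int_lattice[OF A s(3)] primitive_iff by blast
qed

lemma cqs_cong:
  assumes "[a' = a] (mod R) \<or> [a * a' = 1] (mod R)"
  shows "cqs R a' = cqs R a"
proof -
  have "([b = a'] (mod R) \<or> [a' * b = 1] (mod R)) \<longleftrightarrow> ([b = a] (mod R) \<or> [a * b = 1] (mod R))" for b
    using assms
  proof
    assume e: "[a' = a] (mod R)"
    then have "[a' * b = a * b] (mod R)" by (rule cong_scalar_right)
    then show ?thesis using e by (meson cong_sym cong_trans)
  next
    assume e: "[a * a' = 1] (mod R)"
    then have e': "[a' * a = 1] (mod R)" by (simp add: mult.commute)
    have "[b = a'] (mod R) \<longleftrightarrow> [a * b = 1] (mod R)"
      using inverse_unique_cong[of a b R a'] e by (meson cong_scalar_left cong_trans)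
    moreover have "[a' * b = 1] (mod R) \<longleftrightarrow> [b = a] (mod R)"
      using inverse_unique_cong[of a' b R a] e' by (meson cong_scalar_left cong_trans)
    ultimately show ?thesis by blast
  qed
  then show ?thesis unfolding cqs_def by presburger
qed

lemma model_generators_primitive:
  assumes "R > 0" "coprime R a"
  shows "primitive (vector [0, 1])" "primitive (vector [real R, - real a])"
    "cross2 (vector [0, 1]) (vector [real R, - real a]) = - real R"
proof -
  show "primitive (vector [0, 1])" unfolding primitive_def by (intro exI[of _ 0] exI[of _ 1]) simp
  show "primitive (vector [real R, - real a])" unfolding primitive_def
    by (intro exI[of _ "int R"] exI[of _ "- int a"]) (use assms(2) in simp)
  show "cross2 (vector [0, 1]) (vector [real R, - real a]) = - real R" by (simp add: cross2_def)
qed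

text \<open>Lattice functionals that agree at \<open>x\<close> differ by an integer multiple of
  \<open>rot x\<close>, and \<open>rot x\<close> takes the value \<open>r\<close> at
  \<open>y\<close>.\<close>

lemma functional_cong:
  assumes s: "s \<in> int_lattice" "s \<bullet> x = -1" and t: "t \<in> int_lattice" "t \<bullet> x = -1"
    and x: "x \<in> int_lattice" "x \<noteq> 0"
    and v: "s \<bullet> y = of_int m" "t \<bullet> y = of_int n" "cross2 x y = of_int r"
  shows "[m = n] (mod r)"
proof -
  have "(s - t) \<bullet> x = 0" using s t by (simp add: inner_diff_left)
  then obtain c where c: "s - t = c *\<^sub>R rot x" using orthogonal_rot x(2) by blast
  have "c *\<^sub>R rot x \<in> int_lattice" using int_lattice_diff[OF s(1) t(1)] c by simp
  then have "c \<in> \<int>" using rot_coordinate_int s by blast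
  then obtain z where z: "c = of_int z" by (auto elim: Ints_cases)
  have "(s - t) \<bullet> y = c * cross2 x y" unfolding c by (simp add: inner_rot)
  then have "real_of_int (m - n) = of_int (z * r)" using v by (simp add: inner_diff_left z)
  then have "m - n = z * r" by (simp only: of_int_eq_iff)
  then show ?thesis by (simp add: cong_iff_dvd_diff)
qed

context fano
begin

lemma edge_type_model:
  assumes E: "E \<in> edges"
  shows "\<exists>A. unimodular A \<and> (*v) A ` (conic hull E) = convex_cone hull (model_generators (fst (edge_type E)) (snd (edge_type E)))"
proof -
  note D = edgeD[OF E] and I = edge_ints[OF E]
  \<comment> \<open>Adding multiples of \<open>rot (edge_end E)\<close> changes the value at the
    start by multiples of the index; this choice reduces it to the remainder stored in
    \<open>edge_type E\<close>.\<close>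
  define s where "s = foot (edge_end E) + of_int (start_pairing E div edge_index E) *\<^sub>R rot (edge_end E)"
  have s: "s \<in> int_lattice" unfolding s_def
    using foot[OF D(3)] vertices_int_lattice[OF D(3)] by (intro int_lattice_add int_lattice_scale int_lattice_rot) auto
  have sen: "s \<bullet> edge_end E = -1" using foot(2)[OF D(3)] by (simp add: s_def inner_add_left inner_rot)
  have "s \<bullet> edge_start E = of_int (start_pairing E - start_pairing E div edge_index E * edge_index E)"
    by (simp add: s_def inner_add_left inner_rot I(1,2) cross2_swap[of "edge_end E"])
  also have "start_pairing E - start_pairing E div edge_index E * edge_index E = int (snd (edge_type E))"
    using I(4) by (simp add: edge_type_def minus_div_mult_eq_mod)
  finally have sst: "s \<bullet> edge_start E = real (snd (edge_type E))" by simp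
  have R: "real (fst (edge_type E)) = cross2 (edge_start E) (edge_end E)" using I(1,4) by (simp add: edge_type_def)
  \<comment> \<open>The rows are chosen so that \<open>edge_end E\<close> goes to
    \<open>(0, 1)\<close> and \<open>edge_start E\<close> to \<open>(R, -a)\<close>.\<close>
  define A :: "real ^ 2 ^ 2" where "A = vector [- rot (edge_end E), - s]"
  have Av: "(A *v v) $ 1 = - cross2 (edge_end E) v" "(A *v v) $ 2 = - (s \<bullet> v)" for v
    by (simp_all add: A_def matrix_vector_mul_component inner_rot)
  have "A $ i $ j \<in> \<int>" for i j
    using s vertices_int_lattice[OF D(3)] exhaust_2[of i] exhaust_2[of j] by (auto simp: A_def int_lattice_iff)
  moreover have "det A = 1" using sen by (simp add: A_def det_2 inner2 algebra_simps)
  ultimately have "unimodular A" by (simp add: unimodular_def)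
  moreover have "A *v edge_end E = vector [0, 1]" "A *v edge_start E = vector [real (fst (edge_type E)), - real (snd (edge_type E))]"
    using sen sst R by (simp_all add: vec2_eq_iff Av cross2_swap[of "edge_end E" "edge_start E"])
  then have "(*v) A ` (conic hull E) = convex_cone hull (model_generators (fst (edge_type E)) (snd (edge_type E)))"
    by (subst D(1)) (simp add: conic_hull_segment convex_cone_hull_2_image model_generators_def insert_commute)
  ultimately show ?thesis by blast
qed

text \<open>A unimodular map onto a model cone matches the primitive generators in one of two
  orders. One order yields \<open>start_pairing E\<close> modulo the index, the other its inverse
  \<open>end_pairing E\<close>, and \<open>cqs\<close> identifies the two.\<close>

lemma cone_singularity_eq:
  assumes E: "E \<in> edges"
  shows "cone_singularity (conic hull E) = cqs (fst (edge_type E)) (snd (edge_type E))"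
  unfolding cone_singularity_def
proof (rule the_equality)
  have "fst (edge_type E) > 0" "coprime (fst (edge_type E)) (snd (edge_type E))"
    using cyclic_quotient_edge_type[OF E] by (cases "edge_type E"; simp)+
  then show "\<exists>R a. R > 0 \<and> coprime R a \<and> cqs (fst (edge_type E)) (snd (edge_type E)) = cqs R a \<and>
     (\<exists>A. unimodular A \<and> (*v) A ` (conic hull E) = convex_cone hull (model_generators R a))"
    using edge_type_model[OF E] by blast
next
  note D = edgeD[OF E] and I = edge_ints[OF E]
  fix s assume "\<exists>R a. R > 0 \<and> coprime R a \<and> s = cqs R a \<and>
     (\<exists>A. unimodular A \<and> (*v) A ` (conic hull E) = convex_cone hull (model_generators R a))"
  then obtain R a A where R: "R > 0" "coprime R a" and s: "s = cqs R a" and A: "unimodular A"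
    and im: "(*v) A ` (conic hull E) = convex_cone hull (model_generators R a)" by blast
  note M = model_generators_primitive[OF R]
  have d: "\<bar>det A\<bar> = 1" using A by (auto simp: unimodular_def)
  have eq: "convex_cone hull {A *v edge_start E, A *v edge_end E} = convex_cone hull {vector [0, 1], vector [real R, - real a]}"
    using im by (subst (asm) D(1)) (simp add: conic_hull_segment convex_cone_hull_2_image model_generators_def)
  have ac: "\<bar>cross2 (A *v edge_start E) (A *v edge_end E)\<bar> = cross2 (edge_start E) (edge_end E)" using D(4) d by (simp add: det_cross2 abs_mult)
  then have nz: "cross2 (A *v edge_start E) (A *v edge_end E) \<noteq> 0" using D(4) by auto
  have cases: "A *v edge_start E = vector [0, 1] \<and> A *v edge_end E = vector [real R, - real a] \<or>
      A *v edge_start E = vector [real R, - real a] \<and> A *v edge_end E = vector [0, 1]"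
    by (rule cone_generators_unique[OF eq _ _ M(1,2) nz])
      (use M(3) R A unimodular_primitive primitive_vertices D(2,3) in auto)
  then have "\<bar>cross2 (A *v edge_start E) (A *v edge_end E)\<bar> = real R"
    using M(3) cross2_swap[of "vector [real R, - real a]" "vector [0, 1]"] by auto
  then have "real R = of_int (edge_index E)" using ac I(1) by simp
  then have RE: "int R = edge_index E" by (metis of_int_eq_iff of_int_of_nat_eq)
  then have RN: "nat (edge_index E) = R" by (metis nat_int)
  then have RE': "fst (edge_type E) = R" by (simp add: edge_type_def)
  \<comment> \<open>The pullback of the functional with value -1 at \<open>(0, 1)\<close> and
    \<open>a\<close> at \<open>(R, -a)\<close>, to be compared with a foot by
    \<open>functional_cong\<close>.\<close>
  define t where "t = - (A $ 2)"
  have t: "t \<in> int_lattice" using A by (simp add: t_def unimodular_def int_lattice_iff)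
  have tv: "t \<bullet> v = - ((A *v v) $ 2)" for v by (simp add: t_def matrix_vector_mul_component)
  have "[a = snd (edge_type E)] (mod R) \<or> [snd (edge_type E) * a = 1] (mod R)"
    using cases
  proof (elim disjE conjE)
    assume c: "A *v edge_start E = vector [0, 1]" "A *v edge_end E = vector [real R, - real a]"
    have "[int a = end_pairing E] (mod edge_index E)"
    proof (rule functional_cong[OF t _ foot(1)[OF D(2)] foot(2)[OF D(2)]])
      show "t \<bullet> edge_start E = -1" "t \<bullet> edge_end E = of_int (int a)" by (simp_all add: tv c)
    qed (use I vertices_int_lattice D(2) vertices_nonzero in auto)
    also have "[end_pairing E = int (nat (end_pairing E mod edge_index E))] (mod edge_index E)" using I(4) by simp
    finally have "[int a = int (nat (end_pairing E mod edge_index E))] (mod int R)" by (simp only: RE)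
    then have "[a = nat (end_pairing E mod edge_index E)] (mod R)" by (simp only: cong_int_iff)
    then have "[snd (edge_type E) * a = snd (edge_type E) * nat (end_pairing E mod edge_index E)] (mod R)" by (rule cong_scalar_left)
    moreover have "[snd (edge_type E) * nat (end_pairing E mod edge_index E) = 1] (mod R)"
      using edge_type_inverse[OF E] by (simp only: RN edge_type_def snd_conv)
    ultimately show ?thesis using cong_trans by blast
  next
    assume c: "A *v edge_start E = vector [real R, - real a]" "A *v edge_end E = vector [0, 1]"
    have "[int a = start_pairing E] (mod - edge_index E)"
    proof (rule functional_cong[OF t _ foot(1)[OF D(3)] foot(2)[OF D(3)]])
      show "t \<bullet> edge_end E = -1" "t \<bullet> edge_start E = of_int (int a)" by (simp_all add: tv c)
      show "cross2 (edge_end E) (edge_start E) = of_int (- edge_index E)" using cross2_swap[of "edge_end E" "edge_start E"] I(1) by simp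
    qed (use I vertices_int_lattice D(3) vertices_nonzero in auto)
    then have "[int a = start_pairing E] (mod edge_index E)" by simp
    also have "[start_pairing E = int (nat (start_pairing E mod edge_index E))] (mod edge_index E)" using I(4) by simp
    finally have "[int a = int (nat (start_pairing E mod edge_index E))] (mod int R)" by (simp only: RE)
    then have "[a = nat (start_pairing E mod edge_index E)] (mod R)" by (simp only: cong_int_iff)
    then show ?thesis by (simp add: edge_type_def)
  qed
  then show "s = cqs (fst (edge_type E)) (snd (edge_type E))" unfolding s RE' by (rule cqs_cong)
qed

end

section \<open>The denominator of the dual polygon\<close>

context fano
begin

text \<open>In the lattice basis of foot and \<open>rot\<close> at the end vertex only the second
  coordinate can fail to be integral. After division by the width it is \<open>r * c / l\<close> up
  to an integer, with \<open>c\<close> prime to \<open>l\<close>.\<close>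

lemma edge_normal_lattice_iff:
  assumes E: "E \<in> edges"
  shows "real r *\<^sub>R edge_normal E \<in> int_lattice \<longleftrightarrow> local_index (edge_type E) dvd r"
proof -
  note D = edgeD[OF E] and I = edge_ints[OF E]
  have cq: "cyclic_quotient (fst (edge_type E), snd (edge_type E))" using cyclic_quotient_edge_type[OF E] by simp
  obtain k l b c d where K: "fst (edge_type E) = k * l" "snd (edge_type E) + 1 = k * c" "b + 1 = k * d" "k > 0" "l > 0" "c > 0" "d > 0"
    "coprime c l" "coprime d l" "[snd (edge_type E) * b = 1] (mod fst (edge_type E))" "[k * c * d = c + d] (mod l)"
    "local_index (fst (edge_type E), snd (edge_type E)) = l" "width (fst (edge_type E), snd (edge_type E)) = k"
    and w: "\<And>i. wave (fst (edge_type E), snd (edge_type E)) i = sawtooth l (i * c) + sawtooth l (i * d)"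
    by (rule reduced_data[OF cq]) (rule that; assumption)
  have R: "int (fst (edge_type E)) = edge_index E" using I(4) by (simp add: edge_type_def)
  define x where "x = real_of_int (start_pairing E + 1) / of_int (edge_index E)"
  have n: "real r *\<^sub>R edge_normal E = real r *\<^sub>R foot (edge_end E) + (real r * x) *\<^sub>R rot (edge_end E)"
    unfolding edge_normal_eq(1)[OF E] x_def by (simp add: scaleR_add_right)
  have fl: "real r *\<^sub>R foot (edge_end E) \<in> int_lattice" by (intro int_lattice_scale foot(1)[OF D(3)]) simp
  have "real r *\<^sub>R edge_normal E \<in> int_lattice \<longleftrightarrow> (real r * x) *\<^sub>R rot (edge_end E) \<in> int_lattice"
    unfolding n using int_lattice_add[OF fl] int_lattice_diff[OF _ fl] by (metis add_diff_cancel_left')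
  also have "\<dots> \<longleftrightarrow> real r * x \<in> \<int>"
    using rot_coordinate_int[OF foot[OF D(3)]] int_lattice_scale int_lattice_rot[OF vertices_int_lattice[OF D(3)]] by blast
  also have "\<dots> \<longleftrightarrow> edge_index E dvd int r * (start_pairing E + 1)"
  proof
    assume "real r * x \<in> \<int>"
    then obtain z where "real r * x = of_int z" by (auto elim: Ints_cases)
    then have "real_of_int (int r * (start_pairing E + 1)) = of_int (z * edge_index E)" using I(4) by (simp add: x_def field_simps)
    then have "int r * (start_pairing E + 1) = z * edge_index E" by (simp only: of_int_eq_iff)
    then show "edge_index E dvd int r * (start_pairing E + 1)" by simp
  next
    assume "edge_index E dvd int r * (start_pairing E + 1)"
    then obtain z where "int r * (start_pairing E + 1) = edge_index E * z" by blast
    then have "real_of_int (int r * (start_pairing E + 1)) = of_int (edge_index E * z)" by (simp only:)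
    then have "real r * x = of_int z" using I(4) by (simp add: x_def field_simps)
    then show "real r * x \<in> \<int>" by simp
  qed
  also have "\<dots> \<longleftrightarrow> edge_index E dvd int r * int (snd (edge_type E) + 1)"
  proof (rule cong_dvd_iff)
    have "[start_pairing E + 1 = int (snd (edge_type E)) + 1] (mod edge_index E)" using I(4) by (intro cong_add) (auto simp: edge_type_def)
    then have "[int r * (start_pairing E + 1) = int r * (int (snd (edge_type E)) + 1)] (mod edge_index E)" by (rule cong_scalar_left)
    then show "[int r * (start_pairing E + 1) = int r * int (snd (edge_type E) + 1)] (mod edge_index E)" by (simp add: add.commute)
  qed
  also have "\<dots> \<longleftrightarrow> fst (edge_type E) dvd r * (snd (edge_type E) + 1)"
    unfolding R[symmetric] of_nat_mult[symmetric] by (rule int_dvd_int_iff)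
  also have "\<dots> \<longleftrightarrow> k * l dvd k * (r * c)" unfolding K(1,2) by (simp only: mult.left_commute)
  also have "\<dots> \<longleftrightarrow> l dvd r * c" using K(4) by simp
  also have "\<dots> \<longleftrightarrow> l dvd r" using K(8) by (metis coprime_commute coprime_dvd_mult_left_iff)
  finally show ?thesis using K(12) by simp
qed

lemma compact_dual: "compact (dual_polygon P)" and convex_dual: "convex (dual_polygon P)"
proof -
  have D: "dual_polygon P = (\<Inter>v\<in>P. {u. v \<bullet> u \<ge> -1})" by (auto simp: dual_polygon_def inner_commute)
  have "closed (dual_polygon P)" unfolding D by (intro closed_INT ballI closed_halfspace_ge)
  moreover have "bounded (dual_polygon P)"
  proof -
    obtain e where e: "e > 0" "ball 0 e \<subseteq> P" using zero_interior mem_interior by blast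
    have "norm u \<le> 2 / e" if u: "u \<in> dual_polygon P" for u
    proof (cases "u = 0")
      case False
      have "(- (e / 2) / norm u) *\<^sub>R u \<in> ball 0 e" using e(1) False by simp
      then have "(- (e / 2) / norm u) *\<^sub>R u \<in> P" using e(2) by blast
      then have "u \<bullet> ((- (e / 2) / norm u) *\<^sub>R u) \<ge> -1" using u unfolding dual_polygon_def by blast
      moreover have "u \<bullet> ((- (e / 2) / norm u) *\<^sub>R u) = - (e / 2) * norm u"
        using False by (simp add: dot_square_norm power2_eq_square)
      ultimately have "- (e / 2) * norm u \<ge> -1" by (simp only:)
      then have "norm u * e \<le> 2" by (simp add: mult.commute)
      then show ?thesis using e(1) by (simp add: le_divide_eq)
    qed (use e in simp)
    then show ?thesis by (rule boundedI)
  qed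
  ultimately show "compact (dual_polygon P)" by (simp add: compact_eq_bounded_closed)
  show "convex (dual_polygon P)" unfolding D by (intro convex_INT convex_halfspace_ge)
qed

lemma edge_normal_in_dual: "E \<in> edges \<Longrightarrow> edge_normal E \<in> dual_polygon P"
  using edgeD(5) by (simp add: dual_polygon_def)

lemma dual_inner_vertices:
  assumes "\<And>v. v \<in> vertices \<Longrightarrow> u \<bullet> v \<ge> -1"
  shows "u \<in> dual_polygon P"
  using inner_ge_P[where n = u and c = "-1"] assms by (auto simp: dual_polygon_def)

text \<open>A point of the dual polygon at which at most one of the defining inequalities is tight can
  be moved in both directions along that line.\<close>

lemma extreme_point_dual:
  assumes u: "u extreme_point_of dual_polygon P"
  shows "u \<in> edge_normal ` edges"
proof (cases "\<exists>v\<in>vertices. \<exists>w\<in>vertices. v \<noteq> w \<and> u \<bullet> v = -1 \<and> u \<bullet> w = -1")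
  case True
  then obtain v w where vw: "v \<in> vertices" "w \<in> vertices" "v \<noteq> w" "u \<bullet> v = -1" "u \<bullet> w = -1" by blast
  have uP: "u \<bullet> x \<ge> -1" if "x \<in> P" for x using u that by (auto simp: extreme_point_of_def dual_polygon_def)
  define G where "G = P \<inter> {x. u \<bullet> x = -1}"
  have G: "G \<in> edges" unfolding G_def by (rule edge_of_functional[OF uP vw])
  have "v \<in> G" "w \<in> G" using vw vertices_subset by (auto simp: G_def)
  then have n: "edge_normal G \<bullet> v = -1" "edge_normal G \<bullet> w = -1" using edgeD(6)[OF G] by auto
  have "u - edge_normal G = 0"
  proof (rule orthogonal_both_zero)
    show "(u - edge_normal G) \<bullet> v = 0" "(u - edge_normal G) \<bullet> w = 0" using n vw by (simp_all add: inner_diff_left)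
    show "cross2 v w \<noteq> 0" using cross2_zero_imp_eq vw by blast
  qed
  then show ?thesis using G by simp
next
  case False
  have vertices_ne: "vertices \<noteq> {}" using zero_interior interior_subset P_eq by fastforce
  have "\<exists>v\<in>vertices. \<forall>w\<in>vertices. w \<noteq> v \<longrightarrow> u \<bullet> w \<noteq> -1"
  proof (cases "\<exists>v\<in>vertices. u \<bullet> v = -1")
    case True
    then show ?thesis using False by blast
  next
    case False
    then show ?thesis using vertices_ne by blast
  qed
  then obtain v where v: "v \<in> vertices" "\<And>w. w \<in> vertices \<Longrightarrow> w \<noteq> v \<Longrightarrow> u \<bullet> w \<noteq> -1" by blast
  have uD: "u \<in> dual_polygon P" using u by (simp add: extreme_point_of_def)
  have uV: "u \<bullet> w \<ge> -1" if "w \<in> vertices" for w using uD that vertices_subset by (auto simp: dual_polygon_def)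
  \<comment> \<open>The slack at \<open>w\<close> over the rate of change along
    \<open>rot v\<close>; the added 1 avoids division by zero.\<close>
  define f where "f w = (u \<bullet> w + 1) / (1 + \<bar>cross2 v w\<bar>)" for w
  have fpos: "f w > 0" if "w \<in> vertices - {v}" for w
  proof -
    have "u \<bullet> w > -1" using uV[of w] v(2)[of w] that by (simp add: less_le)
    then show ?thesis by (simp add: f_def)
  qed
  define e where "e = Min (insert 1 (f ` (vertices - {v})))"
  have fin: "finite (insert 1 (f ` (vertices - {v})))" using finite_vertices by simp
  have e: "e > 0" unfolding e_def using fin fpos by (subst Min_gr_iff) auto
  have ef: "e \<le> f w" if "w \<in> vertices - {v}" for w unfolding e_def using fin that by (intro Min_le) auto
  have mem: "u + c *\<^sub>R rot v \<in> dual_polygon P" if c: "\<bar>c\<bar> \<le> e" for c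
  proof (rule dual_inner_vertices)
    fix w assume w: "w \<in> vertices"
    show "(u + c *\<^sub>R rot v) \<bullet> w \<ge> -1"
    proof (cases "w = v")
      case True
      then show ?thesis using uV[OF v(1)] by (simp add: inner_add_left inner_rot)
    next
      case False
      have "\<bar>c * cross2 v w\<bar> \<le> e * (1 + \<bar>cross2 v w\<bar>)"
        unfolding abs_mult using c e by (intro mult_mono) auto
      also have "\<dots> \<le> f w * (1 + \<bar>cross2 v w\<bar>)" using ef w False by (intro mult_right_mono) auto
      also have "\<dots> = u \<bullet> w + 1" by (simp add: f_def)
      finally show ?thesis by (simp add: inner_add_left inner_rot)
    qed
  qed
  have r: "rot v \<noteq> 0" using vertices_nonzero[OF v(1)] by (auto simp: vec2_eq_iff)
  have "u = midpoint (u + e *\<^sub>R rot v) (u + (- e) *\<^sub>R rot v)" by (simp add: midpoint_def scaleR_2[symmetric])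
  moreover have "u + e *\<^sub>R rot v \<noteq> u + (- e) *\<^sub>R rot v" using r e by (simp add: eq_neg_iff_add_eq_0 scaleR_2[symmetric])
  ultimately have "u \<in> open_segment (u + e *\<^sub>R rot v) (u + (- e) *\<^sub>R rot v)" by (metis midpoint_in_open_segment)
  moreover have "u + e *\<^sub>R rot v \<in> dual_polygon P" "u + (- e) *\<^sub>R rot v \<in> dual_polygon P"
    using mem[of e] mem[of "- e"] e by simp_all
  ultimately show ?thesis using u by (auto simp: extreme_point_of_def)
qed

lemma dual_eq_hull: "dual_polygon P = convex hull (edge_normal ` edges)"
proof
  have "dual_polygon P = convex hull {u. u extreme_point_of dual_polygon P}"
    by (rule Krein_Milman_Minkowski[OF compact_dual convex_dual])
  also have "\<dots> \<subseteq> convex hull (edge_normal ` edges)" using extreme_point_dual by (intro hull_mono) auto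
  finally show "dual_polygon P \<subseteq> convex hull (edge_normal ` edges)" .
  show "convex hull (edge_normal ` edges) \<subseteq> dual_polygon P"
    using edge_normal_in_dual by (intro hull_minimal convex_dual) auto
qed

text \<open>The sum of the two end vertices, as a functional, is minimal on the dilate only where
  both pairings are, which is a single point.\<close>

lemma scaled_edge_normal_extreme:
  assumes E: "E \<in> edges" and r: "r > 0"
  shows "(real r *\<^sub>R edge_normal E) extreme_point_of ((\<lambda>x. real r *\<^sub>R x) ` dual_polygon P)"
proof -
  define S where "S = (\<lambda>x. real r *\<^sub>R x) ` dual_polygon P"
  define a where "a = edge_start E + edge_end E"
  note D = edgeD[OF E]
  have a: "a \<bullet> x = x \<bullet> edge_start E + x \<bullet> edge_end E" for x by (simp add: a_def inner_add_right inner_commute[of _ x])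
  have cS: "convex S" unfolding S_def by (rule convex_scaling[OF convex_dual])
  have ge: "y \<bullet> edge_start E \<ge> - real r \<and> y \<bullet> edge_end E \<ge> - real r" if "y \<in> S" for y
  proof -
    obtain x where x: "y = real r *\<^sub>R x" "x \<in> dual_polygon P" using \<open>y \<in> S\<close> by (auto simp: S_def)
    have "x \<bullet> edge_start E \<ge> -1" "x \<bullet> edge_end E \<ge> -1" using x(2) D(2,3) vertices_subset by (auto simp: dual_polygon_def)
    then have "real r * (x \<bullet> edge_start E) \<ge> real r * -1" "real r * (x \<bullet> edge_end E) \<ge> real r * -1"
      by (intro mult_left_mono; simp)+
    then show ?thesis by (simp add: x(1))
  qed
  have "S \<inter> {x. a \<bullet> x = - 2 * real r} = {real r *\<^sub>R edge_normal E}"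
  proof (intro equalityI subsetI)
    fix y assume y: "y \<in> S \<inter> {x. a \<bullet> x = - 2 * real r}"
    then have "y \<bullet> edge_start E + y \<bullet> edge_end E = - 2 * real r" by (simp add: a)
    then have "y \<bullet> edge_start E = - real r" "y \<bullet> edge_end E = - real r" using ge[of y] y by auto
    then have "(y - real r *\<^sub>R edge_normal E) \<bullet> edge_start E = 0" "(y - real r *\<^sub>R edge_normal E) \<bullet> edge_end E = 0"
      using D(7,8) by (simp_all add: inner_diff_left)
    then have "y - real r *\<^sub>R edge_normal E = 0" using D(4) by (intro orthogonal_both_zero[of _ "edge_start E" "edge_end E"]) auto
    then show "y \<in> {real r *\<^sub>R edge_normal E}" by simp
  next
    fix y assume "y \<in> {real r *\<^sub>R edge_normal E}"
    then show "y \<in> S \<inter> {x. a \<bullet> x = - 2 * real r}"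
      using edge_normal_in_dual[OF E] D(7,8) by (auto simp: S_def a)
  qed
  moreover have "(S \<inter> {x. a \<bullet> x = - 2 * real r}) face_of S"
  proof (rule face_of_Int_supporting_hyperplane_ge[OF cS])
    show "a \<bullet> x \<ge> - 2 * real r" if "x \<in> S" for x
      using ge[OF that] by (simp add: a)
  qed
  ultimately show ?thesis by (simp add: face_of_singleton S_def)
qed

lemma lattice_polytope_dual_iff:
  assumes r: "r > 0"
  shows "lattice_polytope ((\<lambda>x. real r *\<^sub>R x) ` dual_polygon P) \<longleftrightarrow> (\<forall>E\<in>edges. local_index (edge_type E) dvd r)"
proof
  assume "lattice_polytope ((\<lambda>x. real r *\<^sub>R x) ` dual_polygon P)"
  then obtain U where U: "U \<subseteq> int_lattice" "(\<lambda>x. real r *\<^sub>R x) ` dual_polygon P = convex hull U"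
    unfolding lattice_polytope_def by blast
  show "\<forall>E\<in>edges. local_index (edge_type E) dvd r"
  proof
    fix E assume E: "E \<in> edges"
    have "(real r *\<^sub>R edge_normal E) extreme_point_of (convex hull U)" using scaled_edge_normal_extreme[OF E r] U(2) by simp
    then have "real r *\<^sub>R edge_normal E \<in> int_lattice" using extreme_point_of_convex_hull U(1) by blast
    then show "local_index (edge_type E) dvd r" by (simp only: edge_normal_lattice_iff[OF E])
  qed
next
  assume l: "\<forall>E\<in>edges. local_index (edge_type E) dvd r"
  have "(\<lambda>x. real r *\<^sub>R x) ` dual_polygon P = convex hull ((\<lambda>x. real r *\<^sub>R x) ` edge_normal ` edges)"
    unfolding dual_eq_hull by (rule convex_hull_scaling[symmetric])
  moreover have "(\<lambda>x. real r *\<^sub>R x) ` edge_normal ` edges \<subseteq> int_lattice" using l edge_normal_lattice_iff by auto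
  ultimately show "lattice_polytope ((\<lambda>x. real r *\<^sub>R x) ` dual_polygon P)"
    unfolding lattice_polytope_def using finite_edges by (intro exI[of _ "(\<lambda>x. real r *\<^sub>R x) ` edge_normal ` edges"]) auto
qed

lemma denominator_dual: "denominator (dual_polygon P) = Lcm ((\<lambda>E. local_index (edge_type E)) ` edges)"
  unfolding denominator_def
proof (rule Least_equality)
  have fin: "finite ((\<lambda>E. local_index (edge_type E)) ` edges)" using finite_edges by simp
  have "0 \<notin> (\<lambda>E. local_index (edge_type E)) ` edges"
  proof
    assume "0 \<in> (\<lambda>E. local_index (edge_type E)) ` edges"
    then obtain E where "E \<in> edges" "local_index (edge_type E) = 0" by (metis imageE)
    then show False using local_index_pos[OF cyclic_quotient_edge_type[of E]] by linarith
  qed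
  then have "Lcm ((\<lambda>E. local_index (edge_type E)) ` edges) \<noteq> 0" using Lcm_0_iff[OF fin] by blast
  then have pos: "Lcm ((\<lambda>E. local_index (edge_type E)) ` edges) > 0" by (simp only: neq0_conv)
  moreover have "\<forall>E\<in>edges. local_index (edge_type E) dvd Lcm ((\<lambda>E. local_index (edge_type E)) ` edges)" by (auto intro: dvd_Lcm)
  ultimately show "Lcm ((\<lambda>E. local_index (edge_type E)) ` edges) > 0 \<and>
      lattice_polytope ((\<lambda>x. real (Lcm ((\<lambda>E. local_index (edge_type E)) ` edges)) *\<^sub>R x) ` dual_polygon P)"
    using lattice_polytope_dual_iff by blast
  fix r assume "r > 0 \<and> lattice_polytope ((\<lambda>x. real r *\<^sub>R x) ` dual_polygon P)"
  then have "\<forall>E\<in>edges. local_index (edge_type E) dvd r" "r > 0" using lattice_polytope_dual_iff by blast+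
  then show "Lcm ((\<lambda>E. local_index (edge_type E)) ` edges) \<le> r" by (intro dvd_imp_le Lcm_least) auto
qed

end

section \<open>Quasi-period collapse\<close>

text \<open>Multiplicities in a basket become the real weights of
  \<open>sawtooth_sum_period\<close>.\<close>

lemma sum_mset_eq_sum_count:
  fixes f :: "'b \<Rightarrow> real"
  shows "(\<Sum>s\<in>#A. f s) = (\<Sum>s\<in>set_mset A. real (count A s) * f s)"
proof (induction A)
  case (add x A)
  have "(\<Sum>s\<in>set_mset (add_mset x A). real (count (add_mset x A) s) * f s) =
      (\<Sum>s\<in>insert x (set_mset A). real (count A s) * f s + (if s = x then f x else 0))"
    by (rule sum.cong) (auto simp: distrib_right)
  also have "\<dots> = (\<Sum>s\<in>insert x (set_mset A). real (count A s) * f s) + f x"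
    by (simp only: sum.distrib) (simp add: sum.delta)
  also have "(\<Sum>s\<in>insert x (set_mset A). real (count A s) * f s) = (\<Sum>s\<in>set_mset A. real (count A s) * f s)"
    by (rule sum.mono_neutral_right) (auto simp: not_in_iff)
  finally show ?case using add by simp
qed simp

text \<open>A local index that does not divide the period is realised by a cancelling tuple, namely by
  all singularities of a maximal such local index.\<close>

lemma reduced_period:
  assumes B: "\<forall>s\<in>#B. cyclic_quotient s \<and> R_singularity s"
    and IB: "invisible_basket IB B" and RB: "RB = B - IB"
    and p: "p > 0" and per: "\<And>i. (\<Sum>s\<in>#RB. wave s (i + p)) = (\<Sum>s\<in>#RB. wave s i)"
    and s: "s \<in># RB"
  shows "local_index s dvd p"
proof (rule ccontr)
  assume nd: "\<not> local_index s dvd p"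
  have RBB: "\<forall>s\<in>#RB. cyclic_quotient s \<and> R_singularity s" using B RB by (meson in_diffD)
  define M where "M = {local_index s | s. s \<in># RB \<and> \<not> local_index s dvd p}"
  have "M \<subseteq> local_index ` set_mset RB" by (auto simp: M_def simp del: local_index.simps)
  then have fin: "finite M" by (rule finite_subset) simp
  have "local_index s \<in> M" using s nd unfolding M_def by blast
  then have ne: "M \<noteq> {}" by blast
  define l where "l = Max M"
  have lM: "l \<in> M" unfolding l_def using fin ne by (rule Max_in)
  then obtain s0 where s0: "s0 \<in># RB" "local_index s0 = l" "\<not> l dvd p" unfolding M_def by blast
  have l0: "l > 0" using s0 RBB local_index_pos by blast
  \<comment> \<open>Failing to divide \<open>p\<close> passes on to multiples, so a local index
    divisible by \<open>l\<close> competes with \<open>l\<close> for the maximum.\<close>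
  have max: "local_index t = l" if t: "t \<in># RB" "l dvd local_index t" for t
  proof -
    have "\<not> local_index t dvd p" using s0(3) t(2) dvd_trans by blast
    then have "local_index t \<in> M" unfolding M_def using t(1) by blast
    then have "local_index t \<le> l" unfolding l_def using fin by (intro Max_ge)
    moreover have "l \<le> local_index t" using t RBB local_index_pos by (intro dvd_imp_le) auto
    ultimately show ?thesis by simp
  qed
  have "\<exists>c d. coprime c (local_index t) \<and> coprime d (local_index t) \<and>
      (\<forall>i. wave t i = sawtooth (local_index t) (i * c) + sawtooth (local_index t) (i * d))" if t: "t \<in># RB" for t
  proof -
    have "cyclic_quotient t" using RBB t by blast
    then show ?thesis using wave_reduced by metis
  qed
  then obtain c d where cd: "\<And>t. t \<in># RB \<Longrightarrow> coprime (c t) (local_index t)" "\<And>t. t \<in># RB \<Longrightarrow> coprime (d t) (local_index t)"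
    "\<And>t i. t \<in># RB \<Longrightarrow> wave t i = sawtooth (local_index t) (i * c t) + sawtooth (local_index t) (i * d t)"
    by metis
  define A where "A = filter_mset (\<lambda>t. local_index t = l) RB"
  have wsum: "(\<Sum>t\<in>#RB. wave t i) = (\<Sum>t\<in>set_mset RB. real (count RB t) *
      (sawtooth (local_index t) (i * c t) + sawtooth (local_index t) (i * d t)))" for i
    unfolding sum_mset_eq_sum_count using cd(3) by (intro sum.cong) auto
  have z: "(\<Sum>t\<in>{t\<in>set_mset RB. local_index t = l}. real (count RB t) * (sawtooth l (i * c t) + sawtooth l (i * d t))) = 0" for i
  proof (rule sawtooth_sum_period[where l = local_index and c = c and d = d and p = p])
    show "local_index t > 0" if "t \<in># RB" for t using that RBB local_index_pos by blast
    show "(\<Sum>t\<in>set_mset RB. real (count RB t) * (sawtooth (local_index t) ((i + p) * c t) + sawtooth (local_index t) ((i + p) * d t))) =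
      (\<Sum>t\<in>set_mset RB. real (count RB t) * (sawtooth (local_index t) (i * c t) + sawtooth (local_index t) (i * d t)))" for i
      unfolding wsum[symmetric] by (rule per)
  qed (use cd p s0 l0 max in auto)
  have "(\<Sum>t\<in>#A. wave t i) = 0" for i
  proof -
    have "(\<Sum>t\<in>#A. wave t i) = (\<Sum>t\<in>{t\<in>set_mset RB. local_index t = l}. real (count RB t) * (sawtooth l (i * c t) + sawtooth l (i * d t)))"
      unfolding sum_mset_eq_sum_count A_def using cd(3) by (intro sum.cong) auto
    then show ?thesis using z by simp
  qed
  moreover have AB: "\<forall>t\<in>#A. cyclic_quotient t \<and> R_singularity t" using RBB by (auto simp: A_def)
  ultimately have "(\<Sum>t\<in>#A. orbifold_correction t) = 0" by (subst sum_orbifold_correction_eq_0_iff) auto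
  moreover have "s0 \<in># A" using s0 by (simp add: A_def)
  ultimately have ct: "cancelling_tuple A" "A \<noteq> {#}" using AB by (auto simp: cancelling_tuple_def)
  have "IB \<subseteq># B" "invisible IB" using IB by (auto simp: invisible_basket_def)
  then obtain \<C> where C: "\<forall>C\<in>#\<C>. cancelling_tuple C" "IB = sum_mset \<C>" by (auto simp: invisible_def)
  \<comment> \<open>\<open>A\<close> is one more cancelling tuple, and it is taken from the
    complement of \<open>IB\<close>, so the invisible basket could be enlarged.\<close>
  have "invisible (IB + A)" unfolding invisible_def
    by (rule exI[of _ "add_mset A \<C>"]) (use C ct in \<open>auto simp: add.commute\<close>)
  moreover have "A \<subseteq># B - IB" unfolding A_def RB[symmetric] by (rule multiset_filter_subset)
  then have "IB + A \<subseteq># B" using \<open>IB \<subseteq># B\<close> by (metis subset_mset.add_diff_inverse subset_mset.add_le_cancel_left)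
  ultimately have "IB + A = IB" using IB by (auto simp: invisible_basket_def)
  then show False using ct(2) by simp
qed

lemma invisible_wave:
  assumes "invisible A" "\<forall>s\<in>#A. cyclic_quotient s"
  shows "(\<Sum>s\<in>#A. wave s i) = 0"
proof -
  obtain \<C> where C: "\<forall>C\<in>#\<C>. cancelling_tuple C" "A = sum_mset \<C>" using assms(1) by (auto simp: invisible_def)
  from C(1) assms(2)[unfolded C(2)] have "(\<Sum>s\<in>#sum_mset \<C>. wave s i) = 0"
  proof (induction \<C>)
    case (add C \<C>)
    then have "(\<Sum>s\<in>#C. orbifold_correction s) = 0" "\<forall>s\<in>#C. cyclic_quotient s" by (auto simp: cancelling_tuple_def)
    then have "(\<Sum>s\<in>#C. wave s i) = 0" using sum_orbifold_correction_eq_0_iff by blast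
    then show ?case using add by simp
  qed simp
  then show ?thesis using C(2) by simp
qed

section \<open>Cones, basket and T-singularities of the polygon\<close>

context fano
begin

definition edge_singularity :: "(real ^ 2) set \<Rightarrow> singularity" where
  "edge_singularity E = cqs (fst (edge_type E)) (snd (edge_type E))"

lemma edge_singularity:
  assumes "E \<in> edges"
  shows "cyclic_quotient (edge_singularity E)" "local_index (edge_singularity E) = local_index (edge_type E)"
    "wave (edge_singularity E) = wave (edge_type E)"
proof -
  have cq: "cyclic_quotient (fst (edge_type E), snd (edge_type E))" using cyclic_quotient_edge_type[OF assms] by simp
  show "cyclic_quotient (edge_singularity E)" "local_index (edge_singularity E) = local_index (edge_type E)"
    "wave (edge_singularity E) = wave (edge_type E)"
    unfolding edge_singularity_def cqs_invariants[OF cq] using cqs_invariants(1)[OF cq] by simp_all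
qed

lemma cones_eq: "cones P = image_mset edge_singularity (mset_set edges)"
  unfolding cones_def edges_def[symmetric] edge_singularity_def
  using finite_edges cone_singularity_eq by (intro image_mset_cong) auto

lemma cones_cyclic_quotient: "\<forall>s\<in>#cones P. cyclic_quotient s"
  unfolding cones_eq using finite_edges edge_singularity(1) by auto

lemma sum_cones_wave: "(\<Sum>s\<in>#cones P. wave s i) = (\<Sum>E\<in>edges. wave (edge_type E) i)"
proof -
  have "(\<Sum>s\<in>#cones P. wave s i) = (\<Sum>E\<in>edges. wave (edge_singularity E) i)"
    unfolding cones_eq by (simp add: sum_unfold_sum_mset multiset.map_comp o_def)
  also have "\<dots> = (\<Sum>E\<in>edges. wave (edge_type E) i)" by (rule sum.cong) (auto simp: edge_singularity(3))
  finally show ?thesis .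
qed

lemma sum_basket_wave: "(\<Sum>s\<in>#basket P. wave s i) = (\<Sum>s\<in>#cones P. wave s i)"
proof -
  have "(\<Sum>s\<in>#image_mset residue {#s \<in># A. width s mod local_index s \<noteq> 0#}. wave s i) = (\<Sum>s\<in>#A. wave s i)"
    if "\<forall>s\<in>#A. cyclic_quotient s" for A
    using that
  proof (induction A)
    case (add s A)
    then show ?case using residue_invariants(4)[of s] wave_T_singularity[of s i]
      by (cases "width s mod local_index s = 0") (simp_all del: wave.simps width.simps local_index.simps residue.simps)
  qed simp
  then show ?thesis unfolding basket_def using cones_cyclic_quotient by blast
qed

lemma basket_R_singularities: "\<forall>s\<in>#basket P. cyclic_quotient s \<and> R_singularity s"
  unfolding basket_def using cones_cyclic_quotient residue_invariants by auto

text \<open>Residues and T-parts keep the local index of their cone, and each cone leaves at least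
  one of them behind.\<close>

lemma local_indices_eq:
  "local_index ` set_mset (basket P + T_singularities P) = local_index ` set_mset (cones P)"
proof (intro equalityI subsetI)
  fix l assume "l \<in> local_index ` set_mset (basket P + T_singularities P)"
  then obtain t where t: "t \<in># basket P + T_singularities P" "l = local_index t" by blast
  then consider s where "s \<in># cones P" "width s mod local_index s \<noteq> 0" "t = residue s"
    | s where "s \<in># cones P" "t \<in># replicate_mset (T_multiplicity s) (T_part s)"
    unfolding basket_def T_singularities_def by auto
  then show "l \<in> local_index ` set_mset (cones P)"
  proof cases
    case 1
    then have "l = local_index s" using t residue_invariants(2) cones_cyclic_quotient by simp
    then show ?thesis using 1 by blast
  next
    case 2
    then have "t = T_part s" by (auto split: if_splits)
    then have "l = local_index s" using t T_part_local_index 2 cones_cyclic_quotient by simp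
    then show ?thesis using 2 by blast
  qed
next
  fix l assume "l \<in> local_index ` set_mset (cones P)"
  then obtain s where s: "s \<in># cones P" "l = local_index s" by blast
  have cq: "cyclic_quotient s" using s cones_cyclic_quotient by blast
  show "l \<in> local_index ` set_mset (basket P + T_singularities P)"
  proof (cases "width s mod local_index s = 0")
    case False
    then have "residue s \<in># basket P" using s(1) unfolding basket_def by auto
    moreover have "local_index (residue s) = l" using residue_invariants(2)[OF cq False] s by simp
    ultimately show ?thesis by (metis image_eqI union_iff)
  next
    case True
    \<comment> \<open>The width is positive and divisible by the local index, so the quotient is at
      least 1.\<close>
    then have "T_multiplicity s \<noteq> 0" using width_pos[OF cq] local_index_pos[OF cq]
      by (metis T_multiplicity_def div_eq_0_iff gr_implies_not0 mod_less)
    then have "T_part s \<in># T_singularities P" unfolding T_singularities_def using s(1) by auto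
    moreover have "local_index (T_part s) = l" using T_part_local_index[OF cq] s by simp
    ultimately show ?thesis by (metis image_eqI union_iff)
  qed
qed

end

theorem theorem3p4:
  fixes P :: "(real ^ 2) set" and d :: nat and B IB RB T :: "singularity multiset"
  assumes "fano_polygon P"
    and "singularity_content P = (d, B)"
    and "invisible_basket IB B"
    and "RB = B - IB"
    and "T = T_singularities P"
  shows "quasi_period (dual_polygon P) = Lcm {local_index \<sigma> | \<sigma>. \<sigma> \<in># RB} \<and>
    (quasi_period_collapse (dual_polygon P) \<longleftrightarrow>
      (\<exists>\<tau>. \<tau> \<in># IB + T \<and> \<not> local_index \<tau> dvd Lcm {local_index \<sigma> | \<sigma>. \<sigma> \<in># RB})) \<and>
    denominator (dual_polygon P) =
      Lcm ({quasi_period (dual_polygon P)} \<union> {local_index \<sigma> | \<sigma>. \<sigma> \<in># IB + T})"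
proof -
  interpret fano P by unfold_locales (rule assms(1))
  have B: "B = basket P" using assms(2) by (simp add: singularity_content_def)
  have Bcq: "\<forall>s\<in>#B. cyclic_quotient s \<and> R_singularity s" unfolding B by (rule basket_R_singularities)
  have IBB: "IB \<subseteq># B" and inv: "invisible IB" using assms(3) by (auto simp: invisible_basket_def)
  have Bsplit: "B = IB + RB" using IBB assms(4) by simp
  have IBcq: "\<forall>s\<in>#IB. cyclic_quotient s" and RBcq: "\<forall>s\<in>#RB. cyclic_quotient s" using Bcq Bsplit by auto
  have wave_RB: "(\<Sum>E\<in>edges. wave (edge_type E) i) = (\<Sum>s\<in>#RB. wave s i)" for i
    using sum_basket_wave[of i] sum_cones_wave[of i] invisible_wave[OF inv IBcq, of i]
    unfolding B[symmetric] by (simp add: Bsplit del: wave.simps)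
  define L where "L = Lcm {local_index \<sigma> | \<sigma>. \<sigma> \<in># RB}"
  have sets: "{local_index \<sigma> | \<sigma>. \<sigma> \<in># M} = local_index ` set_mset M" for M by blast
  have L0: "L > 0"
  proof -
    have "0 \<notin> local_index ` set_mset RB"
    proof
      assume "0 \<in> local_index ` set_mset RB"
      then obtain s where "s \<in># RB" "local_index s = 0" by (metis imageE)
      then show False using local_index_pos[of s] RBcq by auto
    qed
    then have "L \<noteq> 0" unfolding L_def sets using Lcm_0_iff[of "local_index ` set_mset RB"] by blast
    then show ?thesis by (simp only: neq0_conv)
  qed
  have dvdL: "local_index s dvd L" if "s \<in># RB" for s unfolding L_def sets using that by (intro dvd_Lcm imageI)
  have qp: "quasi_period (dual_polygon P) = L"
    unfolding quasi_period_def
  proof (rule Least_equality)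
    have "(\<Sum>s\<in>#RB. wave s (i + L)) = (\<Sum>s\<in>#RB. wave s i)" for i
      using wave_period RBcq dvdL by (intro arg_cong[where f = sum_mset] image_mset_cong) blast
    then show "L > 0 \<and> quasi_polynomial_of_period (ehrhart (dual_polygon P)) L"
      using L0 by (simp only: quasi_polynomial_of_period_dual_iff wave_RB simp_thms)
  next
    fix p assume p: "p > 0 \<and> quasi_polynomial_of_period (ehrhart (dual_polygon P)) p"
    then have per: "(\<Sum>s\<in>#RB. wave s (i + p)) = (\<Sum>s\<in>#RB. wave s i)" for i
      using quasi_polynomial_of_period_dual_iff wave_RB by metis
    \<comment> \<open>Minimality holds in the stronger form that every period is a multiple of
      \<open>L\<close>.\<close>
    have "local_index s dvd p" if "s \<in># RB" for s
      using reduced_period[OF Bcq assms(3,4) _ per that] p by blast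
    then have "L dvd p" unfolding L_def sets by (intro Lcm_least) blast
    then show "L \<le> p" using p by (intro dvd_imp_le) auto
  qed
  have "denominator (dual_polygon P) = Lcm (local_index ` set_mset (cones P))"
    unfolding denominator_dual cones_eq using finite_edges edge_singularity(2)
    by (intro arg_cong[where f = Lcm]) (auto simp del: local_index.simps simp: image_image)
  also have "\<dots> = Lcm (local_index ` set_mset RB \<union> local_index ` set_mset (IB + T))"
    unfolding local_indices_eq[symmetric] B[symmetric] assms(5) Bsplit
    by (simp add: image_Un Un_ac)
  also have "\<dots> = Lcm ({L} \<union> local_index ` set_mset (IB + T))"
    unfolding L_def sets Lcm_Un by simp
  finally have den: "denominator (dual_polygon P) = Lcm ({L} \<union> local_index ` set_mset (IB + T))" .
  have "L \<noteq> Lcm ({L} \<union> local_index ` set_mset (IB + T)) \<longleftrightarrow> (\<exists>\<tau>. \<tau> \<in># IB + T \<and> \<not> local_index \<tau> dvd L)"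
  proof
    assume ne: "L \<noteq> Lcm ({L} \<union> local_index ` set_mset (IB + T))"
    show "\<exists>\<tau>. \<tau> \<in># IB + T \<and> \<not> local_index \<tau> dvd L"
    proof (rule ccontr)
      assume "\<not> (\<exists>\<tau>. \<tau> \<in># IB + T \<and> \<not> local_index \<tau> dvd L)"
      then have "Lcm ({L} \<union> local_index ` set_mset (IB + T)) dvd L"
        using dvd_refl[of L] by (intro Lcm_least) blast
      moreover have "L dvd Lcm ({L} \<union> local_index ` set_mset (IB + T))" by (intro dvd_Lcm) auto
      ultimately show False using ne by (metis dvd_antisym)
    qed
  next
    assume "\<exists>\<tau>. \<tau> \<in># IB + T \<and> \<not> local_index \<tau> dvd L"
    then obtain \<tau> where t: "\<tau> \<in># IB + T" "\<not> local_index \<tau> dvd L" by blast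
    have "local_index \<tau> dvd Lcm ({L} \<union> local_index ` set_mset (IB + T))"
      using t(1) by (intro dvd_Lcm UnI2 imageI)
    then show "L \<noteq> Lcm ({L} \<union> local_index ` set_mset (IB + T))" using t(2) by metis
  qed
  then show ?thesis unfolding quasi_period_collapse_def qp den L_def[symmetric] unfolding sets by blast
qed

end
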